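(* (Weighted sum formula) For any integers $k,n$ with $k>n\ge2$, $$\sum_{\mathbf{k}\in I^0_{k,n}}\widetilde{\mathcal{C}}(\widetilde{\mathbf{k}})\zeta^t(\mathbf{k})-t\sum_{\mathbf{k}\in I^0_{k,n-1}}\big(\widetilde{\mathcal{C}}(\mathbf{k})-\widetilde{\mathcal{C}}(\widetilde{\mathbf{k}})\big)\zeta^t(\mathbf{k})+(t-t^2)\sum_{\mathbf{k}\in I^0_{k,n-2}}b_{\mathbf{k}}\zeta^t(\mathbf{k})$$ $$=\left\{\sum_{i=1}^{n-2}\left[k\binom{k-1}{i}-(k-n+1)\binom{k-1}{i-1}\right]t^i(1-t)^{n-1-i}+k(1-t)^{n-1}+\binom{k-1}{n-1}t^{n-1}\right\}\zeta(k).$$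
   Context: An index is a finite sequence of positive integers; $I_{k,n}$ is the set of indices $(k_1,\ldots,k_n)$ of length $n$ with $k_1+\cdots+k_n=k$, and $I^0_{k,n}$ its subset with $k_1\ge2$; $I^0_{k,0}$ (the case $n=2$ of $I^0_{k,n-2}$) is empty. For an index $\mathbf k=(k_1,\ldots,k_n)$, $\mathcal{C}(\mathbf{k})=\sum_{j=1}^n2^{k_1+\cdots+k_j-j}+2^{k_1+\cdots+k_n-n}$, with $\mathcal C$ of the empty index equal to $1$, and $\widetilde{\mathcal C}(\mathbf k)=\mathcal C(k_1,\ldots,k_n)-\mathcal C(k_2,\ldots,k_n)$. For an index $\mathbf{k}=(k_1,\ldots,k_l)$ with $l\ge2$, $\widetilde{\mathbf k}=(k_1,\ldots,k_{l-1})$; for a length-one index $\mathbf k=(k)$ one sets $\widetilde{\mathcal C}(\widetilde{\mathbf k})=k$. For $n>2$ and $\mathbf k\in I^0_{k,n-2}$, $b_{\mathbf k}=\binom{k_1-2}{2}+\binom{k_2-1}{2}+\cdots+\binom{k_{n-2}-1}{2}$. For $k_1\ge2$, $\zeta(k_1,\ldots,k_n)=\sum_{m_1>\cdots>m_n>0}\prod m_j^{-k_j}$ and $\zeta^t(k_1,\ldots,k_n)=\sum_{\mathbf p}t^{n-\mathrm{dep}(\mathbf p)}\zeta(\mathbf p)$, summed over all sequences $\mathbf p$ obtained from $(k_1,\ldots,k_n)$ by replacing each separating comma by a comma or a plus sign ($\mathrm{dep}$ = length). *)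

theory Defs
  imports "HOL-Analysis.Analysis"
begin

definition I_set :: "nat \<Rightarrow> nat \<Rightarrow> nat list set" where
  "I_set k n = {ks. length ks = n \<and> (\<forall>x\<in>set ks. 0 < x) \<and> sum_list ks = k}"

definition I0_set :: "nat \<Rightarrow> nat \<Rightarrow> nat list set" where
  "I0_set k n = {ks. ks \<in> I_set k n \<and> ks \<noteq> [] \<and> 2 \<le> hd ks}"

definition mzv :: "nat list \<Rightarrow> real" where
  "mzv ks = infsum (\<lambda>ms. \<Prod>j<length ks. 1 / real (ms ! j) ^ (ks ! j))
     {ms :: nat list. length ms = length ks \<and> sorted_wrt (>) ms \<and> (\<forall>m\<in>set ms. 0 < m)}"

text \<open>All sequences obtained by replacing each separating comma by a comma or a plus
  sign (listed with multiplicity, one entry per choice).\<close>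
function collapses :: "nat list \<Rightarrow> nat list list" where
  "collapses [] = [[]]"
| "collapses [a] = [[a]]"
| "collapses (a # b # rest) = map ((#) a) (collapses (b # rest)) @ collapses ((a + b) # rest)"
  by pat_completeness auto
termination by (relation "Wellfounded.measure length") auto

definition zeta_t :: "real \<Rightarrow> nat list \<Rightarrow> real" where
  "zeta_t t ks = sum_list (map (\<lambda>p. t ^ (length ks - length p) * mzv p) (collapses ks))"

definition Cf :: "nat list \<Rightarrow> int" where
  "Cf ks = (\<Sum>j=1..length ks. 2 ^ (sum_list (take j ks) - j)) + 2 ^ (sum_list ks - length ks)"

definition Ct :: "nat list \<Rightarrow> int" where
  "Ct ks = Cf ks - Cf (tl ks)"

text \<open>Ctilde of ktilde; for a length-one index (k) it is set to k.\<close>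
definition Ct_tilde :: "nat list \<Rightarrow> int" where
  "Ct_tilde ks = (if length ks = 1 then int (hd ks) else Ct (butlast ks))"

definition b_coef :: "nat list \<Rightarrow> nat" where
  "b_coef ks = ((hd ks - 2) choose 2) + (\<Sum>x\<leftarrow>tl ks. (x - 1) choose 2)"

end

theory Submission
  imports Defs "HOL-Computational_Algebra.Formal_Laurent_Series" "HOL-Real_Asymp.Real_Asymp"
begin

text \<open>
  Fix \<open>k\<close> and pass to generating functions: a letter \<open>k\<^sub>i\<close> at the integer \<open>m\<close> contributes
  \<open>y / (m - z)\<close>, or \<open>y / (m - 2 z)\<close> where a factor \<open>2 ^ (k\<^sub>i - 1)\<close> occurs, with
  \<open>y = \<mu> z\<close> and \<open>\<mu>\<close> a real number marking the depth. Ties between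
  neighbouring summation variables weighted by \<open>t\<close> replace \<open>z\<close> by \<open>a = z + t y\<close> and
  \<open>2 z\<close> by \<open>b = 2 z + t y\<close>. With \<open>v = a - y\<close> and \<open>c\<^sub>m = (\<Prod>l<m. l - v) / (\<Prod>l\<le>m. l - a)\<close>,
  the shuffle product of a single letter with a chain turns the \<open>2\<close>-weighted sums into
  \<open>(\<Sum>m. z c\<^sub>m / m * (\<Sum>l\<le>m. 1 / (l - z)))\<close>; the terms weighted by \<open>t\<close> on the left-hand side are
  exactly the tie terms of this product, and those weighted by \<open>b_coef\<close> convert \<open>1 / (l - z)\<close> into a
  logarithmic derivative of \<open>c\<^sub>m\<close>. What remains is the sum formula
  \<open>(\<Sum>m. c\<^sub>m / m) = (\<Sum>m. 1 / ((m - a) * (m - y)))\<close> and its derivative in the direction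
  \<open>a' = 1 - t\<close>, \<open>y' = 1\<close>, both of which follow from one telescoping double sum.
  All identities are proved for sums truncated at \<open>N\<close>, in the field of formal Laurent series in \<open>z\<close>;
  the coefficients of the error terms are \<open>O((log N)\<^sup>2 / sqrt N)\<close>. Finally the powers of \<open>\<mu>\<close> are compared.
\<close>

section \<open>Truncated chain sums in a field\<close>

text \<open>The factor 2 stems from \<open>Cf (k # ks) = 2 ^ (k - 1) * (1 + Cf ks)\<close>:
  unrolled, each weight doubles an initial stretch of letters and leaves the rest plain. The
  obstacle is that denominators \<open>m - 2 z\<close> do not occur on the right-hand side. They are
  removed by \<open>(m + n) - b = (m - z) + (n - a)\<close>, which lets the doubled stretch be
  summed against one plain letter and one plain chain. The direction of differentiation is forced.
  The partial fractions of \<open>(t - t^2) y^2 / ((m - z) (m - a) (m - v))\<close> have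
  coefficients \<open>-1\<close>, \<open>1 - t\<close>, \<open>t\<close>. The last two form the
  logarithmic derivative of \<open>c\<close> precisely for \<open>a' = 1 - t\<close> and
  \<open>v' = - t\<close>, hence \<open>y' = 1\<close>; the first cancels the sum of
  \<open>1 / (l - z)\<close> left by the shuffle product. No derivative is taken in the field
  itself: the differentiated identities are written out with explicit logarithmic derivatives and
  checked by algebra. With the cut-off \<open>N\<close> every rearrangement is finite, so the only
  limit is that of one fixed coefficient.\<close>

text \<open>Positions are shifted by one: the index \<open>m\<close> stands for the integer \<open>q m = m + 1\<close>.\<close>

locale chain_params =
  fixes z y t :: "'a::field_char_0" and q :: "nat \<Rightarrow> 'a" and a b v :: 'a
  defines "q \<equiv> \<lambda>m. of_nat (Suc m)"
    and "a \<equiv> z + t * y" and "b \<equiv> 2 * z + t * y" and "v \<equiv> z + t * y - y"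
  assumes nz_z: "\<And>m. q m - z \<noteq> 0"
    and nz_2z: "\<And>m. q m - 2 * z \<noteq> 0"
    and nz_a: "\<And>m. q m - a \<noteq> 0"
    and nz_b: "\<And>m. q m - b \<noteq> 0"
    and nz_v: "\<And>m. q m - v \<noteq> 0"
    and nz_y: "\<And>m. q m - y \<noteq> 0"
begin

lemma q_nz: "q m \<noteq> 0"
  unfolding q_def by (metis of_nat_neq_0)

definition h :: "nat \<Rightarrow> 'a" where
  "h m = (\<Prod>l<m. (q l - v) / (q l - a))"

definition c :: "nat \<Rightarrow> 'a" where
  "c m = h m / (q m - a)"

lemma h_0 [simp]: "h 0 = 1"
  by (simp add: h_def)

lemma h_eq_c: "h m = (q m - a) * c m"
  using nz_a by (simp add: c_def)

lemma h_Suc: "h (Suc m) = (q m - v) * c m"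
  by (simp add: h_def c_def)

text \<open>\<open>H m\<close> collects the letters strictly below \<open>m\<close>. Solving for the
  tie at \<open>m\<close> gives \<open>G m = H m * (q m - z) / (q m - a)\<close>, and then
  \<open>H\<close> gains the factor \<open>(q m - v) / (q m - a)\<close> at each step, exactly as
  \<open>h\<close> does.\<close>

lemma single_chain_unique:
  assumes "\<And>m. G m = 1 + t * (y / (q m - z) * G m) + (\<Sum>l<m. y / (q l - z) * G l)"
  shows "G m = (q m - z) * c m"
proof -
  define H where "H m = 1 + (\<Sum>l<m. y / (q l - z) * G l)" for m
  have "(q m - a) * G m = (q m - z) * H m" for m
  proof -
    have "G m = H m + t * (y / (q m - z) * G m)"
      using assms[of m] by (simp add: H_def add_ac)
    then have "(q m - z) * G m = (q m - z) * (H m + t * (y / (q m - z) * G m))" by simp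
    also have "\<dots> = (q m - z) * H m + t * y * G m"
      using nz_z[of m] by (simp add: distrib_left)
    finally show ?thesis by (simp add: a_def algebra_simps)
  qed
  then have G: "G m = (q m - z) * (H m / (q m - a))" for m
    using nz_a[of m] by (simp add: eq_divide_eq mult.commute)
  have "H m = h m" for m
  proof (induction m)
    case (Suc m)
    have "H (Suc m) = H m + y / (q m - z) * G m" by (simp add: H_def)
    also have "\<dots> = ((q m - a) + y) * (H m / (q m - a))"
      using nz_z[of m] nz_a[of m] by (simp add: G distrib_right add_divide_distrib)
    also have "(q m - a) + y = q m - v" by (simp add: a_def v_def)
    finally show ?case using Suc by (simp add: h_def)
  qed (simp add: H_def)
  then show ?thesis by (simp add: G c_def)
qed

text \<open>\<open>X N m\<close> is the generating function of the part of a chain bounded by \<open>N\<close> that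
  lies strictly above \<open>m\<close> and whose letters have weight \<open>2 * z\<close>.\<close>

primrec X_rev :: "nat \<Rightarrow> nat \<Rightarrow> 'a" where
  "X_rev N 0 = 0"
| "X_rev N (Suc d) =
    (z / (q (N - Suc d) - z) + (q (N - Suc d) - b + y) * X_rev N d) / (q (N - Suc d) - b)"

definition X :: "nat \<Rightarrow> nat \<Rightarrow> 'a" where
  "X N m = X_rev N (N - m)"

lemma X_end: "N \<le> m \<Longrightarrow> X N m = 0"
  by (simp add: X_def)

text \<open>The difference counts the chains whose lowest letter sits at \<open>m\<close>. That
  letter is the top letter as well, with weight \<open>2 ^ (k - 1) - 1\<close> and one factor
  \<open>y\<close> divided out, or it lies below others; ties at \<open>m\<close> turn
  \<open>q m - 2 * z\<close> into \<open>q m - b\<close>.\<close>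

lemma X_rec:
  assumes "m < N"
  shows "(q m - b) * (X N m - X N (Suc m)) = z / (q m - z) + y * X N (Suc m)"
proof -
  have N: "N - m = Suc (N - Suc m)" using assms by simp
  have "X N m = (z / (q m - z) + (q m - b + y) * X N (Suc m)) / (q m - b)"
    unfolding X_def N X_rev.simps using assms by simp
  then show ?thesis using nz_b[of m] by (simp add: field_simps)
qed

lemma sum_lessThan_eq_telescope:
  fixes F :: "nat \<Rightarrow> 'a"
  assumes "\<And>m. m < N \<Longrightarrow> f m = F m - F (Suc m) + g m"
  shows "(\<Sum>m<N. f m) = F 0 - F N + (\<Sum>m<N. g m)"
  using assms
proof (induction N)
  case (Suc N)
  have "(\<Sum>m<N. f m) = F 0 - F N + (\<Sum>m<N. g m)" by (rule Suc.IH) (simp add: Suc.prems)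
  then show ?case using Suc.prems[of N] by simp
qed simp

text \<open>\<open>X\<close> solves the adjoint of the recurrence of \<open>G\<close>, from
  \<open>N\<close> downwards, so its pairing with the strict part \<open>W\<close> telescopes and
  only the starting value \<open>c0\<close> and the sources \<open>\<eta>\<close> survive. A source
  at \<open>m\<close> sees all letters above it, those tied with it with weight \<open>t\<close>;
  hence \<open>t * X N m + (1 - t) * X N (Suc m)\<close>.\<close>

lemma double_chain_sum:
  assumes G: "\<And>m. G m = c0 + t * (y / (q m - 2 * z) * G m + \<eta> m)
      + (\<Sum>l<m. y / (q l - 2 * z) * G l + \<eta> l)"
  shows "(\<Sum>m<N. (y / (q m - 2 * z) - y / (q m - z)) * G m)
    = y * (c0 * X N 0 + (\<Sum>m<N. \<eta> m * (t * X N m + (1 - t) * X N (Suc m))))"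
proof -
  define W where "W m = c0 + (\<Sum>l<m. y / (q l - 2 * z) * G l + \<eta> l)" for m
  have Gm: "(q m - b) * G m = (q m - 2 * z) * (W m + t * \<eta> m)" for m
  proof -
    have "G m = W m + t * (y / (q m - 2 * z) * G m + \<eta> m)"
      using G[of m] by (simp add: W_def algebra_simps)
    then have "(q m - 2 * z) * G m = (q m - 2 * z) * (W m + t * (y / (q m - 2 * z) * G m + \<eta> m))"
      by simp
    also have "\<dots> = (q m - 2 * z) * (W m + t * \<eta> m) + t * y * G m"
      using nz_2z[of m] by (simp add: field_simps)
    finally show ?thesis by (simp add: b_def algebra_simps)
  qed
  have Gm': "G m = (q m - 2 * z) * (W m + t * \<eta> m) / (q m - b)" for m
    using Gm[of m] nz_b[of m] by (simp add: field_simps)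
  have step: "(y / (q m - 2 * z) - y / (q m - z)) * G m
      = y * X N m * W m - y * X N (Suc m) * W (Suc m)
        + y * (\<eta> m * (t * X N m + (1 - t) * X N (Suc m)))" if "m < N" for m
  proof -
    define x x' w e \<zeta> D g where "x = X N m" and "x' = X N (Suc m)" and "w = W m" and "e = \<eta> m"
      and "\<zeta> = z / (q m - z)" and "D = q m - b" and "g = G m / (q m - 2 * z)"
    have D: "D \<noteq> 0" using nz_b by (simp add: D_def)
    have x: "D * x = \<zeta> + (D + y) * x'"
      using X_rec[OF that] by (simp add: x_def x'_def \<zeta>_def D_def algebra_simps)
    have g: "D * g = w + t * e"
      using Gm[of m] nz_2z[of m] by (simp add: g_def D_def w_def e_def field_simps)
    have G: "G m = (q m - 2 * z) * g" using nz_2z[of m] by (simp add: g_def)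
    have "(y / (q m - 2 * z) - y / (q m - z)) * G m = y * \<zeta> * g"
      unfolding G \<zeta>_def using nz_2z[of m] nz_z[of m]
      by (simp add: divide_simps) (simp add: algebra_simps)
    moreover have "W (Suc m) = w + y * g + e"
      by (simp add: W_def w_def g_def e_def)
    moreover have "y * \<zeta> * g = y * x * w - y * x' * (w + y * g + e) + y * (e * (t * x + (1 - t) * x'))"
    proof -
      have "D * (y * \<zeta> * g) = y * \<zeta> * (D * g)" by (simp add: algebra_simps)
      also have "\<dots> = y * (D * x) * w - y * x' * (D * w + y * (D * g) + D * e)
          + y * (e * (t * (D * x) + (1 - t) * x' * D))"
        unfolding x g by (simp add: algebra_simps)
      also have "\<dots> = D * (y * x * w - y * x' * (w + y * g + e) + y * (e * (t * x + (1 - t) * x')))"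
        by (simp add: algebra_simps)
      finally show ?thesis using D by simp
    qed
    ultimately show ?thesis unfolding x_def x'_def w_def e_def by simp
  qed
  have "(\<Sum>m<N. (y / (q m - 2 * z) - y / (q m - z)) * G m)
      = y * X N 0 * W 0 - y * X N N * W N
        + (\<Sum>m<N. y * (\<eta> m * (t * X N m + (1 - t) * X N (Suc m))))"
    by (rule sum_lessThan_eq_telescope) (rule step)
  then show ?thesis
    by (simp add: X_end W_def sum_distrib_left algebra_simps)
qed

text \<open>\<open>h m * X N m\<close> telescopes: by the recurrence of \<open>X\<close> and
  \<open>b = a + z\<close>, its differences are the summand on the left plus an explicit term. This
  sum and the next one evaluate the tie terms of the weighted identity.\<close>

lemma X_diff_c_sum:
  "(\<Sum>m<N. z * c m * (X N m - X N (Suc m))) = X N 0 - (\<Sum>m<N. z * c m / (q m - z))"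
proof -
  have "z * c m * (X N m - X N (Suc m)) = h m * X N m - h (Suc m) * X N (Suc m) + - (z * c m / (q m - z))"
    if "m < N" for m
  proof -
    have "h m * X N m - h (Suc m) * X N (Suc m)
        = c m * ((q m - b) * (X N m - X N (Suc m)) - y * X N (Suc m)) + z * c m * (X N m - X N (Suc m))"
      unfolding h_Suc h_eq_c[of m] by (simp add: a_def b_def v_def algebra_simps)
    also have "\<dots> = z * c m / (q m - z) + z * c m * (X N m - X N (Suc m))"
      unfolding X_rec[OF that] by (simp add: mult.commute)
    finally show ?thesis by simp
  qed
  from sum_lessThan_eq_telescope[of N _ "\<lambda>m. h m * X N m", OF this]
  show ?thesis by (simp add: X_end sum_negf)
qed

lemma X_diff_z_sum:
  "(\<Sum>m<N. a / (q m - z) * (X N m - X N (Suc m)) + y / (q m - z) * X N (Suc m))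
    = X N 0 - (\<Sum>m<N. z / (q m - z) ^ 2)"
proof -
  have "a / (q m - z) * (X N m - X N (Suc m)) + y / (q m - z) * X N (Suc m)
      = X N m - X N (Suc m) + - (z / (q m - z) ^ 2)" if "m < N" for m
  proof -
    define P where "P = q m - z"
    have P: "P \<noteq> 0" using nz_z by (simp add: P_def)
    have "P * (X N m - X N (Suc m)) = a * (X N m - X N (Suc m)) + (z / P + y * X N (Suc m))"
      unfolding P_def X_rec[OF that, symmetric] by (simp add: a_def b_def algebra_simps)
    then have "X N m - X N (Suc m) = (a * (X N m - X N (Suc m)) + (z / P + y * X N (Suc m))) / P"
      using P by (simp add: eq_divide_eq mult.commute)
    moreover have "a / P * (X N m - X N (Suc m)) + y / P * X N (Suc m)
        = (a * (X N m - X N (Suc m)) + (z / P + y * X N (Suc m))) / P + - (z / P ^ 2)"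
      by (simp add: add_divide_distrib power2_eq_square)
    ultimately show ?thesis unfolding P_def[symmetric] by simp
  qed
  from sum_lessThan_eq_telescope[of N _ "X N", OF this]
  show ?thesis by (simp add: X_end sum_negf)
qed

text \<open>The shuffle product of a single letter and a chain: \<open>X\<close> solves a recurrence in which
  \<open>q (m + n + 1) - b\<close> splits as \<open>(q m - z) + (q n - a)\<close>, and each part telescopes.\<close>

lemma shuffle_sum:
  "(\<Sum>m<N. X N (Suc m) * (c m + 1 / (q m - z)))
    = (\<Sum>n<N. \<Sum>m<N - Suc n. z * c n / ((q m - z) * (q (m + n + 1) - z)))"
proof -
  \<comment> \<open>Beyond \<open>N\<close> the inhomogeneity of the recurrence is set to 0, in
    accordance with \<open>X N p = 0\<close> there. The triangle of the claim thus becomes a square,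
    over which both orders of summation are available.\<close>
  define R where "R p = (if p < N then z / (q p - z) else 0)" for p
  have R: "R p = (q p - b) * (X N p - X N (Suc p)) - y * X N (Suc p)" for p
    using X_rec[of p N] by (simp add: R_def X_end)
  have step: "c n / (q m - z) * R (m + n + 1)
      = c n * (X N (m + n + 1) - X N (Suc m + n + 1))
        + 1 / (q m - z) * (h n * X N (m + n + 1) - h (Suc n) * X N (m + Suc n + 1))" for m n
  proof -
    have q: "q (m + n + 1) - b = (q m - z) + (q n - a)"
      by (simp add: q_def a_def b_def)
    have "c n * R (m + n + 1) = (q m - z) * (c n * (X N (m + n + 1) - X N (Suc m + n + 1)))
        + (h n * X N (m + n + 1) - h (Suc n) * X N (m + Suc n + 1))"
      unfolding R q h_Suc h_eq_c[of n] by (simp add: a_def v_def algebra_simps)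
    then show ?thesis using nz_z[of m] by (simp add: field_simps)
  qed
  have "(\<Sum>n<N. \<Sum>m<N. c n / (q m - z) * R (m + n + 1))
      = (\<Sum>n<N. \<Sum>m<N. c n * (X N (m + n + 1) - X N (Suc m + n + 1)))
        + (\<Sum>n<N. \<Sum>m<N. 1 / (q m - z) * (h n * X N (m + n + 1) - h (Suc n) * X N (m + Suc n + 1)))"
    by (simp only: step sum.distrib)
  also have "(\<Sum>n<N. \<Sum>m<N. c n * (X N (m + n + 1) - X N (Suc m + n + 1)))
      = (\<Sum>n<N. c n * X N (Suc n))"
  proof (rule sum.cong[OF refl])
    fix n
    have "(\<Sum>m<N. X N (m + n + 1) - X N (Suc m + n + 1)) = X N (0 + n + 1) - X N (N + n + 1)"
      by (rule sum_lessThan_telescope'[of "\<lambda>m. X N (m + n + 1)"])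
    then show "(\<Sum>m<N. c n * (X N (m + n + 1) - X N (Suc m + n + 1))) = c n * X N (Suc n)"
      by (simp only: sum_distrib_left[symmetric]) (simp add: X_end)
  qed
  also have "(\<Sum>n<N. \<Sum>m<N. 1 / (q m - z) * (h n * X N (m + n + 1) - h (Suc n) * X N (m + Suc n + 1)))
      = (\<Sum>m<N. 1 / (q m - z) * X N (Suc m))"
  proof (subst sum.swap, rule sum.cong[OF refl])
    fix m
    have "(\<Sum>n<N. h n * X N (m + n + 1) - h (Suc n) * X N (m + Suc n + 1))
        = h 0 * X N (m + 0 + 1) - h N * X N (m + N + 1)"
      by (rule sum_lessThan_telescope'[of "\<lambda>n. h n * X N (m + n + 1)"])
    then show "(\<Sum>n<N. 1 / (q m - z) * (h n * X N (m + n + 1) - h (Suc n) * X N (m + Suc n + 1)))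
        = 1 / (q m - z) * X N (Suc m)"
      by (simp only: sum_distrib_left[symmetric]) (simp add: X_end)
  qed
  finally have eq: "(\<Sum>n<N. \<Sum>m<N. c n / (q m - z) * R (m + n + 1))
      = (\<Sum>m<N. X N (Suc m) * (c m + 1 / (q m - z)))"
    by (simp add: sum.distrib[symmetric] distrib_left mult.commute)
  have "(\<Sum>m<N. c n / (q m - z) * R (m + n + 1))
      = (\<Sum>m<N - Suc n. z * c n / ((q m - z) * (q (m + n + 1) - z)))" for n
    by (rule sum.mono_neutral_cong_right) (auto simp: R_def mult.commute)
  then show ?thesis by (simp add: eq[symmetric])
qed

definition A :: "nat \<Rightarrow> 'a" where
  "A n = (\<Sum>l<n. 1 / (q l - z))"

text \<open>Partial fractions leave two copies of one sum, shifted by \<open>n + 1\<close>, so only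
  the two ends remain. The upper end \<open>A N - A (N - Suc n)\<close> is the price of the
  cut-off.\<close>

lemma shuffle_inner_sum:
  assumes "n < N"
  shows "(\<Sum>m<N - Suc n. z * c n / ((q m - z) * (q (m + n + 1) - z)))
    = z * c n / q n * (A (Suc n) - (A N - A (N - Suc n)))"
proof -
  have "z * c n / ((q m - z) * (q (m + n + 1) - z))
      = z * c n / q n * (1 / (q m - z) - 1 / (q (Suc n + m) - z))" for m
  proof -
    have "q (m + n + 1) = q m + q n" "q (Suc n + m) = q m + q n" by (simp_all add: q_def)
    moreover have "q m + q n - z \<noteq> 0" using nz_z[of "m + n + 1"] calculation by simp
    ultimately show ?thesis using nz_z[of m] q_nz[of n]
      by (simp add: diff_frac_eq)
  qed
  then have "(\<Sum>m<N - Suc n. z * c n / ((q m - z) * (q (m + n + 1) - z)))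
      = z * c n / q n * (A (N - Suc n) - (\<Sum>m<N - Suc n. 1 / (q (Suc n + m) - z)))"
    by (simp only: sum_distrib_left[symmetric] sum_subtractf A_def)
  also have "(\<Sum>m<N - Suc n. 1 / (q (Suc n + m) - z)) = A N - A (Suc n)"
  proof -
    have "A (k + m) = A k + (\<Sum>i<m. 1 / (q (k + i) - z))" for k m
      by (induction m) (simp_all add: A_def)
    from this[of "Suc n" "N - Suc n"] show ?thesis using assms by simp
  qed
  finally show ?thesis by simp
qed

lemma shuffle_sum':
  "(\<Sum>m<N. X N (Suc m) * (c m + 1 / (q m - z)))
    = (\<Sum>n<N. z * c n / q n * (A (Suc n) - (A N - A (N - Suc n))))"
  unfolding shuffle_sum by (intro sum.cong refl shuffle_inner_sum) simp

text \<open>Logarithmic derivative of \<open>kappa j n\<close> along \<open>a' = 1 - t\<close>,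
  \<open>v' = - t\<close>. Since \<open>kappa 0 n = c n\<close>, the case \<open>j = 0\<close> is
  that of \<open>c n\<close>.\<close>

definition "log_deriv j n = (1 - t) * (\<Sum>i\<le>n. 1 / (q (j + i) - a)) + t * (\<Sum>l<n. 1 / (q l - v))"

text \<open>Found by variation of constants: the strict part of a chain with one letter marked by
  \<open>(k - 1) choose 2\<close> is \<open>h m\<close> times this sum, each summand being the
  contribution of a mark at \<open>l\<close> divided by \<open>h (Suc l)\<close>.\<close>

definition "b_letter_sum m = (\<Sum>l<m. y * z ^ 2 / ((q l - z) * (q l - a) * (q l - v)))"

text \<open>The left-hand side has the shape delivered by \<open>gen_termA\<close>,
  \<open>gen_termB\<close> and \<open>gen_termD\<close>. The second and third sums of the theorem
  run over shorter indices and are compensated by \<open>\<mu>\<close> and \<open>\<mu> ^ 2\<close>;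
  the relation \<open>y = \<mu> * z\<close> absorbs these powers, so that the three sums can be
  merged.\<close>

theorem weighted_chain_identity:
  fixes \<mu> :: 'a
  assumes y: "y = \<mu> * z"
  shows "(\<Sum>m<N. z * y / q m * (c m - 1 / (q m - z)))
    + y * (\<Sum>m<N. y * (c m + 1 / (q m - z)) * (t * X N m + (1 - t) * X N (Suc m)))
    - t * \<mu> * (y * (2 * X N 0 + (\<Sum>m<N. - (y / (q m - z)) * (t * X N m + (1 - t) * X N (Suc m))))
        - (\<Sum>m<N. y * z / (q m - z) ^ 2))
    + (t - t ^ 2) * \<mu> ^ 2 * (\<Sum>m<N. z / q m * (y * c m * (b_letter_sum m + z ^ 2 / ((q m - z) * (q m - a)))))
    = y * ((z - t * y) * (\<Sum>m<N. c m / q m) + y * z * (\<Sum>m<N. c m / q m * log_deriv 0 m)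
        - (\<Sum>m<N. z / (q m * (q m - z)))
        - y * (\<Sum>n<N. z * c n / q n * (A N - A (N - Suc n))))"
proof -
  let ?D = "\<lambda>m. X N m - X N (Suc m)"
  let ?Y = "\<lambda>m. t * X N m + (1 - t) * X N (Suc m)"
  have Y: "?Y m = X N (Suc m) + t * ?D m" for m by (simp add: algebra_simps)
  \<comment> \<open>The strict part of \<open>?Y\<close> goes into the shuffle sum, the tie part
    \<open>?D\<close> into the two telescoping sums.\<close>
  have 0: "(\<Sum>m<N. y * (c m + 1 / (q m - z)) * ?Y m) - t * \<mu> * (\<Sum>m<N. - (y / (q m - z)) * ?Y m)
      = y * (\<Sum>m<N. X N (Suc m) * (c m + 1 / (q m - z)))
        + t * \<mu> * ((\<Sum>m<N. z * c m * ?D m) + (\<Sum>m<N. a / (q m - z) * ?D m + y / (q m - z) * X N (Suc m)))"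
  proof -
    have "y * (c m + 1 / (q m - z)) * ?Y m - t * \<mu> * (- (y / (q m - z)) * ?Y m)
      = y * (X N (Suc m) * (c m + 1 / (q m - z)))
        + t * \<mu> * (z * c m * ?D m + (a / (q m - z) * ?D m + y / (q m - z) * X N (Suc m)))" for m
    proof -
      have *: "u * (e + i) * (x' + t * (x - x')) - t * r * (- (u * i) * (x' + t * (x - x')))
          = u * (x' * (e + i)) + t * r * (z * e * (x - x') + ((z + t * u) * i * (x - x') + u * i * x'))"
        if "u = r * z" for u r x x' e i
        unfolding that by (simp add: algebra_simps)
      have i: "a / (q m - z) = (z + t * y) * (1 / (q m - z))" "y / (q m - z) = y * (1 / (q m - z))"
        by (simp_all add: a_def)
      show ?thesis unfolding i Y by (rule *) (rule y)
    qed
    then show ?thesis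
      by (simp only: sum_distrib_left sum.distrib[symmetric] sum_subtractf[symmetric])
  qed
  \<comment> \<open>Each of the two telescoping sums yields one \<open>X N 0\<close>; together they
    cancel \<open>2 * X N 0\<close>, whose factor 2 is \<open>wB []\<close>. The sums of
    \<open>1 / (q m - z) ^ 2\<close> cancel too.\<close>
  have 1: "y * (\<Sum>m<N. y * (c m + 1 / (q m - z)) * ?Y m)
      - t * \<mu> * (y * (2 * X N 0 + (\<Sum>m<N. - (y / (q m - z)) * ?Y m)) - (\<Sum>m<N. y * z / (q m - z) ^ 2))
      = y * (y * (\<Sum>n<N. z * c n / q n * (A (Suc n) - (A N - A (N - Suc n))))
         - t * \<mu> * (\<Sum>m<N. z * c m / (q m - z)))"
  proof -
    have s: "(\<Sum>m<N. y * z / (q m - z) ^ 2) = y * (\<Sum>m<N. z / (q m - z) ^ 2)"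
      by (simp add: sum_distrib_left)
    have *: "y * P - t * \<mu> * (y * (2 * X N 0 + Q) - y * S)
      = y * (y * U - t * \<mu> * V)" if "P - t * \<mu> * Q = y * U + t * \<mu> * ((X N 0 - V) + (X N 0 - S))" for P Q U V S
    proof -
      have "y * P - t * \<mu> * (y * (2 * X N 0 + Q) - y * S)
          = y * ((P - t * \<mu> * Q) - t * \<mu> * (2 * X N 0 - S))" by (simp add: algebra_simps)
      then show ?thesis unfolding that by (simp add: algebra_simps)
    qed
    show ?thesis unfolding s
      by (rule *) (simp only: 0 X_diff_c_sum X_diff_z_sum shuffle_sum')
  qed
  have 2: "(t - t ^ 2) * \<mu> ^ 2 * (z / q m * (y * c m * (b_letter_sum m + z ^ 2 / ((q m - z) * (q m - a)))))
      = y * (y * (z * (c m / q m) * (log_deriv 0 m - A (Suc m) + t * (1 / (q m - z)))))" for m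
  proof -
    have yz: "\<mu> ^ 2 * z ^ 2 = y ^ 2" by (simp add: y power_mult_distrib)
    have pf1: "(t - t ^ 2) * (y / ((q m - z) * (q m - a))) = (1 - t) * (1 / (q m - a) - 1 / (q m - z))"
    proof -
      define w where "w = q m - z"
      have "q m - a = w - t * y" by (simp add: w_def a_def)
      moreover have "w \<noteq> 0" "w - t * y \<noteq> 0" using nz_z[of m] nz_a[of m] by (simp_all add: w_def a_def diff_diff_eq)
      ultimately show ?thesis unfolding w_def[symmetric]
        by (simp add: diff_frac_eq) (simp add: divide_simps power2_eq_square algebra_simps)
    qed
    \<comment> \<open>The coefficients \<open>1 - t\<close>, \<open>t\<close>, \<open>-1\<close>
      have sum 0, and weighted by the poles \<open>t * y\<close>, \<open>- (1 - t) * y\<close>,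
      \<open>0\<close> in \<open>w\<close> they again have sum 0; therefore the numerator is
      constant.\<close>
    have pf2: "(t - t ^ 2) * (y ^ 2 / ((q l - z) * (q l - a) * (q l - v)))
        = (1 - t) * (1 / (q l - a)) + t * (1 / (q l - v)) - 1 / (q l - z)" for l
    proof -
      define w where "w = q l - z"
      have "q l - a = w - t * y" "q l - v = w - t * y + y" by (simp_all add: w_def a_def v_def)
      moreover have "w \<noteq> 0" "w - t * y \<noteq> 0" "w - t * y + y \<noteq> 0"
        using nz_z[of l] nz_a[of l] nz_v[of l] calculation by (simp_all add: w_def)
      ultimately show ?thesis unfolding w_def[symmetric]
        by (simp add: divide_simps) (simp add: power2_eq_square algebra_simps)
    qed
    have "(t - t ^ 2) * \<mu> ^ 2 * (b_letter_sum m + z ^ 2 / ((q m - z) * (q m - a)))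
        = (\<Sum>l<m. (t - t ^ 2) * (\<mu> ^ 2 * z ^ 2 * (y / ((q l - z) * (q l - a) * (q l - v)))))
          + (t - t ^ 2) * (\<mu> ^ 2 * z ^ 2 / ((q m - z) * (q m - a)))"
      by (simp add: b_letter_sum_def sum_distrib_left distrib_left mult_ac)
    also have "\<dots> = (\<Sum>l<m. y * ((t - t ^ 2) * (y ^ 2 / ((q l - z) * (q l - a) * (q l - v)))))
          + y * ((t - t ^ 2) * (y / ((q m - z) * (q m - a))))"
      unfolding yz by (simp add: power2_eq_square mult_ac)
    also have "\<dots> = y * ((\<Sum>l<m. (1 - t) * (1 / (q l - a)) + t * (1 / (q l - v)) - 1 / (q l - z))
        + (1 - t) * (1 / (q m - a) - 1 / (q m - z)))"
      unfolding pf1 pf2 by (simp only: sum_distrib_left[symmetric] distrib_left)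
    also have "(\<Sum>l<m. (1 - t) * (1 / (q l - a)) + t * (1 / (q l - v)) - 1 / (q l - z))
        + (1 - t) * (1 / (q m - a) - 1 / (q m - z)) = log_deriv 0 m - A (Suc m) + t * (1 / (q m - z))"
      by (simp add: log_deriv_def A_def sum.distrib sum_subtractf sum_distrib_left lessThan_Suc_atMost[symmetric]
          left_diff_distrib right_diff_distrib distrib_left diff_divide_distrib del: lessThan_Suc_atMost)
    finally have "(t - t ^ 2) * \<mu> ^ 2 * (b_letter_sum m + z ^ 2 / ((q m - z) * (q m - a)))
      = y * (log_deriv 0 m - A (Suc m) + t * (1 / (q m - z)))" .
    then have "z / q m * (y * c m) * ((t - t ^ 2) * \<mu> ^ 2 * (b_letter_sum m + z ^ 2 / ((q m - z) * (q m - a))))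
      = z / q m * (y * c m) * (y * (log_deriv 0 m - A (Suc m) + t * (1 / (q m - z))))" by simp
    then show ?thesis by (simp add: mult_ac)
  qed
  \<comment> \<open>Two cancellations: \<open>A (Suc m)\<close> from the shuffle sum against the one
    from the partial fractions, and the part \<open>z * d * i\<close> of
    \<open>c m / (q m - z)\<close> against the leftover \<open>t / (q m - z)\<close>.\<close>
  have 3: "z * y / q m * (c m - 1 / (q m - z))
      + (y * (y * (z * c m / q m * (A (Suc m) - (A N - A (N - Suc m))))) - y * (t * \<mu> * (z * c m / (q m - z))))
      + y * (y * (z * (c m / q m) * (log_deriv 0 m - A (Suc m) + t * (1 / (q m - z)))))
      = y * ((z - t * y) * (c m / q m)) + y * (y * z * (c m / q m * log_deriv 0 m))
        - y * (z / (q m * (q m - z))) - y * (y * (z * c m / q m * (A N - A (N - Suc m))))" for m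
  proof -
    define d i where "d = c m / q m" and "i = 1 / (q m - z)"
    have "t * \<mu> * (z * c m / (q m - z)) = t * (\<mu> * z) * (c m / (q m - z))" by simp
    also have "c m / (q m - z) = d + z * d * i"
      using nz_z[of m] q_nz[of m] by (simp add: d_def i_def divide_simps) (simp add: algebra_simps)
    finally have "t * \<mu> * (z * c m / (q m - z)) = t * y * (d + z * d * i)" by (simp only: y[symmetric])
    moreover have "z * y / q m * (c m - 1 / (q m - z)) = y * z * d - y * (z / (q m * (q m - z)))"
      by (simp add: d_def right_diff_distrib mult.commute[of z y])
    moreover have "z * c m / q m = z * d" by (simp add: d_def)
    ultimately show ?thesis
      unfolding d_def[symmetric] i_def[symmetric] by (simp add: algebra_simps)
  qed
  have "(\<Sum>m<N. z * y / q m * (c m - 1 / (q m - z)))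
      + (y * (y * (\<Sum>m<N. z * c m / q m * (A (Suc m) - (A N - A (N - Suc m)))))
         - y * (t * \<mu> * (\<Sum>m<N. z * c m / (q m - z))))
      + (t - t ^ 2) * \<mu> ^ 2 * (\<Sum>m<N. z / q m * (y * c m * (b_letter_sum m + z ^ 2 / ((q m - z) * (q m - a)))))
    = (\<Sum>m<N. y * ((z - t * y) * (c m / q m)) + y * (y * z * (c m / q m * log_deriv 0 m))
        - y * (z / (q m * (q m - z))) - y * (y * (z * c m / q m * (A N - A (N - Suc m)))))"
    unfolding 3[symmetric] sum_distrib_left 2 sum.distrib sum_subtractf ..
  also have "\<dots> = y * ((z - t * y) * (\<Sum>m<N. c m / q m) + y * z * (\<Sum>m<N. c m / q m * log_deriv 0 m)
        - (\<Sum>m<N. z / (q m * (q m - z)))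
        - y * (\<Sum>n<N. z * c n / q n * (A N - A (N - Suc n))))"
    by (simp only: sum.distrib sum_subtractf sum_distrib_left[symmetric] distrib_left right_diff_distrib)
  finally show ?thesis
    unfolding add_diff_eq[symmetric] 1 by (simp only: right_diff_distrib)
qed

text \<open>On the left of the conclusion stands a chain whose top letter is at \<open>m\<close>:
  this letter is plain and the mark lies further down, in \<open>G m\<close>, or it carries the mark
  itself, which is \<open>\<rho> m\<close>.\<close>

lemma b_chain:
  assumes G: "\<And>m. G m = t * (y / (q m - z) * G m + \<rho> m) + (\<Sum>l<m. y / (q l - z) * G l + \<rho> l)"
    and \<rho>: "\<And>m. \<rho> m = y * z ^ 2 * c m / (q m - z) ^ 2"
  shows "y / (q m - z) * G m + \<rho> m = y * c m * (b_letter_sum m + z ^ 2 / ((q m - z) * (q m - a)))"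
proof -
  define B where "B m = (\<Sum>l<m. y / (q l - z) * G l + \<rho> l)" for m
  have step: "y / (q m - z) * G m + \<rho> m = (y * B m + (q m - z) * \<rho> m) / (q m - a)" for m
  proof -
    define g where "g = G m / (q m - z)"
    have G': "G m = (q m - z) * g" using nz_z[of m] by (simp add: g_def)
    have "(q m - z) * g = t * (y * g + \<rho> m) + B m"
      using G[of m] unfolding B_def[symmetric] G' using nz_z[of m] by simp
    then have "(q m - a) * (y * g + \<rho> m) = y * B m + (q m - z) * \<rho> m"
      by (simp add: a_def algebra_simps) algebra
    then show ?thesis using nz_a[of m] nz_z[of m] by (simp add: G' eq_divide_eq mult.commute)
  qed
  have top: "(y * B m + (q m - z) * \<rho> m) / (q m - a)
      = y * c m * (b_letter_sum m + z ^ 2 / ((q m - z) * (q m - a)))"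
    if "B m = h m * b_letter_sum m" for m
    unfolding that h_eq_c[of m] \<rho> using nz_a[of m] nz_z[of m]
    by (simp add: divide_simps) (simp add: power2_eq_square algebra_simps)
  have "B m = h m * b_letter_sum m" for m
  proof (induction m)
    case (Suc m)
    have "B (Suc m) = B m + (y / (q m - z) * G m + \<rho> m)" by (simp add: B_def)
    also have "\<dots> = (q m - a) * c m * b_letter_sum m
        + y * c m * (b_letter_sum m + z ^ 2 / ((q m - z) * (q m - a)))"
      unfolding step top[OF Suc] unfolding Suc h_eq_c[of m] ..
    also have "\<dots> = (q m - v) * c m * b_letter_sum m + y * c m * (z ^ 2 / ((q m - z) * (q m - a)))"
      by (simp add: a_def v_def algebra_simps)
    also have "\<dots> = h (Suc m) * b_letter_sum (Suc m)"
      unfolding h_Suc using nz_v[of m] by (simp add: b_letter_sum_def distrib_left)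
    finally show ?case .
  qed (simp add: B_def b_letter_sum_def)
  from top[OF this] show ?thesis unfolding step .
qed

section \<open>A double sum that telescopes both ways: the sum formula and its derivative\<close>

definition rho :: "nat \<Rightarrow> nat \<Rightarrow> 'a" where
  "rho j n = (\<Prod>l<n. (q l - v) / (q (l + j + 1) - a))"

text \<open>In Pochhammer symbols \<open>kappa j n\<close> is
  \<open>(1 - v)_n / (j + 1 - a)_(n+1)\<close>, and \<open>rho j n\<close> is
  \<open>(1 - v)_n / (j + 2 - a)_n\<close>. They are the edge values of the double sum in the
  directions \<open>j\<close> and \<open>n\<close>.\<close>

definition kappa :: "nat \<Rightarrow> nat \<Rightarrow> 'a" where
  "kappa j n = rho j n / (q j - a)"

lemma kappa_0: "kappa 0 n = c n"
proof (induction n)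
  case (Suc n)
  have "kappa 0 (Suc n) = kappa 0 n * ((q n - v) / (q (Suc n) - a))"
    by (simp add: kappa_def rho_def)
  also have "\<dots> = h (Suc n) / (q (Suc n) - a)"
    unfolding Suc h_Suc by (simp add: mult.commute)
  finally show ?case by (simp add: c_def)
qed (simp add: kappa_def rho_def c_def)

lemma kappa_Suc: "kappa (Suc j) n = rho j n / (q (j + n + 1) - a)"
proof (induction n)
  case (Suc n)
  have "kappa (Suc j) (Suc n) = kappa (Suc j) n * ((q n - v) / (q (Suc (n + Suc j)) - a))"
    by (simp add: kappa_def rho_def)
  also have "\<dots> = rho j (Suc n) / (q (j + Suc n + 1) - a)"
    unfolding Suc by (simp add: rho_def add_ac)
  finally show ?case .
qed (simp add: kappa_def rho_def)

lemma q_add: "q (j + n + 1) = q j + q n"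
  by (simp add: q_def)

lemma q_add': "q (Suc (j + n)) = q j + q n"
  by (simp add: q_def)

text \<open>The summand telescopes in \<open>j\<close> because
  \<open>q (j + n + 1) - q j = q n\<close>, and in \<open>n\<close> because
  \<open>a - v = y\<close>.\<close>

definition "T j n = kappa (Suc j) n / (q j - a)"

lemma T_eq: "T j n = kappa j n / (q (j + n + 1) - a)"
  unfolding T_def kappa_Suc kappa_def[of j] by (simp add: mult.commute)

lemma T_kappa: "kappa j n = T j n * (q (j + n + 1) - a)" "kappa (Suc j) n = T j n * (q j - a)"
proof -
  show "kappa j n = T j n * (q (j + n + 1) - a)" using nz_a[of "j + n + 1"] unfolding T_eq by simp
  show "kappa (Suc j) n = T j n * (q j - a)" using nz_a[of j] unfolding T_def by simp
qed

lemma T_telescope_j: "T j n = (kappa j n - kappa (Suc j) n) / q n"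
  unfolding T_kappa(1)[of j] T_kappa(2)[of j] q_add using q_nz[of n] by (simp add: right_diff_distrib[symmetric])

lemma rho_diff: "rho j n - rho j (Suc n) = T j n * (q j - a) * (q j - y)"
proof -
  define R where "R = q (j + n + 1) - a"
  have R: "R \<noteq> 0" using nz_a by (simp add: R_def)
  have "rho j n = T j n * (q j - a) * R"
    unfolding T_kappa(2)[symmetric] kappa_Suc R_def[symmetric] using R by simp
  moreover from this have "rho j (Suc n) = T j n * (q j - a) * (q n - v)"
    using R by (simp add: rho_def R_def[symmetric] add_ac) (simp add: R_def add_ac)
  ultimately have "rho j n - rho j (Suc n) = T j n * (q j - a) * (R - (q n - v))"
    by (simp only: right_diff_distrib)
  also have "R - (q n - v) = q j - y" by (simp add: R_def q_add' a_def v_def)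
  finally show ?thesis .
qed

lemma sum_T: "(\<Sum>n<N. T j n) = (1 - rho j N) / ((q j - a) * (q j - y))"
proof -
  have "(\<Sum>n<N. T j n) * ((q j - a) * (q j - y)) = (\<Sum>n<N. rho j n - rho j (Suc n))"
    unfolding rho_diff by (simp add: sum_distrib_right mult.assoc)
  also have "\<dots> = 1 - rho j N" by (simp add: sum_lessThan_telescope') (simp add: rho_def)
  finally show ?thesis using nz_a[of j] nz_y[of j] by (simp add: eq_divide_eq)
qed

text \<open>Summing \<open>T\<close> over \<open>j\<close> first produces \<open>c n / q n\<close>
  minus the edge \<open>j = N\<close>; summing over \<open>n\<close> first produces the last sum,
  with the edge \<open>n = N\<close> in \<open>rho j N\<close>.\<close>

theorem sum_formula:
  "(\<Sum>n<N. c n / q n) = (\<Sum>n<N. kappa N n / q n) + (\<Sum>j<N. (1 - rho j N) / ((q j - a) * (q j - y)))"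
proof -
  have "(\<Sum>j<N. T j n) = c n / q n - kappa N n / q n" for n
    unfolding T_telescope_j diff_divide_distrib
    by (subst sum_lessThan_telescope') (simp add: kappa_0)
  then have "(\<Sum>n<N. c n / q n) = (\<Sum>n<N. kappa N n / q n) + (\<Sum>n<N. \<Sum>j<N. T j n)"
    by (simp add: sum_subtractf)
  also have "(\<Sum>n<N. \<Sum>j<N. T j n) = (\<Sum>j<N. \<Sum>n<N. T j n)" by (rule sum.swap)
  finally show ?thesis by (simp only: sum_T)
qed

text \<open>Logarithmic derivative of \<open>T j n = kappa j n / (q (j + n + 1) - a)\<close>;
  \<open>log_deriv_rho\<close> is that of \<open>rho j n\<close>.\<close>

definition "log_deriv_T j n = log_deriv j n + (1 - t) / (q (j + n + 1) - a)"

definition "log_deriv_rho j n = t * (\<Sum>l<n. 1 / (q l - v)) + (1 - t) * (\<Sum>l<n. 1 / (q (l + j + 1) - a))"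

text \<open>Read off the two other factorisations of \<open>T j n\<close>, through
  \<open>kappa (Suc j) n\<close> and through \<open>rho j n\<close>.\<close>

lemma log_deriv_T_alt:
  "log_deriv_T j n = log_deriv (Suc j) n + (1 - t) / (q j - a)"
  "log_deriv_T j n = log_deriv_rho j n + (1 - t) / (q (j + n + 1) - a) + (1 - t) / (q j - a)"
proof -
  have "(\<Sum>i\<le>n. f (j + i)) + f (j + n + 1) = f j + (\<Sum>i\<le>n. f (Suc j + i))" for f :: "nat \<Rightarrow> 'a"
    using sum.atMost_Suc_shift[of "\<lambda>i. f (j + i)" n] by simp
  from arg_cong[OF this[of "\<lambda>i. 1 / (q i - a)"], of "(*) (1 - t)"]
  show "log_deriv_T j n = log_deriv (Suc j) n + (1 - t) / (q j - a)"
    by (simp add: log_deriv_T_def log_deriv_def distrib_left add_ac)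
  have "(\<Sum>i\<le>n. f (j + i)) = f j + (\<Sum>l<n. f (l + j + 1))" for f :: "nat \<Rightarrow> 'a"
    by (simp add: lessThan_Suc_atMost[symmetric] sum.lessThan_Suc_shift add_ac del: sum.lessThan_Suc lessThan_Suc_atMost)
  from arg_cong[OF this[of "\<lambda>i. 1 / (q i - a)"], of "(*) (1 - t)"]
  show "log_deriv_T j n = log_deriv_rho j n + (1 - t) / (q (j + n + 1) - a) + (1 - t) / (q j - a)"
    by (simp add: log_deriv_T_def log_deriv_def log_deriv_rho_def distrib_left add_ac)
qed

text \<open>This is \<open>T_telescope_j\<close> differentiated, with \<open>q n\<close>
  constant.\<close>

lemma T_log_deriv_telescope_j:
  "T j n * log_deriv_T j n = (kappa j n * log_deriv j n - kappa (Suc j) n * log_deriv (Suc j) n) / q n"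
proof -
  define R P where "R = q (j + n + 1) - a" and "P = q j - a"
  have nz: "R \<noteq> 0" "P \<noteq> 0" using nz_a by (simp_all add: R_def P_def)
  have "log_deriv j n = log_deriv_T j n - (1 - t) / R" "log_deriv (Suc j) n = log_deriv_T j n - (1 - t) / P"
    by (simp add: log_deriv_T_def R_def) (simp add: log_deriv_T_alt(1) P_def)
  then have "kappa j n * log_deriv j n - kappa (Suc j) n * log_deriv (Suc j) n
      = T j n * (R * (log_deriv_T j n - (1 - t) / R) - P * (log_deriv_T j n - (1 - t) / P))"
    unfolding T_kappa(1)[of j] T_kappa(2)[of j] R_def[symmetric] P_def[symmetric] by (simp only: right_diff_distrib mult.assoc)
  also have "R * (log_deriv_T j n - (1 - t) / R) - P * (log_deriv_T j n - (1 - t) / P) = (R - P) * log_deriv_T j n"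
  proof -
    have "x * (L - e / x) = x * L - e" if "x \<noteq> 0" for x L e :: 'a
      using that by (simp add: right_diff_distrib)
    then show ?thesis using nz by (simp add: left_diff_distrib)
  qed
  also have "R - P = q n" by (simp add: R_def P_def q_add')
  finally show ?thesis using q_nz[of n] by simp
qed

text \<open>Derivative of \<open>1 / ((q j - a) * (q j - y))\<close> along
  \<open>a' = 1 - t\<close>, \<open>y' = 1\<close>.\<close>

definition "main_deriv j = (1 - t) / ((q j - a) ^ 2 * (q j - y)) + 1 / ((q j - a) * (q j - y) ^ 2)"

lemma sum_T_log_deriv:
  "(\<Sum>n<N. T j n * log_deriv_T j n)
    = (1 - rho j N) * main_deriv j - rho j N * log_deriv_rho j N / ((q j - a) * (q j - y))"
proof -
  \<comment> \<open>\<open>F n\<close> is the derivative of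
    \<open>rho j n / ((q j - a) * (q j - y))\<close>, the quantity whose telescoping gives
    \<open>sum_T\<close>.\<close>
  define F where "F n = rho j n * (main_deriv j + log_deriv_rho j n / ((q j - a) * (q j - y)))" for n
  have "T j n * log_deriv_T j n = F n - F (Suc n)" for n
  proof -
    define R P Q V L where "R = q (j + n + 1) - a" and "P = q j - a" and "Q = q j - y" and "V = q n - v"
      and "L = log_deriv_rho j n"
    have nz: "R \<noteq> 0" "P \<noteq> 0" "Q \<noteq> 0" "V \<noteq> 0"
      using nz_a nz_y nz_v by (simp_all add: R_def P_def Q_def V_def)
    have V: "V = R - Q" by (simp add: V_def R_def Q_def q_add' a_def v_def)
    have r: "rho j n = T j n * P * R"
      unfolding P_def T_kappa(2)[symmetric] kappa_Suc R_def[symmetric] using nz by simp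
    have r': "rho j (Suc n) = T j n * P * V"
      using rho_diff[of j n] unfolding r P_def[symmetric] Q_def[symmetric] V by (simp add: algebra_simps)
    have L': "log_deriv_rho j (Suc n) = L + t / V + (1 - t) / R"
      by (simp add: log_deriv_rho_def L_def V_def R_def distrib_left add_ac)
    have "F n - F (Suc n) = T j n * (P * R * (main_deriv j + L / (P * Q))
        - P * V * (main_deriv j + (L + t / V + (1 - t) / R) / (P * Q)))"
      unfolding F_def r r' L' L_def[symmetric] P_def[symmetric] Q_def[symmetric]
      by (simp only: right_diff_distrib mult.assoc)
    also have "P * R * (main_deriv j + L / (P * Q)) - P * V * (main_deriv j + (L + t / V + (1 - t) / R) / (P * Q))
        = P * Q * main_deriv j + L * (R - V) / Q - t / Q - (1 - t) * V / (R * Q)"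
      using nz by (simp add: V divide_simps) (simp add: algebra_simps)
    also have "P * Q * main_deriv j = (1 - t) / P + 1 / Q"
      unfolding main_deriv_def P_def[symmetric] Q_def[symmetric] using nz
      by (simp add: divide_simps power2_eq_square)
    also have "R - V = Q" by (simp add: V)
    also have "(1 - t) / P + 1 / Q + L * Q / Q - t / Q - (1 - t) * V / (R * Q) = L + (1 - t) / R + (1 - t) / P"
      using nz by (simp add: V divide_simps) (simp add: algebra_simps)
    also have "\<dots> = log_deriv_T j n" by (simp add: log_deriv_T_alt(2) L_def R_def P_def)
    finally show ?thesis by simp
  qed
  then have "(\<Sum>n<N. T j n * log_deriv_T j n) = F 0 - F N"
    by (simp add: sum_lessThan_telescope')
  then show ?thesis by (simp add: F_def rho_def[of j 0] log_deriv_rho_def[of j 0] algebra_simps)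
qed

theorem sum_formula_deriv:
  "(\<Sum>n<N. c n / q n * log_deriv 0 n) = (\<Sum>n<N. kappa N n * log_deriv N n / q n)
    + (\<Sum>j<N. (1 - rho j N) * main_deriv j - rho j N * log_deriv_rho j N / ((q j - a) * (q j - y)))"
proof -
  have "(\<Sum>j<N. T j n * log_deriv_T j n) = c n / q n * log_deriv 0 n - kappa N n * log_deriv N n / q n" for n
    unfolding T_log_deriv_telescope_j diff_divide_distrib
    by (subst sum_lessThan_telescope') (simp add: kappa_0)
  then have "(\<Sum>n<N. c n / q n * log_deriv 0 n) = (\<Sum>n<N. kappa N n * log_deriv N n / q n)
      + (\<Sum>n<N. \<Sum>j<N. T j n * log_deriv_T j n)"
    by (simp add: sum_subtractf)
  also have "(\<Sum>n<N. \<Sum>j<N. T j n * log_deriv_T j n) = (\<Sum>j<N. \<Sum>n<N. T j n * log_deriv_T j n)"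
    by (rule sum.swap)
  finally show ?thesis by (simp only: sum_T_log_deriv)
qed

end

section \<open>Generating functions of weighted index sums\<close>

text \<open>Here \<open>m\<close> is the position of the letter just above the chain. A run of equal
  positions collects one factor \<open>t\<close> per equality, that is, per plus sign in
  \<open>zeta_t\<close>.\<close>

primrec chain_below :: "real \<Rightarrow> nat \<Rightarrow> nat list \<Rightarrow> real" where
  "chain_below t m [] = 1"
| "chain_below t m (k # ks) = (\<Sum>l\<le>m. (if l = m then t else 1) / real (Suc l) ^ k * chain_below t l ks)"

definition zeta_trunc :: "real \<Rightarrow> nat \<Rightarrow> nat list \<Rightarrow> real" where
  "zeta_trunc t N ks = (case ks of [] \<Rightarrow> 1
    | k # ks' \<Rightarrow> (\<Sum>l<N. 1 / real (Suc l) ^ k * chain_below t l ks'))"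

lemma zeta_trunc_simps [simp]:
  "zeta_trunc t N [] = 1"
  "zeta_trunc t N (k # ks) = (\<Sum>l<N. 1 / real (Suc l) ^ k * chain_below t l ks)"
  by (simp_all add: zeta_trunc_def)

definition compositions :: "nat \<Rightarrow> nat list set" where
  "compositions r = {ks. (\<forall>x\<in>set ks. 0 < x) \<and> sum_list ks = r}"

lemma compositions_0 [simp]: "compositions 0 = {[]}"
proof -
  have "ks \<in> compositions 0 \<longleftrightarrow> ks = []" for ks
    by (cases ks) (auto simp: compositions_def)
  then show ?thesis by auto
qed

lemma compositions_pos:
  assumes "0 < r"
  shows "compositions r = (\<Union>k\<in>{1..r}. (#) k ` compositions (r - k))"
proof (intro equalityI subsetI)
  fix ks assume ks: "ks \<in> compositions r"
  then obtain k ks' where "ks = k # ks'" using assms by (cases ks) (auto simp: compositions_def)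
  with ks show "ks \<in> (\<Union>k\<in>{1..r}. (#) k ` compositions (r - k))"
    by (intro UN_I[of k] image_eqI[of _ _ ks']) (auto simp: compositions_def)
qed (auto simp: compositions_def)

lemma finite_compositions [simp]: "finite (compositions r)"
proof (induction r rule: less_induct)
  case (less r)
  then show ?case by (cases "r = 0") (auto simp: compositions_pos)
qed

lemma sum_compositions_pos:
  assumes "0 < r"
  shows "(\<Sum>ks\<in>compositions r. F ks) = (\<Sum>k=1..r. \<Sum>ks\<in>compositions (r - k). F (k # ks) :: real)"
proof -
  have "(\<Sum>ks\<in>compositions r. F ks) = (\<Sum>k=1..r. \<Sum>ks\<in>(#) k ` compositions (r - k). F ks)"
    unfolding compositions_pos[OF assms] by (rule sum.UNION_disjoint) auto
  also have "\<dots> = (\<Sum>k=1..r. \<Sum>ks\<in>compositions (r - k). F (k # ks))"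
    by (intro sum.cong refl sum.reindex_cong[of "(#) _"]) auto
  finally show ?thesis .
qed

text \<open>Only power series occur; they are viewed as Laurent series to have the field required by
  \<open>chain_params\<close>. Depth is marked by putting \<open>\<mu> ^ length ks\<close> into
  \<open>F\<close>, so one variable suffices.\<close>

definition gen :: "(nat list \<Rightarrow> real) \<Rightarrow> real fls" where
  "gen F = fps_to_fls (Abs_fps (\<lambda>r. \<Sum>ks\<in>compositions r. F ks))"

text \<open>Letters are positive, so the coefficient at 0 is cleared; this also makes the truncated
  subtraction in \<open>k - 1\<close> harmless.\<close>

definition gen1 :: "(nat \<Rightarrow> real) \<Rightarrow> real fls" where
  "gen1 g = fps_to_fls (Abs_fps (\<lambda>k. if k = 0 then 0 else g k))"

lemma gen_nth: "fls_nth (gen F) (int r) = (\<Sum>ks\<in>compositions r. F ks)"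
  by (simp add: gen_def)

lemma fps_to_fls_sum: "fps_to_fls (\<Sum>i\<in>I. f i) = (\<Sum>i\<in>I. fps_to_fls (f i))"
  by (induction I rule: infinite_finite_induct) auto

lemma gen_cong:
  assumes "\<And>ks. (\<forall>x\<in>set ks. 0 < x) \<Longrightarrow> F ks = G ks"
  shows "gen F = gen G"
  unfolding gen_def by (intro arg_cong[of _ _ fps_to_fls] fps_ext) (auto intro!: sum.cong assms simp: compositions_def)

text \<open>Splitting off the first letter is a Cauchy product. \<open>I\<close> holds the positions
  of that letter; two products per position are provided because the weights satisfy recurrences
  \<open>w (k # ks) = u k * w1 ks + u' k * w2 ks\<close>.\<close>

lemma gen_peel:
  assumes "\<And>k ks. 0 < k \<Longrightarrow> F (k # ks) = (\<Sum>i\<in>I. g i k * F1 i ks + g' i k * F2 i ks)"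
  shows "gen F = fls_const (F []) + (\<Sum>i\<in>I. gen1 (g i) * gen (F1 i) + gen1 (g' i) * gen (F2 i))"
proof -
  let ?S = "\<lambda>F. Abs_fps (\<lambda>r. \<Sum>ks\<in>compositions r. F ks)"
  let ?g = "\<lambda>g. Abs_fps (\<lambda>k. if k = 0 then 0 else g k) :: real fps"
  have conv: "fps_nth (?g g * ?S F) r = (\<Sum>k=1..r. g k * (\<Sum>ks\<in>compositions (r - k). F ks))"
    for g and F :: "nat list \<Rightarrow> real" and r
    unfolding fps_mult_nth by (rule sum.mono_neutral_cong_right) auto
  have "?S F = fps_const (F []) + (\<Sum>i\<in>I. ?g (g i) * ?S (F1 i) + ?g (g' i) * ?S (F2 i))"
  proof (rule fps_ext)
    fix r
    have "(\<Sum>ks\<in>compositions r. F ks) = (\<Sum>i\<in>I. \<Sum>k=1..r. g i k * (\<Sum>ks\<in>compositions (r - k). F1 i ks)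
        + g' i k * (\<Sum>ks\<in>compositions (r - k). F2 i ks))" if "r > 0"
      unfolding sum_compositions_pos[OF that] sum.swap[of _ _ I]
      by (intro sum.cong refl)
        (simp add: assms sum.swap[of _ I] sum.distrib sum_distrib_left)
    then show "fps_nth (?S F) r
      = fps_nth (fps_const (F []) + (\<Sum>i\<in>I. ?g (g i) * ?S (F1 i) + ?g (g' i) * ?S (F2 i))) r"
      by (cases "r = 0") (simp_all add: fps_sum_nth conv sum.distrib del: One_nat_def)
  qed
  then show ?thesis
    by (simp add: gen_def gen1_def fps_to_fls_sum fls_times_fps_to_fls)
qed

lemma gen_add: "gen (\<lambda>ks. F ks + G ks) = gen F + gen G"
  by (simp add: gen_def sum.distrib flip: fps_to_fls_plus) (simp add: fps_eq_iff)

lemma gen_diff: "gen (\<lambda>ks. F ks - G ks) = gen F - gen G"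
  by (simp add: gen_def sum_subtractf flip: fps_to_fls_minus) (simp add: fps_eq_iff)

lemma gen_Nil: "gen (\<lambda>ks. if ks = [] then 1 else 0) = 1"
  using gen_peel[where F = "\<lambda>ks. if ks = [] then 1 else 0" and I = "{} :: nat set"] by simp

lemma gen1_diff: "gen1 (\<lambda>k. f k - g k) = gen1 f - gen1 g"
  unfolding gen1_def fps_to_fls_minus[symmetric]
  by (intro arg_cong[of _ _ fps_to_fls] fps_ext) auto

lemma gen1_scale: "gen1 (\<lambda>k. \<mu> * g k) = fls_const \<mu> * gen1 g"
  unfolding gen1_def fps_const_to_fls[symmetric] fls_times_fps_to_fls[symmetric]
  by (intro arg_cong[of _ _ fps_to_fls] fps_ext) auto

lemma of_nat_minus_X_nonzero: "of_nat (Suc m) - fls_const p * fls_X \<noteq> (0 :: real fls)"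
proof -
  have "fps_nth (of_nat (Suc m) - fps_const p * fps_X) 0 \<noteq> (0 :: real)"
    by (simp add: fps_of_nat[symmetric] del: of_nat_Suc)
  then have "of_nat (Suc m) - fps_const p * fps_X \<noteq> (0 :: real fps)" by (metis fps_zero_nth)
  then have "fps_to_fls (of_nat (Suc m) - fps_const p * fps_X) \<noteq> (0 :: real fls)"
    by (simp only: fps_to_fls_eq_0_iff) simp
  then show ?thesis by (simp add: fls_times_fps_to_fls del: of_nat_Suc)
qed

lemma gen1_geometric:
  "gen1 (\<lambda>k. p ^ (k - 1) / real (Suc m) ^ k) = fls_X / (of_nat (Suc m) - fls_const p * fls_X)"
proof -
  let ?g = "Abs_fps (\<lambda>k. if k = 0 then 0 else p ^ (k - 1) / real (Suc m) ^ k)"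
  have "(of_nat (Suc m) - fps_const p * fps_X) * ?g = fps_X"
  proof (rule fps_ext)
    fix r
    have *: "fps_const p * fps_X * ?g = fps_X * (fps_const p * ?g)" by (simp only: mult_ac)
    consider "r = 0" | "r = 1" | j where "r = Suc (Suc j)" by (metis One_nat_def not0_implies_Suc)
    then show "fps_nth ((of_nat (Suc m) - fps_const p * fps_X) * ?g) r = fps_nth fps_X r"
      unfolding left_diff_distrib * by cases (auto simp: fps_of_nat[symmetric] fps_mult_left_const_nth field_simps simp del: of_nat_Suc)
  qed
  from arg_cong[OF this, of fps_to_fls]
  have "(of_nat (Suc m) - fls_const p * fls_X) * gen1 (\<lambda>k. p ^ (k - 1) / real (Suc m) ^ k) = fls_X"
    by (simp add: gen1_def fls_times_fps_to_fls del: of_nat_Suc One_nat_def)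
  then show ?thesis
    using of_nat_minus_X_nonzero[of m p] by (simp add: eq_divide_eq mult.commute del: of_nat_Suc)
qed

lemma gen1_binomial:
  "gen1 (\<lambda>k. real ((k - 1) choose j) / real (Suc m) ^ k) = (fls_X / (of_nat (Suc m) - fls_X)) ^ Suc j"
proof (induction j)
  case 0
  then show ?case using gen1_geometric[of 1 m] by simp
next
  case (Suc j)
  let ?g = "\<lambda>j. Abs_fps (\<lambda>k. if k = 0 then 0 else real ((k - 1) choose j) / real (Suc m) ^ k)"
  have "(of_nat (Suc m) - fps_X) * ?g (Suc j) = fps_X * ?g j"
  proof (rule fps_ext)
    fix r
    consider "r = 0" | "r = 1" | i where "r = Suc (Suc i)" by (metis One_nat_def not0_implies_Suc)
    then show "fps_nth ((of_nat (Suc m) - fps_X) * ?g (Suc j)) r = fps_nth (fps_X * ?g j) r"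
      unfolding left_diff_distrib by cases (auto simp: fps_of_nat[symmetric] fps_mult_left_const_nth field_simps simp del: of_nat_Suc)
  qed
  from arg_cong[OF this, of fps_to_fls]
  have "(of_nat (Suc m) - fls_X) * gen1 (\<lambda>k. real ((k - 1) choose Suc j) / real (Suc m) ^ k)
      = fls_X * gen1 (\<lambda>k. real ((k - 1) choose j) / real (Suc m) ^ k)"
    by (simp add: gen1_def fls_times_fps_to_fls del: of_nat_Suc One_nat_def)
  then have "gen1 (\<lambda>k. real ((k - 1) choose Suc j) / real (Suc m) ^ k)
      = fls_X * (fls_X / (of_nat (Suc m) - fls_X)) ^ Suc j / (of_nat (Suc m) - fls_X)"
    unfolding Suc using of_nat_minus_X_nonzero[of m 1]
    by (simp add: eq_divide_eq mult.commute del: of_nat_Suc One_nat_def power_Suc)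
  then show ?case by (simp add: mult.commute)
qed

text \<open>An admissible first letter \<open>k\<close> is an arbitrary letter \<open>k - 1\<close>
  with one more factor \<open>1 / m\<close>.\<close>

lemma gen1_shift:
  "gen1 (\<lambda>k. if 2 \<le> k then g (k - 1) / real (Suc m) else 0) = fls_X / of_nat (Suc m) * gen1 g"
proof -
  let ?S = "\<lambda>g. Abs_fps (\<lambda>k. if k = 0 then 0 else g k)"
  have "of_nat (Suc m) * ?S (\<lambda>k. if 2 \<le> k then g (k - 1) / real (Suc m) else 0) = fps_X * ?S g"
    by (rule fps_ext) (auto simp: fps_of_nat[symmetric] fps_mult_left_const_nth simp del: of_nat_Suc)
  from arg_cong[OF this, of fps_to_fls]
  have "of_nat (Suc m) * gen1 (\<lambda>k. if 2 \<le> k then g (k - 1) / real (Suc m) else 0) = fls_X * gen1 g"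
    by (simp add: gen1_def fls_times_fps_to_fls del: of_nat_Suc One_nat_def)
  moreover have "of_nat (Suc m) \<noteq> (0 :: real fls)" by (metis of_nat_neq_0)
  ultimately show ?thesis by (simp add: field_simps del: of_nat_Suc)
qed

lemma gen1_zero [simp]: "gen1 (\<lambda>_. 0) = 0"
  unfolding gen1_def fps_zero_to_fls[symmetric]
  by (intro arg_cong[of _ _ fps_to_fls] fps_ext) auto

text \<open>For \<open>u\<^sub>i = k\<^sub>i - 1\<close> one has, with \<open>ks = k\<^sub>1 # ks'\<close>,
  \<open>Ct (butlast ks) = 1 + (2 ^ u\<^sub>1 - 1) * wA ks'\<close> and
  \<open>Ct ks - Ct (butlast ks) = (2 ^ u\<^sub>1 - 1) * wB ks'\<close>.\<close>

primrec wA :: "nat list \<Rightarrow> real" where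
  "wA [] = 0"
| "wA (k # ks) = 2 ^ (k - 1) * wA ks + 1 + (if ks = [] then 1 else 0)"

primrec wB :: "nat list \<Rightarrow> real" where
  "wB [] = 2"
| "wB (k # ks) = 2 ^ (k - 1) * wB ks - (if ks = [] then 1 else 0)"

definition wD :: "nat list \<Rightarrow> real" where
  "wD ks = (\<Sum>k\<leftarrow>ks. real ((k - 1) choose 2))"

text \<open>Length one is left out: there the convention for \<open>Ct_tilde\<close> does not follow
  the formula with \<open>wA\<close>, and the theorem uses this sum for \<open>n \<ge> 2\<close>
  only.\<close>

definition termA :: "real \<Rightarrow> nat \<Rightarrow> nat list \<Rightarrow> real" where
  "termA t N ks = (case ks of [] \<Rightarrow> 0 | k # ks' \<Rightarrow>
    if 2 \<le> k \<and> ks' \<noteq> [] then (1 + (2 ^ (k - 1) - 1) * wA ks') * zeta_trunc t N ks else 0)"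

text \<open>At \<open>k = 1\<close> both \<open>2 ^ (k - 1) - 1\<close> and \<open>k - 1\<close>
  vanish, which confines the sum to admissible indices. The correction at length one encodes the
  convention there: \<open>2 * (2 ^ (k - 1) - 1) - (k - 1)\<close> is
  \<open>Ct [k] - k\<close>.\<close>

definition termB :: "real \<Rightarrow> nat \<Rightarrow> nat list \<Rightarrow> real" where
  "termB t N ks = (case ks of [] \<Rightarrow> 0 | k # ks' \<Rightarrow>
    ((2 ^ (k - 1) - 1) * wB ks' - (if ks' = [] then real (k - 1) else 0)) * zeta_trunc t N ks)"

definition termD :: "real \<Rightarrow> nat \<Rightarrow> nat list \<Rightarrow> real" where
  "termD t N ks = (case ks of [] \<Rightarrow> 0 | k # ks' \<Rightarrow>
    if 2 \<le> k then (real ((k - 2) choose 2) + wD ks') * zeta_trunc t N ks else 0)"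

lemma fls_const_2: "fls_const (2::real) = 2"
  by (metis fps_const_to_fls fps_numeral_fps_const fps_to_fls_numeral)

section \<open>Generating functions of weighted chains\<close>

locale mzv_gen =
  fixes \<mu> t :: real
begin

abbreviation "z \<equiv> (fls_X :: real fls)"
abbreviation "y \<equiv> fls_const \<mu> * z"

text \<open>Every parameter is a real multiple of \<open>z\<close>, so each denominator has a
  nonzero constant term.\<close>

lemma params: "chain_params z y (fls_const t)"
proof -
  have nz: "of_nat (Suc m) - w \<noteq> (0 :: real fls)" if "w = fls_const p * fls_X" for m p w
    unfolding that by (rule of_nat_minus_X_nonzero)
  have s: "fls_const a * fls_X + fls_const b * fls_X = fls_const (a + b) * fls_X"
    "fls_const a * fls_X - fls_const b * fls_X = fls_const (a - b) * fls_X" for a b :: real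
    by (simp_all add: distrib_right left_diff_distrib flip: fls_plus_const fls_minus_const)
  have c: "z = fls_const 1 * z" "2 * z = fls_const 2 * z" "fls_const t * y = fls_const (t * \<mu>) * z"
    by (simp_all add: fls_const_2 mult.assoc flip: fls_const_mult_const)
  show ?thesis
  proof (rule chain_params.intro)
    show "of_nat (Suc m) - z \<noteq> 0" for m by (rule nz, rule c)
    show "of_nat (Suc m) - 2 * z \<noteq> 0" for m by (rule nz, rule c)
    show "of_nat (Suc m) - (z + fls_const t * y) \<noteq> 0" for m
      by (rule nz, subst c(1), subst c(3)) (rule s)
    show "of_nat (Suc m) - (2 * z + fls_const t * y) \<noteq> 0" for m
      by (rule nz, subst c(2), subst c(3)) (rule s)
    have "z + fls_const t * y = fls_const (1 + t * \<mu>) * z" by (subst c(1), subst c(3)) (rule s)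
    then show "of_nat (Suc m) - (z + fls_const t * y - y) \<noteq> 0" for m
      by (intro nz[of _ "1 + t * \<mu> - \<mu>"]) (simp only: s)
    show "of_nat (Suc m) - y \<noteq> 0" for m by (rule nz) simp
  qed
qed

sublocale chain_params z y "fls_const t" "\<lambda>m. of_nat (Suc m)" "z + fls_const t * y"
  "2 * z + fls_const t * y" "z + fls_const t * y - y"
  by (intro_locales; rule params)

abbreviation Q :: "nat \<Rightarrow> real fls" where "Q m \<equiv> of_nat (Suc m)"

abbreviation tie :: "nat \<Rightarrow> nat \<Rightarrow> real" where "tie l m \<equiv> if l = m then t else 1"

lemma sum_tie:
  "(\<Sum>l\<le>m. fls_const (tie l m) * f l) = fls_const t * f m + (\<Sum>l<m. f l)"
proof -
  have "(\<Sum>l\<le>m. fls_const (tie l m) * f l) = (\<Sum>l<m. fls_const (tie l m) * f l) + fls_const t * f m"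
    by (simp add: lessThan_Suc_atMost[symmetric] del: lessThan_Suc_atMost)
  also have "(\<Sum>l<m. fls_const (tie l m) * f l) = (\<Sum>l<m. f l)"
    by (intro sum.cong) auto
  finally show ?thesis by simp
qed

lemma gen1_letter:
  "gen1 (\<lambda>k. \<mu> / real (Suc l) ^ k) = y / (Q l - z)"
  "gen1 (\<lambda>k. \<mu> * 2 ^ (k - 1) / real (Suc l) ^ k) = y / (Q l - 2 * z)"
  using gen1_scale[of \<mu> "\<lambda>k. 1 ^ (k - 1) / real (Suc l) ^ k"] gen1_scale[of \<mu> "\<lambda>k. 2 ^ (k - 1) / real (Suc l) ^ k"]
    gen1_geometric[of 1 l] gen1_geometric[of 2 l]
  by (simp_all add: fls_const_2 del: of_nat_Suc One_nat_def)

lemma gen1_letter_binomial: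
  "gen1 (\<lambda>k. \<mu> * real ((k - 1) choose j) / real (Suc l) ^ k) = y * z ^ j / (Q l - z) ^ Suc j"
  using gen1_scale[of \<mu> "\<lambda>k. real ((k - 1) choose j) / real (Suc l) ^ k"] gen1_binomial[of j l]
  by (simp add: power_divide del: of_nat_Suc One_nat_def)

definition chain_gen :: "(nat list \<Rightarrow> real) \<Rightarrow> nat \<Rightarrow> real fls" where
  "chain_gen w m = gen (\<lambda>ks. \<mu> ^ length ks * (w ks * chain_below t m ks))"

lemma chain_gen_peel:
  assumes "\<And>k ks. w (k # ks) = u k * w1 ks + u' k * w2 ks"
  shows "chain_gen w m = fls_const (w [])
    + fls_const t * (gen1 (\<lambda>k. \<mu> * u k / real (Suc m) ^ k) * chain_gen w1 m
      + gen1 (\<lambda>k. \<mu> * u' k / real (Suc m) ^ k) * chain_gen w2 m)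
    + (\<Sum>l<m. gen1 (\<lambda>k. \<mu> * u k / real (Suc l) ^ k) * chain_gen w1 l
      + gen1 (\<lambda>k. \<mu> * u' k / real (Suc l) ^ k) * chain_gen w2 l)"
proof -
  have "chain_gen w m = fls_const (w []) + (\<Sum>l\<le>m.
      gen1 (\<lambda>k. tie l m * (\<mu> * u k / real (Suc l) ^ k)) * chain_gen w1 l
      + gen1 (\<lambda>k. tie l m * (\<mu> * u' k / real (Suc l) ^ k)) * chain_gen w2 l)"
    unfolding chain_gen_def
    by (subst gen_peel[where I = "{..m}"
        and g = "\<lambda>l k. tie l m * (\<mu> * u k / real (Suc l) ^ k)"
        and g' = "\<lambda>l k. tie l m * (\<mu> * u' k / real (Suc l) ^ k)"
        and ?F1.0 = "\<lambda>l ks. \<mu> ^ length ks * (w1 ks * chain_below t l ks)"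
        and ?F2.0 = "\<lambda>l ks. \<mu> ^ length ks * (w2 ks * chain_below t l ks)"])
      (simp_all add: assms sum_distrib_left distrib_left distrib_right add_divide_distrib mult_ac del: of_nat_Suc)
  also have "\<dots> = fls_const (w []) + (\<Sum>l\<le>m. fls_const (tie l m) *
    (gen1 (\<lambda>k. \<mu> * u k / real (Suc l) ^ k) * chain_gen w1 l
      + gen1 (\<lambda>k. \<mu> * u' k / real (Suc l) ^ k) * chain_gen w2 l))"
    unfolding gen1_scale[of "tie _ _"] by (simp only: distrib_left mult.assoc)
  finally show ?thesis by (simp only: sum_tie add.assoc)
qed

lemma chain_gen_1: "chain_gen (\<lambda>_. 1) m = (Q m - z) * c m"
proof (rule single_chain_unique)
  fix m
  show "chain_gen (\<lambda>_. 1) m = 1 + fls_const t * (y / (Q m - z) * chain_gen (\<lambda>_. 1) m)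
      + (\<Sum>l<m. y / (Q l - z) * chain_gen (\<lambda>_. 1) l)"
    using chain_gen_peel[of "\<lambda>_. 1" "\<lambda>_. 1" "\<lambda>_. 1" "\<lambda>_. 0" "\<lambda>_. 1" m]
    by (simp add: gen1_letter del: of_nat_Suc)
qed

lemma chain_gen_Nil: "chain_gen (\<lambda>ks. if ks = [] then 1 else 0) m = 1"
proof -
  have "chain_gen (\<lambda>ks. if ks = [] then 1 else 0) m = gen (\<lambda>ks. if ks = [] then 1 else 0)"
    unfolding chain_gen_def by (rule gen_cong) auto
  then show ?thesis by (simp add: gen_Nil)
qed

lemma chain_gen_add: "chain_gen (\<lambda>ks. f ks + g ks) m = chain_gen f m + chain_gen g m"
  unfolding chain_gen_def gen_add[symmetric] by (simp add: algebra_simps)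

lemma chain_gen_uminus: "chain_gen (\<lambda>ks. - f ks) m = - chain_gen f m"
  using chain_gen_add[of f "\<lambda>ks. - f ks" m] by (simp add: chain_gen_def gen_def fps_zero_def[symmetric] add_eq_0_iff)

text \<open>The source is the plain letter at which the doubling stops, followed by an arbitrary
  plain chain, \<open>(Q l - z) * c l\<close>, and once more by the empty chain, 1.\<close>

lemma chain_gen_wA:
  "chain_gen wA m = 0 + fls_const t * (y / (Q m - 2 * z) * chain_gen wA m + y * (c m + 1 / (Q m - z)))
    + (\<Sum>l<m. y / (Q l - 2 * z) * chain_gen wA l + y * (c l + 1 / (Q l - z)))"
proof -
  have "y / (Q l - z) * ((Q l - z) * c l + 1) = y * (c l + 1 / (Q l - z))" for l
    using nz_z[of l] by (simp add: distrib_left del: of_nat_Suc)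
  then show ?thesis
    using chain_gen_peel[of wA "\<lambda>k. 2 ^ (k - 1)" wA "\<lambda>_. 1" "\<lambda>ks. 1 + (if ks = [] then 1 else 0)" m]
    by (simp add: gen1_letter chain_gen_add chain_gen_1 chain_gen_Nil del: of_nat_Suc One_nat_def)
qed

lemma chain_gen_wB:
  "chain_gen wB m = 2 + fls_const t * (y / (Q m - 2 * z) * chain_gen wB m + - (y / (Q m - z)))
    + (\<Sum>l<m. y / (Q l - 2 * z) * chain_gen wB l + - (y / (Q l - z)))"
  using chain_gen_peel[of wB "\<lambda>k. 2 ^ (k - 1)" wB "\<lambda>_. 1" "\<lambda>ks. - (if ks = [] then 1 else 0)" m]
  by (simp add: gen1_letter chain_gen_uminus chain_gen_Nil fls_const_2 del: of_nat_Suc One_nat_def)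

lemma wD_Cons: "wD (k # ks) = 1 * wD ks + real ((k - 1) choose 2) * 1"
  by (simp add: wD_def)

definition src :: "nat \<Rightarrow> real fls" where "src m = y * z ^ 2 * c m / (Q m - z) ^ 2"

lemma letter_chain_src: "y * z ^ 2 / (Q l - z) ^ Suc 2 * ((Q l - z) * c l) = src l"
  using nz_z[of l] by (simp add: src_def numeral_3_eq_3 power2_eq_square del: of_nat_Suc)

lemma chain_gen_wD:
  "y / (Q m - z) * chain_gen wD m + src m
    = y * c m * (b_letter_sum m + z ^ 2 / ((Q m - z) * (Q m - (z + fls_const t * y))))"
proof (rule b_chain)
  fix m
  show "chain_gen wD m = fls_const t * (y / (Q m - z) * chain_gen wD m + src m)
      + (\<Sum>l<m. y / (Q l - z) * chain_gen wD l + src l)"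
    using chain_gen_peel[of wD "\<lambda>_. 1" wD "\<lambda>k. real ((k - 1) choose 2)" "\<lambda>_. 1" m, OF wD_Cons]
    by (simp only: gen1_letter gen1_letter_binomial mult_1_right chain_gen_1 letter_chain_src)
      (simp add: wD_def del: of_nat_Suc)
qed (simp add: src_def del: of_nat_Suc)

lemma shift_letter:
  "2 \<le> k \<Longrightarrow> x / real (Suc l) ^ (k - 1) / real (Suc l) = x / real (Suc l) ^ k"
  by (cases k) (simp_all add: mult.commute)

text \<open>The summand 1 of the weight gives the first sum, with \<open>(Q l - z) * c l - 1\<close>
  for the nonempty plain chains below the first letter. The summand with \<open>wA\<close> gives the
  second one by \<open>double_chain_sum\<close>, with starting value
  \<open>wA [] = 0\<close>.\<close>

lemma gen_termA:
  "gen (\<lambda>ks. \<mu> ^ length ks * termA t N ks) = (\<Sum>m<N. z * y / Q m * (c m - 1 / (Q m - z)))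
    + y * (\<Sum>m<N. y * (c m + 1 / (Q m - z)) * (fls_const t * X N m + (1 - fls_const t) * X N (Suc m)))"
proof -
  let ?e = "\<lambda>ks :: nat list. if ks = [] then 1 else 0 :: real"
  have "gen (\<lambda>ks. \<mu> ^ length ks * termA t N ks) = (\<Sum>l<N.
      gen1 (\<lambda>k. if 2 \<le> k then \<mu> / real (Suc l) ^ (k - 1) / real (Suc l) else 0)
        * gen (\<lambda>ks. \<mu> ^ length ks * (1 * chain_below t l ks) - ?e ks)
      + gen1 (\<lambda>k. \<mu> * 2 ^ (k - 1) / real (Suc l) ^ k - \<mu> / real (Suc l) ^ k)
        * gen (\<lambda>ks. \<mu> ^ length ks * (wA ks * chain_below t l ks)))"
  proof (subst gen_peel)
    fix k :: nat and ks :: "nat list" assume "0 < k"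
    then consider "k = 1" | "k \<ge> 2" "ks = []" | "k \<ge> 2" "ks \<noteq> []" by linarith
    then show "\<mu> ^ length (k # ks) * termA t N (k # ks) = (\<Sum>l<N.
      (if 2 \<le> k then \<mu> / real (Suc l) ^ (k - 1) / real (Suc l) else 0)
        * (\<mu> ^ length ks * (1 * chain_below t l ks) - ?e ks)
      + (\<mu> * 2 ^ (k - 1) / real (Suc l) ^ k - \<mu> / real (Suc l) ^ k)
        * (\<mu> ^ length ks * (wA ks * chain_below t l ks)))"
    proof cases
      case 3
      define d where "d l = 1 / real (Suc l) ^ k" for l
      have d: "x / real (Suc l) ^ k = x * d l" for x l by (simp add: d_def)
      show ?thesis
        using 3 by (simp only: termA_def list.simps zeta_trunc_simps shift_letter d if_True if_False simp_thms)
          (simp only: sum_distrib_left, rule sum.cong[OF refl], simp add: algebra_simps del: of_nat_Suc One_nat_def)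
    qed (simp_all add: termA_def)
  qed (simp add: termA_def)
  also have "\<dots> = (\<Sum>l<N. z / Q l * (y / (Q l - z)) * ((Q l - z) * c l - 1)
      + (y / (Q l - 2 * z) - y / (Q l - z)) * chain_gen wA l)"
  proof -
    have "gen (\<lambda>ks. \<mu> ^ length ks * (1 * chain_below t l ks) - ?e ks) = (Q l - z) * c l - 1" for l
      using chain_gen_1[of l] by (simp only: gen_diff gen_Nil chain_gen_def)
    then show ?thesis
      unfolding gen1_shift[of "\<lambda>k. \<mu> / real (Suc _) ^ k"] gen1_diff gen1_letter chain_gen_def by simp
  qed
  also have "\<dots> = (\<Sum>l<N. z * y / Q l * (c l - 1 / (Q l - z)))
      + (\<Sum>l<N. (y / (Q l - 2 * z) - y / (Q l - z)) * chain_gen wA l)"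
  proof -
    have "z / Q l * (y / (Q l - z)) * ((Q l - z) * c l - 1) = z * y / Q l * (c l - 1 / (Q l - z))" for l
    proof -
      have "c l - 1 / (Q l - z) = ((Q l - z) * c l - 1) / (Q l - z)"
        using nz_z[of l] by (simp add: diff_divide_distrib del: of_nat_Suc)
      then show ?thesis by (simp del: of_nat_Suc)
    qed
    then show ?thesis by (simp add: sum.distrib del: of_nat_Suc)
  qed
  also have "(\<Sum>l<N. (y / (Q l - 2 * z) - y / (Q l - z)) * chain_gen wA l)
      = y * (0 * X N 0 + (\<Sum>m<N. y * (c m + 1 / (Q m - z)) * (fls_const t * X N m + (1 - fls_const t) * X N (Suc m))))"
    by (rule double_chain_sum) (rule chain_gen_wA)
  finally show ?thesis by simp
qed

lemma gen_termB:
  "gen (\<lambda>ks. \<mu> ^ length ks * termB t N ks)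
    = y * (2 * X N 0 + (\<Sum>m<N. - (y / (Q m - z)) * (fls_const t * X N m + (1 - fls_const t) * X N (Suc m))))
      - (\<Sum>m<N. y * z / (Q m - z) ^ 2)"
proof -
  let ?e = "\<lambda>ks :: nat list. if ks = [] then 1 else 0 :: real"
  have "gen (\<lambda>ks. \<mu> ^ length ks * termB t N ks) = (\<Sum>l<N.
      gen1 (\<lambda>k. \<mu> * 2 ^ (k - 1) / real (Suc l) ^ k - \<mu> / real (Suc l) ^ k)
        * gen (\<lambda>ks. \<mu> ^ length ks * (wB ks * chain_below t l ks))
      + gen1 (\<lambda>k. (- 1) * (\<mu> * real ((k - 1) choose 1) / real (Suc l) ^ k)) * gen ?e)"
  proof (subst gen_peel)
    fix k :: nat and ks :: "nat list"
    define d where "d l = 1 / real (Suc l) ^ k" for l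
    have d: "x / real (Suc l) ^ k = x * d l" for x l by (simp add: d_def)
    show "\<mu> ^ length (k # ks) * termB t N (k # ks) = (\<Sum>l<N.
      (\<mu> * 2 ^ (k - 1) / real (Suc l) ^ k - \<mu> / real (Suc l) ^ k)
        * (\<mu> ^ length ks * (wB ks * chain_below t l ks))
      + (- 1) * (\<mu> * real ((k - 1) choose 1) / real (Suc l) ^ k) * ?e ks)"
      by (simp only: termB_def list.simps zeta_trunc_simps d)
        (simp only: sum_distrib_left, rule sum.cong[OF refl], simp add: algebra_simps choose_one del: of_nat_Suc One_nat_def)
  qed (simp add: termB_def)
  also have "\<dots> = (\<Sum>l<N. (y / (Q l - 2 * z) - y / (Q l - z)) * chain_gen wB l - y * z / (Q l - z) ^ 2)"
    unfolding gen1_scale[of "- 1"] gen1_letter_binomial gen_Nil gen1_diff gen1_letter chain_gen_def[symmetric]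
    by (simp add: power2_eq_square del: of_nat_Suc One_nat_def)
  also have "\<dots> = (\<Sum>l<N. (y / (Q l - 2 * z) - y / (Q l - z)) * chain_gen wB l)
      - (\<Sum>l<N. y * z / (Q l - z) ^ 2)" by (rule sum_subtractf)
  also have "(\<Sum>l<N. (y / (Q l - 2 * z) - y / (Q l - z)) * chain_gen wB l)
      = y * (2 * X N 0 + (\<Sum>m<N. - (y / (Q m - z)) * (fls_const t * X N m + (1 - fls_const t) * X N (Suc m))))"
    by (rule double_chain_sum) (rule chain_gen_wB)
  finally show ?thesis .
qed

text \<open>Once the first letter is lowered by 1, the mark \<open>(k - 1) choose 2\<close> sits on
  it or in the chain below; together these form the left-hand side of
  \<open>chain_gen_wD\<close>.\<close>

lemma gen_termD:
  "gen (\<lambda>ks. \<mu> ^ length ks * termD t N ks)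
    = (\<Sum>m<N. z / Q m * (y * c m * (b_letter_sum m + z ^ 2 / ((Q m - z) * (Q m - (z + fls_const t * y))))))"
proof -
  have "gen (\<lambda>ks. \<mu> ^ length ks * termD t N ks) = (\<Sum>l<N.
      gen1 (\<lambda>k. if 2 \<le> k then \<mu> * real ((k - 1 - 1) choose 2) / real (Suc l) ^ (k - 1) / real (Suc l) else 0)
        * gen (\<lambda>ks. \<mu> ^ length ks * (1 * chain_below t l ks))
      + gen1 (\<lambda>k. if 2 \<le> k then \<mu> / real (Suc l) ^ (k - 1) / real (Suc l) else 0)
        * gen (\<lambda>ks. \<mu> ^ length ks * (wD ks * chain_below t l ks)))"
  proof (subst gen_peel)
    fix k :: nat and ks :: "nat list"
    show "\<mu> ^ length (k # ks) * termD t N (k # ks) = (\<Sum>l<N.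
      (if 2 \<le> k then \<mu> * real ((k - 1 - 1) choose 2) / real (Suc l) ^ (k - 1) / real (Suc l) else 0)
        * (\<mu> ^ length ks * (1 * chain_below t l ks))
      + (if 2 \<le> k then \<mu> / real (Suc l) ^ (k - 1) / real (Suc l) else 0)
        * (\<mu> ^ length ks * (wD ks * chain_below t l ks)))"
    proof (cases "2 \<le> k")
      case True
      define d where "d l = 1 / real (Suc l) ^ k" for l
      have d: "x / real (Suc l) ^ k = x * d l" for x l by (simp add: d_def)
      have k: "k - 1 - 1 = k - 2" by simp
      show ?thesis
        using True by (simp only: termD_def list.simps zeta_trunc_simps shift_letter d k if_True)
          (simp only: sum_distrib_left, rule sum.cong[OF refl], simp add: algebra_simps del: of_nat_Suc)
    qed (simp add: termD_def)
  qed (simp add: termD_def)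
  also have "\<dots> = (\<Sum>l<N. z / Q l * (y / (Q l - z) * chain_gen wD l + src l))"
    unfolding gen1_shift[of "\<lambda>k. \<mu> * real ((k - 1) choose 2) / real (Suc _) ^ k"]
      gen1_shift[of "\<lambda>k. \<mu> / real (Suc _) ^ k"] chain_gen_def[symmetric] gen1_letter gen1_letter_binomial
      letter_chain_src[symmetric]
    by (simp add: chain_gen_1 distrib_left add.commute mult_ac del: of_nat_Suc One_nat_def)
  finally show ?thesis by (simp only: chain_gen_wD)
qed

theorem gen_identity:
  "gen (\<lambda>ks. \<mu> ^ length ks * termA t N ks)
    - fls_const (t * \<mu>) * gen (\<lambda>ks. \<mu> ^ length ks * termB t N ks)
    + fls_const ((t - t ^ 2) * \<mu> ^ 2) * gen (\<lambda>ks. \<mu> ^ length ks * termD t N ks)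
  = y * ((z - fls_const t * y) * (\<Sum>m<N. c m / Q m) + y * z * (\<Sum>m<N. c m / Q m * log_deriv 0 m)
        - (\<Sum>m<N. z / (Q m * (Q m - z)))
        - y * (\<Sum>n<N. z * c n / Q n * (A N - A (N - Suc n))))"
proof -
  have "fls_const (t * \<mu>) = fls_const t * fls_const \<mu>"
    "fls_const ((t - t ^ 2) * \<mu> ^ 2) = (fls_const t - fls_const t ^ 2) * fls_const \<mu> ^ 2"
    by (simp_all add: power2_eq_square flip: fls_const_mult_const fls_minus_const)
  then show ?thesis
    unfolding gen_termA gen_termB gen_termD
    by (simp only:) (rule weighted_chain_identity[OF refl])
qed

end

section \<open>Weighted norms and elementary estimates\<close>

text \<open>\<open>norm_le \<rho> R f B\<close>: \<open>f\<close> is a power series, and the \<open>\<rho>\<close>-weighted \<open>l\<^sup>1\<close>-norm of its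
  truncation at degree \<open>R\<close> is at most \<open>B\<close>. This norm is submultiplicative.\<close>

definition norm_le :: "real \<Rightarrow> nat \<Rightarrow> real fls \<Rightarrow> real \<Rightarrow> bool" where
  "norm_le \<rho> R f B \<longleftrightarrow> (\<exists>g. f = fps_to_fls g \<and> (\<Sum>r\<le>R. \<bar>fps_nth g r\<bar> * \<rho> ^ r) \<le> B)"

text \<open>The point of a small weight \<open>\<rho>\<close>: a quotient
  \<open>(m - v) / (m - a)\<close> has norm at most \<open>1 + O(1 / m)\<close> with a small
  constant, so long products are bounded by a small power of \<open>N\<close> in all coefficients at
  once.\<close>

locale trunc_norm =
  fixes \<rho> :: real and R :: nat
  assumes \<rho>: "0 < \<rho>"
begin

abbreviation nb :: "real fls \<Rightarrow> real \<Rightarrow> bool" where "nb \<equiv> norm_le \<rho> R"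

lemma nb_mono: "nb f B \<Longrightarrow> B \<le> B' \<Longrightarrow> nb f B'"
  unfolding norm_le_def using order_trans by blast

lemma nb_add:
  assumes "nb f B" "nb g C" shows "nb (f + g) (B + C)"
proof -
  from assms obtain f' g' where f: "f = fps_to_fls f'" "(\<Sum>r\<le>R. \<bar>fps_nth f' r\<bar> * \<rho> ^ r) \<le> B"
    and g: "g = fps_to_fls g'" "(\<Sum>r\<le>R. \<bar>fps_nth g' r\<bar> * \<rho> ^ r) \<le> C"
    unfolding norm_le_def by blast
  have "(\<Sum>r\<le>R. \<bar>fps_nth (f' + g') r\<bar> * \<rho> ^ r)
      \<le> (\<Sum>r\<le>R. \<bar>fps_nth f' r\<bar> * \<rho> ^ r) + (\<Sum>r\<le>R. \<bar>fps_nth g' r\<bar> * \<rho> ^ r)"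
    unfolding sum.distrib[symmetric] distrib_right[symmetric]
    using \<rho> by (intro sum_mono mult_right_mono) (auto intro: abs_triangle_ineq)
  then show ?thesis using f g unfolding norm_le_def by (intro exI[of _ "f' + g'"]) simp
qed

lemma nb_uminus: "nb f B \<Longrightarrow> nb (- f) B"
  unfolding norm_le_def
proof (elim exE conjE)
  fix g assume "f = fps_to_fls g" "(\<Sum>r\<le>R. \<bar>fps_nth g r\<bar> * \<rho> ^ r) \<le> B"
  then show "\<exists>g. - f = fps_to_fls g \<and> (\<Sum>r\<le>R. \<bar>fps_nth g r\<bar> * \<rho> ^ r) \<le> B"
    by (intro exI[of _ "- g"]) simp
qed

lemma nb_diff: "nb f B \<Longrightarrow> nb g C \<Longrightarrow> nb (f - g) (B + C)"
  using nb_add[OF _ nb_uminus, of f B g C] by simp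

lemma nb_mult:
  assumes "nb f B" "nb g C" shows "nb (f * g) (B * C)"
proof -
  from assms obtain f' g' where f: "f = fps_to_fls f'" "(\<Sum>r\<le>R. \<bar>fps_nth f' r\<bar> * \<rho> ^ r) \<le> B"
    and g: "g = fps_to_fls g'" "(\<Sum>r\<le>R. \<bar>fps_nth g' r\<bar> * \<rho> ^ r) \<le> C"
    unfolding norm_le_def by blast
  let ?a = "\<lambda>r. \<bar>fps_nth f' r\<bar> * \<rho> ^ r" and ?b = "\<lambda>r. \<bar>fps_nth g' r\<bar> * \<rho> ^ r"
  have nn: "0 \<le> ?a r" "0 \<le> ?b r" for r using \<rho> by simp_all
  have "(\<Sum>r\<le>R. \<bar>fps_nth (f' * g') r\<bar> * \<rho> ^ r) \<le> (\<Sum>r\<le>R. \<Sum>i\<le>r. ?a i * ?b (r - i))"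
  proof (rule sum_mono)
    fix r
    have "\<bar>fps_nth (f' * g') r\<bar> \<le> (\<Sum>i\<le>r. \<bar>fps_nth f' i * fps_nth g' (r - i)\<bar>)"
      by (simp add: fps_mult_nth atLeast0AtMost sum_abs)
    then have "\<bar>fps_nth (f' * g') r\<bar> * \<rho> ^ r \<le> (\<Sum>i\<le>r. \<bar>fps_nth f' i * fps_nth g' (r - i)\<bar>) * \<rho> ^ r"
      using \<rho> by (intro mult_right_mono) auto
    also have "\<dots> = (\<Sum>i\<le>r. ?a i * ?b (r - i))"
      unfolding sum_distrib_right
    proof (rule sum.cong[OF refl])
      fix i assume "i \<in> {..r}"
      then have "\<rho> ^ r = \<rho> ^ i * \<rho> ^ (r - i)" by (simp flip: power_add)
      then show "\<bar>fps_nth f' i * fps_nth g' (r - i)\<bar> * \<rho> ^ r = ?a i * ?b (r - i)"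
        by (simp add: abs_mult)
    qed
    finally show "\<bar>fps_nth (f' * g') r\<bar> * \<rho> ^ r \<le> (\<Sum>i\<le>r. ?a i * ?b (r - i))" .
  qed
  also have "\<dots> = (\<Sum>(i, j)\<in>{(i, j). i + j \<le> R}. ?a i * ?b j)"
    by (rule sum.triangle_reindex_eq[symmetric])
  also have "\<dots> \<le> (\<Sum>(i, j)\<in>{..R} \<times> {..R}. ?a i * ?b j)"
    by (rule sum_mono2) (auto intro!: mult_nonneg_nonneg zero_le_power less_imp_le[OF \<rho>])
  also have "\<dots> = (\<Sum>i\<le>R. ?a i) * (\<Sum>j\<le>R. ?b j)"
    by (simp add: sum.cartesian_product sum_product)
  also have "\<dots> \<le> B * C"
    using f(2) g(2) nn by (intro mult_mono order_trans[OF _ f(2)] sum_nonneg) auto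
  finally show ?thesis
    using f(1) g(1) unfolding norm_le_def by (intro exI[of _ "f' * g'"]) (simp add: fls_times_fps_to_fls)
qed

lemma nb_sum: "(\<And>i. i \<in> I \<Longrightarrow> nb (f i) (B i)) \<Longrightarrow> nb (\<Sum>i\<in>I. f i) (\<Sum>i\<in>I. B i)"
proof (induction I rule: infinite_finite_induct)
  case (insert i I)
  then show ?case by (simp add: nb_add)
qed (auto simp: norm_le_def intro!: exI[of _ 0])

lemma nb_const: "nb (fls_const k) \<bar>k\<bar>"
  unfolding norm_le_def
proof (intro exI conjI)
  show "(\<Sum>r\<le>R. \<bar>fps_nth (fps_const k) r\<bar> * \<rho> ^ r) \<le> \<bar>k\<bar>"
    by (subst sum.mono_neutral_right[of _ "{0}"]) auto
qed simp

lemma nb_1: "nb 1 1"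
  using nb_const[of 1] by simp

lemma nb_X: "nb fls_X \<rho>"
  unfolding norm_le_def
proof (intro exI conjI)
  have "(\<Sum>r\<le>R. \<bar>fps_nth fps_X r\<bar> * \<rho> ^ r) = (\<Sum>r\<le>R. if r = 1 then \<rho> else 0)"
    by (rule sum.cong) auto
  then show "(\<Sum>r\<le>R. \<bar>fps_nth fps_X r\<bar> * \<rho> ^ r) \<le> \<rho>" using \<rho> by simp
qed simp

lemma nb_prod: "(\<And>i. i \<in> I \<Longrightarrow> nb (f i) (B i)) \<Longrightarrow> nb (\<Prod>i\<in>I. f i) (\<Prod>i\<in>I. B i)"
proof (induction I rule: infinite_finite_induct)
  case (insert i I)
  then show ?case by (simp add: nb_mult)
qed (auto simp: nb_1)

lemma nb_coeff:
  assumes "nb f B" "r \<le> R" shows "\<bar>fls_nth f (int r)\<bar> \<le> B / \<rho> ^ r"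
proof -
  from assms obtain g where g: "f = fps_to_fls g" "(\<Sum>r\<le>R. \<bar>fps_nth g r\<bar> * \<rho> ^ r) \<le> B"
    unfolding norm_le_def by blast
  have "\<bar>fps_nth g r\<bar> * \<rho> ^ r \<le> (\<Sum>r\<le>R. \<bar>fps_nth g r\<bar> * \<rho> ^ r)"
    using \<rho> assms(2) by (intro member_le_sum) auto
  then show ?thesis using g \<rho> by (simp add: pos_le_divide_eq)
qed

lemma nb_letter: "nb (of_nat (Suc m) - fls_const p * fls_X) (real (Suc m) + \<bar>p\<bar> * \<rho>)"
  using nb_diff[OF nb_const[of "real (Suc m)"] nb_mult[OF nb_const[of p] nb_X]]
  by (simp only: fls_of_nat[symmetric] abs_of_nat)

text \<open>A geometric series has norm at most \<open>1 / (m - \<bar>p\<bar> * \<rho>)\<close>.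
  This sharp form serves the products, where the factor 2 of the coarser variant would
  accumulate.\<close>

lemma nb_inverse_letter:
  assumes p: "\<bar>p\<bar> * \<rho> \<le> 1 / 8"
  shows "nb (1 / (of_nat (Suc m) - fls_const p * fls_X)) (1 / (real (Suc m) - 1 / 8))"
proof -
  define g where "g = Abs_fps (\<lambda>r. p ^ r / real (Suc m) ^ Suc r)"
  have "(of_nat (Suc m) - fps_const p * fps_X) * g = 1"
  proof (rule fps_ext)
    fix r
    have *: "fps_const p * fps_X * g = fps_X * (fps_const p * g)" by (simp only: mult_ac)
    show "fps_nth ((of_nat (Suc m) - fps_const p * fps_X) * g) r = fps_nth 1 r"
      unfolding left_diff_distrib *
      by (cases r) (auto simp: g_def fps_of_nat[symmetric] fps_mult_left_const_nth field_simps simp del: of_nat_Suc)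
  qed
  from arg_cong[OF this, of fps_to_fls]
  have "(of_nat (Suc m) - fls_const p * fls_X) * fps_to_fls g = 1"
    by (simp add: fls_times_fps_to_fls del: of_nat_Suc)
  then have eq: "1 / (of_nat (Suc m) - fls_const p * fls_X) = fps_to_fls g"
    using of_nat_minus_X_nonzero[of m p] by (simp add: divide_eq_eq mult.commute del: of_nat_Suc)
  define x where "x = \<bar>p\<bar> * \<rho> / real (Suc m)"
  have x: "0 \<le> x" "x \<le> 1 / 8"
    using p \<rho> by (simp_all add: x_def divide_le_eq)
  have "(\<Sum>r\<le>R. x ^ r) \<le> 1 / (1 - x)"
  proof -
    have "(1 - x) * (\<Sum>r\<le>R. x ^ r) = 1 - x ^ Suc R"
      unfolding lessThan_Suc_atMost[symmetric] by (rule one_diff_power_eq[symmetric])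
    then show ?thesis using x by (simp add: pos_le_divide_eq mult.commute)
  qed
  then have "1 / real (Suc m) * (\<Sum>r\<le>R. x ^ r) \<le> 1 / real (Suc m) * (1 / (1 - x))"
    by (rule mult_left_mono) simp
  also have "1 / real (Suc m) * (1 / (1 - x)) = 1 / (real (Suc m) - \<bar>p\<bar> * \<rho>)"
    using x by (simp add: x_def field_simps del: of_nat_Suc)
  also have "\<dots> \<le> 1 / (real (Suc m) - 1 / 8)"
    using p by (intro divide_left_mono mult_pos_pos) auto
  also have "1 / real (Suc m) * (\<Sum>r\<le>R. x ^ r) = (\<Sum>r\<le>R. \<bar>fps_nth g r\<bar> * \<rho> ^ r)"
    by (simp add: g_def x_def sum_distrib_left power_mult_distrib power_divide abs_mult power_abs del: of_nat_Suc)
  finally show ?thesis unfolding norm_le_def eq by (intro exI[of _ g]) simp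
qed

lemma nb_inverse_letter':
  assumes p: "\<bar>p\<bar> * \<rho> \<le> 1 / 8"
  shows "nb (1 / (of_nat (Suc m) - fls_const p * fls_X)) (2 / real (Suc m))"
  by (rule nb_mono[OF nb_inverse_letter[OF p]]) (simp add: field_simps)

end

section \<open>Harmonic sums and products of shifted ratios\<close>

definition Hn :: "nat \<Rightarrow> real" where "Hn N = (\<Sum>l<N. 1 / real (Suc l))"

lemma Hn_ge_1: "1 \<le> N \<Longrightarrow> 1 \<le> Hn N"
  unfolding Hn_def using sum_mono2[of "{..<N}" "{0}" "\<lambda>l. 1 / real (Suc l)"] by auto

lemma Hn_nonneg: "0 \<le> Hn N"
  unfolding Hn_def by (intro sum_nonneg) simp

lemma Hn_le_ln: "1 \<le> N \<Longrightarrow> Hn N \<le> 1 + ln (real N)"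
proof (induction N rule: nat_induct_at_least)
  case (Suc n)
  have "ln (real n / real (Suc n)) \<le> real n / real (Suc n) - 1"
    using Suc.hyps by (intro ln_le_minus_one) simp
  also have "\<dots> = - (1 / real (Suc n))" by (simp add: field_simps)
  finally have "1 / real (Suc n) \<le> ln (real (Suc n)) - ln (real n)"
    using Suc.hyps by (simp add: ln_div del: of_nat_Suc)
  with Suc.IH show ?case by (simp add: Hn_def)
qed (simp add: Hn_def)

lemma Hn_sq_div_sqrt_tendsto_0: "(\<lambda>N. Hn N ^ 2 / sqrt (real N)) \<longlonglongrightarrow> 0"
proof (rule tendsto_sandwich[of "\<lambda>_. 0" _ _ "\<lambda>N. (1 + ln (real N)) ^ 2 / sqrt (real N)"])
  show "eventually (\<lambda>N. Hn N ^ 2 / sqrt (real N) \<le> (1 + ln (real N)) ^ 2 / sqrt (real N)) sequentially"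
    using eventually_ge_at_top[of 1]
    by eventually_elim (intro divide_right_mono power_mono Hn_le_ln Hn_nonneg; simp)
  show "(\<lambda>N. (1 + ln (real N)) ^ 2 / sqrt (real N)) \<longlonglongrightarrow> 0" by real_asymp
qed auto

text \<open>Two crude bounds for the tail \<open>D\<close> are combined:
  \<open>(N - k) * D \<le> k\<close>, which is weak for \<open>k\<close> near \<open>N\<close>, and
  \<open>D \<le> Hn N\<close>. Weighting the latter by \<open>k\<close> and adding bounds
  \<open>N * D\<close> uniformly in \<open>k\<close>.\<close>

lemma Hn_tail_le:
  assumes "k \<le> N" "1 \<le> N"
  shows "(\<Sum>l\<in>{N - k..<N}. 1 / real (Suc l)) \<le> 2 * real k * Hn N / real N"
proof -
  define D where "D = (\<Sum>l\<in>{N - k..<N}. 1 / real (Suc l))"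
  have D1: "D \<le> Hn N" unfolding D_def Hn_def by (rule sum_mono2) auto
  have "real (N - k) * D \<le> real k"
  proof -
    have "real (N - k) * D = (\<Sum>l\<in>{N - k..<N}. real (N - k) / real (Suc l))" by (simp add: D_def sum_distrib_left)
    also have "\<dots> \<le> (\<Sum>l\<in>{N - k..<N}. 1)" by (rule sum_mono) simp
    finally show ?thesis using assms by simp
  qed
  moreover have "real k * D \<le> real k * Hn N" using D1 by (intro mult_left_mono) auto
  moreover have "real k \<le> real k * Hn N" using Hn_ge_1[OF assms(2)] by (simp add: mult_le_cancel_left1)
  ultimately have "real (N - k) * D + real k * D \<le> 2 * real k * Hn N" by simp
  also have "real (N - k) * D + real k * D = real N * D"
    using assms(1) by (simp add: of_nat_diff algebra_simps)
  finally show ?thesis using assms by (simp add: D_def pos_le_divide_eq mult.commute)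
qed

lemma sum_inverse_sqrt_le: "(\<Sum>l<N. 1 / sqrt (real (Suc l))) \<le> 2 * sqrt (real N)"
proof (induction N)
  case (Suc N)
  have "1 / sqrt (real (Suc N)) \<le> 2 * (sqrt (real (Suc N)) - sqrt (real N))"
  proof -
    define u v where "u = sqrt (real (Suc N))" and "v = sqrt (real N)"
    have uv: "u ^ 2 - v ^ 2 = 1" "0 < u" "v \<le> u" by (simp_all add: u_def v_def)
    have "1 = (u - v) * (u + v)" using uv(1) by (simp add: power2_eq_square algebra_simps)
    also have "\<dots> \<le> (u - v) * (u + u)" using uv(3) by (intro mult_left_mono) auto
    finally have "1 \<le> 2 * (u - v) * u" by (simp add: algebra_simps)
    then show ?thesis using uv(2) unfolding u_def[symmetric] v_def[symmetric] by (simp add: divide_le_eq)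
  qed
  with Suc.IH show ?case by simp
qed simp

lemma sum_inverse_squares_le: "(\<Sum>j<N. 1 / real (Suc j) ^ 2) \<le> 2"
proof -
  have "(\<Sum>j<N. 1 / real (Suc j) ^ 2) \<le> (\<Sum>j<N. 2 * (1 / real (Suc j) - 1 / real (Suc (Suc j))))"
    by (rule sum_mono) (simp add: power2_eq_square divide_simps)
  also have "\<dots> = 2 * (1 - 1 / real (Suc N))"
    by (simp only: sum_distrib_left[symmetric] sum_lessThan_telescope'[of "\<lambda>j. 1 / real (Suc j)"]) simp
  also have "\<dots> \<le> 2" by simp
  finally show ?thesis .
qed

text \<open>The true order is \<open>n\<close> to the power \<open>-3/4\<close>. The exponent
  \<open>-1/2\<close> suffices and, after squaring, reduces the induction step to an inequality of
  rational functions.\<close>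

lemma prod_ratio_le: "(\<Prod>l<n. (real (Suc l) + 1 / 8) / (real (Suc l) + 7 / 8)) \<le> 1 / sqrt (real (Suc n))"
proof (induction n)
  case (Suc n)
  have "(real (Suc n) + 1 / 8) / (real (Suc n) + 7 / 8) \<le> sqrt (real (Suc n) / real (Suc (Suc n)))"
  proof (rule real_le_rsqrt)
    have "(x + 1 / 8) ^ 2 / (x + 7 / 8) ^ 2 \<le> x / (x + 1)" if "1 \<le> x" for x :: real
    proof -
      have "(x + 7 / 8) ^ 2 * x - (x + 1 / 8) ^ 2 * (x + 1) = x * x / 2 + x / 2 - 1 / 64"
        by (simp add: power2_eq_square field_simps)
      then have "(x + 1 / 8) ^ 2 * (x + 1) \<le> x * (x + 7 / 8) ^ 2"
        using that zero_le_square[of x] unfolding mult.commute[of x "_ ^ 2"] by linarith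
      moreover have "0 < (x + 7 / 8) ^ 2" using that by simp
      ultimately show ?thesis using that by (simp add: divide_le_eq pos_le_divide_eq)
    qed
    from this[of "real (Suc n)"] show "((real (Suc n) + 1 / 8) / (real (Suc n) + 7 / 8)) ^ 2 \<le> real (Suc n) / real (Suc (Suc n))"
      by (simp add: power_divide add_ac)
  qed
  with Suc.IH have "(\<Prod>l<Suc n. (real (Suc l) + 1 / 8) / (real (Suc l) + 7 / 8))
      \<le> 1 / sqrt (real (Suc n)) * sqrt (real (Suc n) / real (Suc (Suc n)))"
    unfolding prod.lessThan_Suc by (intro mult_mono) auto
  then show ?case by (simp add: real_sqrt_divide del: of_nat_Suc)
qed simp

text \<open>Here the true order is \<open>n\<close> to the power \<open>1/4\<close>. The bound
  controls \<open>h\<close> and, through the same product, the truncated zeta values.\<close>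

lemma prod_ratio_ge: "(\<Prod>l<n. (real (Suc l) + 1 / 8) / (real (Suc l) - 1 / 8)) \<le> sqrt (real (Suc n))"
proof (induction n)
  case (Suc n)
  have "(real (Suc n) + 1 / 8) / (real (Suc n) - 1 / 8) \<le> sqrt (real (Suc (Suc n)) / real (Suc n))"
  proof (rule real_le_rsqrt)
    have "(x + 1 / 8) ^ 2 / (x - 1 / 8) ^ 2 \<le> (x + 1) / x" if "1 \<le> x" for x :: real
    proof -
      have "(x - 1 / 8) ^ 2 * (x + 1) - (x + 1 / 8) ^ 2 * x = x * x / 2 - x / 4 + 1 / 64"
        by (simp add: power2_eq_square field_simps)
      then have "(x + 1 / 8) ^ 2 * x \<le> (x + 1) * (x - 1 / 8) ^ 2"
        using that mult_left_mono[of 1 x x] unfolding mult.commute[of "x + 1" "_ ^ 2"] by linarith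
      moreover have "0 < (x - 1 / 8) ^ 2" using that by simp
      ultimately show ?thesis using that by (simp add: divide_le_eq pos_le_divide_eq)
    qed
    from this[of "real (Suc n)"] show "((real (Suc n) + 1 / 8) / (real (Suc n) - 1 / 8)) ^ 2 \<le> real (Suc (Suc n)) / real (Suc n)"
      by (simp add: power_divide add_ac)
  qed
  with Suc.IH have "(\<Prod>l<Suc n. (real (Suc l) + 1 / 8) / (real (Suc l) - 1 / 8))
      \<le> sqrt (real (Suc n)) * sqrt (real (Suc (Suc n)) / real (Suc n))"
    unfolding prod.lessThan_Suc by (intro mult_mono) auto
  then show ?case by (simp add: real_sqrt_divide del: of_nat_Suc)
qed simp

section \<open>Passage to the limit\<close>

lemma chain_below_Cons:
  "chain_below t m (k # ks) = t / real (Suc m) ^ k * chain_below t m ks + zeta_trunc t m (k # ks)"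
  by (simp add: lessThan_Suc_atMost[symmetric] add.commute del: lessThan_Suc_atMost of_nat_Suc)

lemma chain_below_0: "chain_below 0 m ks = zeta_trunc 0 m ks"
  by (cases ks) (simp_all add: chain_below_Cons del: chain_below.simps(2) zeta_trunc_simps(2))

lemma zeta_trunc_0_Cons: "zeta_trunc 0 N (k # ks) = (\<Sum>l<N. 1 / real (Suc l) ^ k * zeta_trunc 0 l ks)"
  by (simp add: chain_below_0 del: of_nat_Suc)

lemma length_collapses: "p \<in> set (collapses ks) \<Longrightarrow> length p \<le> length ks"
proof (induction ks arbitrary: p rule: collapses.induct)
  case (3 a b rest)
  then show ?case by force
qed auto

text \<open>Comparing the first two positions: strict inequality is the comma, a tie of weight
  \<open>t\<close> merges the letters into \<open>a + b\<close> and is the plus sign. The merged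
  index is shorter by one, which accounts for the additional \<open>t\<close>.\<close>

lemma zeta_trunc_collapses:
  "zeta_trunc t N ks = (\<Sum>p\<leftarrow>collapses ks. t ^ (length ks - length p) * zeta_trunc 0 N p)"
proof (induction ks arbitrary: N rule: collapses.induct)
  case (3 a b rest)
  have swap: "(\<Sum>l<N. \<Sum>p\<leftarrow>ps. f l p) = (\<Sum>p\<leftarrow>ps. \<Sum>l<N. f l p)" for f :: "nat \<Rightarrow> nat list \<Rightarrow> real" and ps
    by (induction ps) (simp_all add: sum.distrib)
  have "zeta_trunc t N (a # b # rest)
      = (\<Sum>l<N. 1 / real (Suc l) ^ a * zeta_trunc t l (b # rest) + t * (1 / real (Suc l) ^ (a + b) * chain_below t l rest))"
    unfolding zeta_trunc_simps(2)[of t N] chain_below_Cons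
    by (rule sum.cong[OF refl]) (simp add: power_add distrib_left mult_ac del: of_nat_Suc)
  also have "\<dots> = (\<Sum>l<N. 1 / real (Suc l) ^ a * zeta_trunc t l (b # rest)) + t * zeta_trunc t N ((a + b) # rest)"
    by (simp add: sum.distrib sum_distrib_left del: of_nat_Suc)
  also have "(\<Sum>l<N. 1 / real (Suc l) ^ a * zeta_trunc t l (b # rest))
      = (\<Sum>p\<leftarrow>collapses (b # rest). t ^ (length (b # rest) - length p) * zeta_trunc 0 N (a # p))"
    unfolding 3(1) zeta_trunc_0_Cons sum_list_const_mult[symmetric] swap sum_distrib_left
    by (simp add: mult_ac del: of_nat_Suc)
  also have "t * zeta_trunc t N ((a + b) # rest)
      = (\<Sum>p\<leftarrow>collapses ((a + b) # rest). t ^ (length (a # b # rest) - length p) * zeta_trunc 0 N p)"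
    unfolding 3(2) sum_list_const_mult[symmetric]
  proof (intro arg_cong[of _ _ sum_list] map_cong refl)
    fix p assume "p \<in> set (collapses ((a + b) # rest))"
    from length_collapses[OF this]
    have "length (a # b # rest) - length p = Suc (length ((a + b) # rest) - length p)" by simp
    then show "t * (t ^ (length ((a + b) # rest) - length p) * zeta_trunc 0 N p)
        = t ^ (length (a # b # rest) - length p) * zeta_trunc 0 N p" by simp
  qed
  finally show ?case by (simp add: o_def del: zeta_trunc_simps(2))
qed auto

lemma collapses_admissible:
  assumes "p \<in> set (collapses ks)" "ks \<noteq> []" "\<forall>x\<in>set ks. 0 < x" "2 \<le> hd ks"
  shows "p \<noteq> []" "\<forall>x\<in>set p. 0 < x" "2 \<le> hd p"
proof -
  have "p \<noteq> [] \<and> (\<forall>x\<in>set p. 0 < x) \<and> hd ks \<le> hd p"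
    using assms(1,2,3)
  proof (induction ks arbitrary: p rule: collapses.induct)
    case (3 a b rest)
    then show ?case by fastforce
  qed auto
  with assms(4) show "p \<noteq> []" "\<forall>x\<in>set p. 0 < x" "2 \<le> hd p" by auto
qed

definition desc :: "nat \<Rightarrow> nat \<Rightarrow> nat list set" where
  "desc N n = {ms. length ms = n \<and> sorted_wrt (>) ms \<and> (\<forall>m\<in>set ms. 0 < m) \<and> (\<forall>m\<in>set ms. m \<le> N)}"

lemma desc_0 [simp]: "desc N 0 = {[]}"
  by (auto simp: desc_def)

lemma desc_Suc: "desc N (Suc n) = (\<Union>l<N. (#) (Suc l) ` desc l n)"
proof (intro equalityI subsetI)
  fix ms assume ms: "ms \<in> desc N (Suc n)"
  then obtain m ms' where m: "ms = m # ms'" by (cases ms) (auto simp: desc_def)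
  with ms obtain l where "m = Suc l" by (cases m) (auto simp: desc_def)
  with ms m show "ms \<in> (\<Union>l<N. (#) (Suc l) ` desc l n)"
    by (intro UN_I[of l] image_eqI[of _ _ ms']) (auto simp: desc_def)
qed (fastforce simp: desc_def)

lemma finite_desc [simp]: "finite (desc N n)"
  by (induction n arbitrary: N) (simp_all add: desc_Suc)

lemma zeta_trunc_0_eq_sum:
  "zeta_trunc 0 N ks = (\<Sum>ms\<in>desc N (length ks). \<Prod>j<length ks. 1 / real (ms ! j) ^ (ks ! j))"
proof (induction ks arbitrary: N)
  case (Cons k ks)
  have "(\<Sum>ms\<in>desc N (length (k # ks)). \<Prod>j<length (k # ks). 1 / real (ms ! j) ^ ((k # ks) ! j))
      = (\<Sum>l<N. \<Sum>ms\<in>(#) (Suc l) ` desc l (length ks). \<Prod>j<length (k # ks). 1 / real (ms ! j) ^ ((k # ks) ! j))"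
    unfolding list.size(4) add_0_right add_Suc_right desc_Suc by (rule sum.UNION_disjoint) auto
  also have "\<dots> = (\<Sum>l<N. \<Sum>ms\<in>desc l (length ks). \<Prod>j<length (k # ks). 1 / real ((Suc l # ms) ! j) ^ ((k # ks) ! j))"
    by (intro sum.cong refl sum.reindex_cong[of "(#) _"]) auto
  also have "\<dots> = zeta_trunc 0 N (k # ks)"
    by (simp add: zeta_trunc_0_Cons Cons.IH prod.lessThan_Suc_shift sum_distrib_left del: prod.lessThan_Suc zeta_trunc_simps(2) of_nat_Suc)
  finally show ?case by (rule sym)
qed simp

lemma zeta_trunc_0_nonneg: "0 \<le> zeta_trunc 0 N ks"
  unfolding zeta_trunc_0_eq_sum by (intro sum_nonneg prod_nonneg) simp

text \<open>The product serves as a majorant because its increment at \<open>l\<close> is at least a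
  quarter of its value divided by \<open>l + 1\<close>: each further letter then costs only a factor
  4.\<close>

lemma zeta_trunc_0_le:
  assumes "\<forall>x\<in>set ks. 0 < x"
  shows "zeta_trunc 0 N ks \<le> 4 ^ length ks * (\<Prod>l<N. (real (Suc l) + 1 / 8) / (real (Suc l) - 1 / 8))"
  using assms
proof (induction ks arbitrary: N)
  case Nil
  have "1 \<le> (\<Prod>l<N. (real (Suc l) + 1 / 8) / (real (Suc l) - 1 / 8))"
    by (intro prod_ge_1) simp
  then show ?case by simp
next
  case (Cons k ks)
  define P where "P N = (\<Prod>l<N. (real (Suc l) + 1 / 8) / (real (Suc l) - 1 / 8))" for N
  have P0: "0 \<le> P N" for N unfolding P_def by (intro prod_nonneg) simp
  have P: "1 / real (Suc l) * P l \<le> 4 * (P (Suc l) - P l)" for l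
  proof -
    have "P (Suc l) - P l = P l * ((1 / 4) / (real (Suc l) - 1 / 8))"
    proof -
      have "(real (Suc l) + 1 / 8) / (real (Suc l) - 1 / 8) = 1 + (1 / 4) / (real (Suc l) - 1 / 8)"
        by (simp add: field_simps)
      then show ?thesis by (simp add: P_def distrib_left del: of_nat_Suc)
    qed
    moreover have "1 / real (Suc l) \<le> 4 * ((1 / 4) / (real (Suc l) - 1 / 8))"
      by (simp add: field_simps)
    ultimately show ?thesis
      using mult_right_mono[OF _ P0[of l], of "1 / real (Suc l)" "4 * ((1 / 4) / (real (Suc l) - 1 / 8))"]
      by (simp only: mult_ac)
  qed
  have "zeta_trunc 0 N (k # ks) \<le> (\<Sum>l<N. 4 ^ length ks * (4 * (P (Suc l) - P l)))"
    unfolding zeta_trunc_0_Cons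
  proof (rule sum_mono)
    fix l
    have "real (Suc l) ^ 1 \<le> real (Suc l) ^ k"
      using Cons.prems by (intro power_increasing) auto
    then have "1 / real (Suc l) ^ k \<le> 1 / real (Suc l)" by (intro divide_left_mono) auto
    then have "1 / real (Suc l) ^ k * zeta_trunc 0 l ks \<le> 1 / real (Suc l) * (4 ^ length ks * P l)"
      using Cons.prems Cons.IH[of l] by (intro mult_mono) (simp_all add: P_def zeta_trunc_0_nonneg del: of_nat_Suc)
    also have "\<dots> \<le> 4 ^ length ks * (4 * (P (Suc l) - P l))"
      using mult_left_mono[OF P[of l], of "4 ^ length ks"] by (simp add: mult_ac)
    finally show "1 / real (Suc l) ^ k * zeta_trunc 0 l ks \<le> 4 ^ length ks * (4 * (P (Suc l) - P l))" .
  qed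
  also have "\<dots> = 4 ^ length (k # ks) * (P N - P 0)"
    by (simp only: sum_distrib_left[symmetric] sum_lessThan_telescope) simp
  also have "\<dots> \<le> 4 ^ length (k # ks) * P N" using P0[of 0] by (intro mult_left_mono) auto
  finally show ?case by (simp only: P_def)
qed

lemma zeta_trunc_0_bounded:
  assumes "\<forall>x\<in>set ks. 0 < x" "ks \<noteq> []" "2 \<le> hd ks"
  shows "\<exists>B. \<forall>N. zeta_trunc 0 N ks \<le> B"
proof -
  obtain k ks' where ks: "ks = k # ks'" "2 \<le> k" using assms by (cases ks) auto
  have "summable (\<lambda>l. real (Suc l) powr (- 3 / 2))"
    by (subst summable_Suc_iff) (simp add: summable_real_powr_iff)
  then have B: "(\<Sum>l<N. real (Suc l) powr (- 3 / 2)) \<le> (\<Sum>l. real (Suc l) powr (- 3 / 2))" for N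
    by (intro sum_le_suminf) auto
  have "zeta_trunc 0 N ks \<le> 4 ^ length ks' * (\<Sum>l. real (Suc l) powr (- 3 / 2))" for N
  proof -
    have "zeta_trunc 0 N ks \<le> (\<Sum>l<N. 4 ^ length ks' * real (Suc l) powr (- 3 / 2))"
      unfolding ks zeta_trunc_0_Cons
    proof (rule sum_mono)
      fix l
      have "real (Suc l) ^ 2 \<le> real (Suc l) ^ k" using ks(2) by (intro power_increasing) auto
      then have "1 / real (Suc l) ^ k \<le> 1 / real (Suc l) ^ 2" by (intro divide_left_mono) auto
      moreover have "zeta_trunc 0 l ks' \<le> 4 ^ length ks' * sqrt (real (Suc l))"
        using zeta_trunc_0_le[of ks' l] prod_ratio_ge[of l] assms(1) unfolding ks
        by (auto intro: order_trans mult_left_mono)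
      ultimately have "1 / real (Suc l) ^ k * zeta_trunc 0 l ks' \<le> 1 / real (Suc l) ^ 2 * (4 ^ length ks' * sqrt (real (Suc l)))"
        by (intro mult_mono) (auto simp: zeta_trunc_0_nonneg)
      also have "\<dots> = 4 ^ length ks' * real (Suc l) powr (- 3 / 2)"
      proof -
        have "real (Suc l) powr (- 3 / 2) = real (Suc l) powr (1 / 2) * real (Suc l) powr (- 2)"
          by (simp flip: powr_add)
        also have "\<dots> = sqrt (real (Suc l)) * (1 / real (Suc l) ^ 2)"
          by (simp add: powr_half_sqrt powr_minus_divide del: of_nat_Suc)
        finally show ?thesis by simp
      qed
      finally show "1 / real (Suc l) ^ k * zeta_trunc 0 l ks' \<le> 4 ^ length ks' * real (Suc l) powr (- 3 / 2)" .
    qed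
    also have "\<dots> \<le> 4 ^ length ks' * (\<Sum>l. real (Suc l) powr (- 3 / 2))"
      unfolding sum_distrib_left[symmetric] by (intro mult_left_mono B) simp
    finally show ?thesis .
  qed
  then show ?thesis by blast
qed

text \<open>\<open>mzv\<close> is an unordered sum of nonnegative terms. The finite sets
  \<open>desc N (length ks)\<close> exhaust its index set, so bounded truncations give summability,
  and the sum is the limit along these sets.\<close>

lemma zeta_trunc_0_tendsto:
  assumes "\<forall>x\<in>set ks. 0 < x" "ks \<noteq> []" "2 \<le> hd ks"
  shows "(\<lambda>N. zeta_trunc 0 N ks) \<longlonglongrightarrow> mzv ks"
proof -
  let ?S = "{ms :: nat list. length ms = length ks \<and> sorted_wrt (>) ms \<and> (\<forall>m\<in>set ms. 0 < m)}"
  let ?f = "\<lambda>ms :: nat list. \<Prod>j<length ks. 1 / real (ms ! j) ^ (ks ! j)"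
  obtain B where B: "\<And>N. zeta_trunc 0 N ks \<le> B" using zeta_trunc_0_bounded[OF assms] by blast
  have sub: "\<exists>M. \<forall>N\<ge>M. F \<subseteq> desc N (length ks)" if "finite F" "F \<subseteq> ?S" for F
  proof (intro exI allI impI subsetI)
    fix N ms assume N: "Max (insert 0 (\<Union>(set ` F))) \<le> N" and "ms \<in> F"
    then have "m \<le> N" if "m \<in> set ms" for m
      using that \<open>finite F\<close> by (intro order_trans[OF Max_ge N]) auto
    then show "ms \<in> desc N (length ks)" using \<open>ms \<in> F\<close> \<open>F \<subseteq> ?S\<close> by (auto simp: desc_def)
  qed
  have desc_sub: "desc N (length ks) \<subseteq> ?S" for N by (auto simp: desc_def)
  have "?f summable_on ?S"
  proof (rule nonneg_bdd_above_summable_on)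
    show "0 \<le> ?f ms" for ms by (intro prod_nonneg) simp
    show "bdd_above (sum ?f ` {F. F \<subseteq> ?S \<and> finite F})"
    proof (rule bdd_aboveI[of _ B], clarify)
      fix F assume F: "F \<subseteq> ?S" "finite F"
      then obtain N where "F \<subseteq> desc N (length ks)" using sub[of F] by blast
      then have "sum ?f F \<le> sum ?f (desc N (length ks))"
        by (intro sum_mono2) (auto intro!: prod_nonneg)
      also have "\<dots> \<le> B" using B[of N] by (simp add: zeta_trunc_0_eq_sum)
      finally show "sum ?f F \<le> B" .
    qed
  qed
  then have "(?f has_sum mzv ks) ?S" by (simp add: mzv_def)
  then have "(sum ?f \<longlongrightarrow> mzv ks) (finite_subsets_at_top ?S)" by (simp add: has_sum_def)
  moreover have "filterlim (\<lambda>N. desc N (length ks)) (finite_subsets_at_top ?S) sequentially"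
    unfolding filterlim_finite_subsets_at_top
  proof (intro allI impI)
    fix F assume "finite F \<and> F \<subseteq> ?S"
    then obtain M where "\<forall>N\<ge>M. F \<subseteq> desc N (length ks)" using sub[of F] by blast
    then show "eventually (\<lambda>N. finite (desc N (length ks)) \<and> F \<subseteq> desc N (length ks) \<and> desc N (length ks) \<subseteq> ?S) sequentially"
      unfolding eventually_sequentially using desc_sub by (intro exI[of _ M]) auto
  qed
  ultimately have "(\<lambda>N. sum ?f (desc N (length ks))) \<longlonglongrightarrow> mzv ks"
    by (rule filterlim_compose)
  then show ?thesis by (simp add: zeta_trunc_0_eq_sum)
qed

lemma zeta_trunc_tendsto:
  assumes "\<forall>x\<in>set ks. 0 < x" "ks \<noteq> []" "2 \<le> hd ks"
  shows "(\<lambda>N. zeta_trunc t N ks) \<longlonglongrightarrow> zeta_t t ks"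
proof -
  have "(\<lambda>N. \<Sum>p\<leftarrow>ps. t ^ (length ks - length p) * zeta_trunc 0 N p)
      \<longlonglongrightarrow> (\<Sum>p\<leftarrow>ps. t ^ (length ks - length p) * mzv p)" if "set ps \<subseteq> set (collapses ks)" for ps
    using that
  proof (induction ps)
    case (Cons p ps)
    then have "p \<in> set (collapses ks)" by simp
    from collapses_admissible[OF this assms(2,1,3)] Cons show ?case
      by (auto intro!: tendsto_intros zeta_trunc_0_tendsto)
  qed simp
  then show ?thesis unfolding zeta_trunc_collapses[of t _ ks] zeta_t_def by blast
qed

section \<open>The weights of the theorem as linear recurrences along the index\<close>

lemma Cf_Cons:
  assumes "0 < k" "\<forall>x\<in>set ks. 0 < x"
  shows "Cf (k # ks) = 2 ^ (k - 1) * (1 + Cf ks)"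
proof -
  \<comment> \<open>The exponents in \<open>Cf\<close> are truncated subtractions. Positivity of the
    entries makes them genuine, so that \<open>2 ^ (k - 1)\<close> splits off.\<close>
  have ge: "j \<le> sum_list (take j ks)" if "j \<le> length ks" for j
    using that assms(2)
  proof (induction ks arbitrary: j)
    case (Cons a ks)
    show ?case
    proof (cases j)
      case (Suc i)
      then have "i \<le> sum_list (take i ks)" using Cons by auto
      then show ?thesis using Suc Cons.prems by auto
    qed simp
  qed simp
  have "(\<Sum>j=1..length (k # ks). (2::int) ^ (sum_list (take j (k # ks)) - j))
      = (\<Sum>j=0..length ks. 2 ^ (sum_list (take (Suc j) (k # ks)) - Suc j))"
    using sum.atLeast_Suc_atMost_Suc_shift[of "\<lambda>j. (2::int) ^ (sum_list (take j (k # ks)) - j)" 0 "length ks"]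
    by (simp only: list.size(4) add_0_right add_Suc_right One_nat_def o_def)
  also have "\<dots> = (\<Sum>j=0..length ks. 2 ^ (k - 1) * 2 ^ (sum_list (take j ks) - j))"
  proof (rule sum.cong[OF refl])
    fix j assume "j \<in> {0..length ks}"
    then have "sum_list (take (Suc j) (k # ks)) - Suc j = (k - 1) + (sum_list (take j ks) - j)"
      using ge[of j] assms(1) by simp
    then show "(2::int) ^ (sum_list (take (Suc j) (k # ks)) - Suc j) = 2 ^ (k - 1) * 2 ^ (sum_list (take j ks) - j)"
      by (simp only: power_add)
  qed
  also have "\<dots> = 2 ^ (k - 1) * (1 + (\<Sum>j=1..length ks. 2 ^ (sum_list (take j ks) - j)))"
    by (simp add: sum.atLeast_Suc_atMost sum_distrib_left distrib_left)
  finally have 1: "(\<Sum>j=1..length (k # ks). (2::int) ^ (sum_list (take j (k # ks)) - j))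
      = 2 ^ (k - 1) * (1 + (\<Sum>j=1..length ks. 2 ^ (sum_list (take j ks) - j)))" .
  have "sum_list (k # ks) - length (k # ks) = (k - 1) + (sum_list ks - length ks)"
    using ge[of "length ks"] assms(1) by simp
  then have "(2::int) ^ (sum_list (k # ks) - length (k # ks)) = 2 ^ (k - 1) * 2 ^ (sum_list ks - length ks)"
    by (simp only: power_add)
  with 1 show ?thesis unfolding Cf_def by (simp only: distrib_left add.assoc)
qed

lemma Cf_Nil [simp]: "Cf [] = 1"
  by (simp add: Cf_def)

lemma set_butlast_pos: "\<forall>x\<in>set ks. (0::nat) < x \<Longrightarrow> \<forall>x\<in>set (butlast ks). 0 < x"
  by (auto dest: in_set_butlastD)

lemma wA_eq: "\<forall>x\<in>set ks. 0 < x \<Longrightarrow> ks \<noteq> [] \<Longrightarrow> wA ks = 1 + real_of_int (Cf (butlast ks))"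
  by (induction ks) (auto simp: Cf_Cons set_butlast_pos)

lemma wB_eq: "\<forall>x\<in>set ks. 0 < x \<Longrightarrow> ks \<noteq> [] \<Longrightarrow> wB ks = real_of_int (Cf ks) - real_of_int (Cf (butlast ks))"
proof (induction ks)
  case (Cons k ks)
  show ?case
  proof (cases "ks = []")
    case False
    then have "wB (k # ks) = 2 ^ (k - 1) * (real_of_int (Cf ks) - real_of_int (Cf (butlast ks)))"
      using Cons by simp
    moreover have "Cf (k # butlast ks) = 2 ^ (k - 1) * (1 + Cf (butlast ks))"
      using Cons.prems by (intro Cf_Cons) (auto dest: in_set_butlastD)
    ultimately show ?thesis using False Cons.prems by (simp add: Cf_Cons right_diff_distrib distrib_left)
  qed (use Cons.prems in \<open>simp add: Cf_Cons\<close>)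
qed simp

lemma Ct_tilde_eq:
  assumes "0 < k" "\<forall>x\<in>set ks. 0 < x" "ks \<noteq> []"
  shows "real_of_int (Ct_tilde (k # ks)) = 1 + (2 ^ (k - 1) - 1) * wA ks"
  using assms by (simp add: Ct_tilde_def Ct_def Cf_Cons set_butlast_pos wA_eq algebra_simps)

lemma Ct_diff_eq:
  assumes "0 < k" "\<forall>x\<in>set ks. 0 < x"
  shows "real_of_int (Ct (k # ks) - Ct_tilde (k # ks))
    = (2 ^ (k - 1) - 1) * wB ks - (if ks = [] then real (k - 1) else 0)"
proof (cases "ks = []")
  case True
  then show ?thesis using assms by (simp add: Ct_tilde_def Ct_def Cf_Cons algebra_simps)
next
  case False
  then show ?thesis using assms
    by (simp add: Ct_tilde_def Ct_def Cf_Cons set_butlast_pos wB_eq algebra_simps)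
qed

lemma b_coef_eq: "real (b_coef (k # ks)) = real ((k - 2) choose 2) + wD ks"
proof -
  have "real (\<Sum>x\<leftarrow>ks. (x - 1) choose 2) = wD ks" by (induction ks) (simp_all add: wD_def)
  then show ?thesis by (simp add: b_coef_def)
qed

lemma zeta_trunc_tendsto_Cons:
  assumes "2 \<le> k" "\<forall>x\<in>set ks. 0 < x"
  shows "(\<lambda>N. zeta_trunc t N (k # ks)) \<longlonglongrightarrow> zeta_t t (k # ks)"
  using assms by (intro zeta_trunc_tendsto) auto

text \<open>For a first letter 1 all three terms are 0 at every \<open>N\<close>, so divergent
  truncations never enter.\<close>

lemma term_tendsto:
  assumes "\<forall>x\<in>set ks. 0 < x"
  defines "adm \<equiv> ks \<noteq> [] \<and> 2 \<le> hd ks"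
  shows "(\<lambda>N. termA t N ks) \<longlonglongrightarrow> (if adm \<and> length ks \<noteq> 1 then real_of_int (Ct_tilde ks) * zeta_t t ks else 0)"
    and "(\<lambda>N. termB t N ks) \<longlonglongrightarrow> (if adm then real_of_int (Ct ks - Ct_tilde ks) * zeta_t t ks else 0)"
    and "(\<lambda>N. termD t N ks) \<longlonglongrightarrow> (if adm then real (b_coef ks) * zeta_t t ks else 0)"
proof -
  have "((\<lambda>N. termA t N ks) \<longlonglongrightarrow> (if adm \<and> length ks \<noteq> 1 then real_of_int (Ct_tilde ks) * zeta_t t ks else 0))
    \<and> ((\<lambda>N. termB t N ks) \<longlonglongrightarrow> (if adm then real_of_int (Ct ks - Ct_tilde ks) * zeta_t t ks else 0))
    \<and> ((\<lambda>N. termD t N ks) \<longlonglongrightarrow> (if adm then real (b_coef ks) * zeta_t t ks else 0))"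
  proof (cases ks)
    case Nil
    then show ?thesis by (simp add: adm_def termA_def termB_def termD_def)
  next
    case (Cons k ks')
    have k: "0 < k" "\<forall>x\<in>set ks'. 0 < x" using assms(1) Cons by auto
    show ?thesis
    proof (cases "2 \<le> k")
      case True
      note lim = zeta_trunc_tendsto_Cons[OF True k(2), of t]
      have adm: "adm" using True Cons by (simp add: adm_def)
      have lenA: "length ks \<noteq> 1 \<longleftrightarrow> ks' \<noteq> []" using Cons by auto
      show ?thesis
        unfolding lenA Cons using adm True k
        by (simp add: termA_def termB_def termD_def Ct_tilde_eq Ct_diff_eq b_coef_eq
            del: of_int_diff zeta_trunc_simps(2) One_nat_def) (use lim in \<open>auto intro!: tendsto_mult_left simp del: zeta_trunc_simps(2)\<close>)
    next
      case False
      then have "k = 1" using k(1) by simp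
      then show ?thesis using Cons by (simp add: adm_def termA_def termB_def termD_def)
    qed
  qed
  then show "(\<lambda>N. termA t N ks) \<longlonglongrightarrow> (if adm \<and> length ks \<noteq> 1 then real_of_int (Ct_tilde ks) * zeta_t t ks else 0)"
    and "(\<lambda>N. termB t N ks) \<longlonglongrightarrow> (if adm then real_of_int (Ct ks - Ct_tilde ks) * zeta_t t ks else 0)"
    and "(\<lambda>N. termD t N ks) \<longlonglongrightarrow> (if adm then real (b_coef ks) * zeta_t t ks else 0)"
    by blast+
qed

section \<open>The error terms\<close>

locale mzv_err = mzv_gen +
  fixes R :: nat
begin

text \<open>Chosen so that \<open>\<bar>p\<bar> * rad \<le> 1 / 8\<close> for all multiples
  \<open>p * z\<close> in play: \<open>z\<close>, \<open>a'\<close>, \<open>v'\<close> and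
  \<open>y\<close>. The value 1/8 is the shift in the two product estimates.\<close>

definition rad :: real where "rad = 1 / (8 * (2 + \<bar>t * \<mu>\<bar> + \<bar>\<mu>\<bar>))"

lemma rad: "0 < rad" "\<bar>p\<bar> \<le> 2 + \<bar>t * \<mu>\<bar> + \<bar>\<mu>\<bar> \<Longrightarrow> \<bar>p\<bar> * rad \<le> 1 / 8"
proof -
  have "0 < 2 + \<bar>t * \<mu>\<bar> + \<bar>\<mu>\<bar>" by linarith
  then show "0 < rad" "\<bar>p\<bar> \<le> 2 + \<bar>t * \<mu>\<bar> + \<bar>\<mu>\<bar> \<Longrightarrow> \<bar>p\<bar> * rad \<le> 1 / 8"
    by (simp_all add: rad_def divide_le_eq)
qed

sublocale trunc_norm rad R
  by unfold_locales (rule rad)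

abbreviation "a' \<equiv> z + fls_const t * y"
abbreviation "v' \<equiv> z + fls_const t * y - y"

lemma a'_eq: "a' = fls_const (1 + t * \<mu>) * z"
  by (simp add: distrib_right mult.assoc flip: fls_plus_const fls_const_mult_const)

lemma v'_eq: "v' = fls_const (1 + t * \<mu> - \<mu>) * z"
  unfolding a'_eq by (simp add: left_diff_distrib flip: fls_minus_const)

lemma nb_inv:
  "nb (1 / (Q m - z)) (2 / real (Suc m))" "nb (1 / (Q m - a')) (2 / real (Suc m))"
  "nb (1 / (Q m - v')) (2 / real (Suc m))" "nb (1 / (Q m - y)) (2 / real (Suc m))"
  "nb (1 / Q m) (2 / real (Suc m))" "nb (1 / (Q m - a')) (1 / (real (Suc m) - 1 / 8))"
proof -
  have p: "\<bar>p\<bar> * rad \<le> 1 / 8" if "p \<in> {0, 1, 1 + t * \<mu>, 1 + t * \<mu> - \<mu>, \<mu>}" for p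
    by (rule rad(2)) (use that in auto)
  note i = nb_inverse_letter'[OF p]
  show "nb (1 / (Q m - z)) (2 / real (Suc m))" using i[of 1 m] by simp
  show "nb (1 / (Q m - a')) (2 / real (Suc m))" using i[of "1 + t * \<mu>" m] unfolding a'_eq by simp
  show "nb (1 / (Q m - v')) (2 / real (Suc m))" using i[of "1 + t * \<mu> - \<mu>" m] unfolding v'_eq by simp
  show "nb (1 / (Q m - y)) (2 / real (Suc m))" using i[of \<mu> m] by simp
  show "nb (1 / Q m) (2 / real (Suc m))" using i[of 0 m] by simp
  show "nb (1 / (Q m - a')) (1 / (real (Suc m) - 1 / 8))"
    using nb_inverse_letter[OF p, of "1 + t * \<mu>" m] unfolding a'_eq by simp
qed

lemma nb_v: "nb (Q m - v') (real (Suc m) + 1 / 8)"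
  using nb_letter[of m "1 + t * \<mu> - \<mu>"] rad(2)[of "1 + t * \<mu> - \<mu>"]
  unfolding v'_eq by (auto intro: nb_mono)

lemma nb_z: "nb z 1"
  by (rule nb_mono[OF nb_X]) (use rad(2)[of 1] in simp)

lemma nb_y: "nb y 1"
  by (rule nb_mono[OF nb_mult[OF nb_const nb_X]]) (use rad(2)[of \<mu>] in simp)

lemma nb_1_minus_t: "nb (1 - fls_const t) (1 + \<bar>t\<bar>)"
  by (intro nb_diff nb_1 nb_const)

lemma nb_h: "nb (h n) (sqrt (real (Suc n)))"
proof -
  have "nb (\<Prod>l<n. (Q l - v') * (1 / (Q l - a'))) (\<Prod>l<n. (real (Suc l) + 1 / 8) * (1 / (real (Suc l) - 1 / 8)))"
    by (intro nb_prod nb_mult nb_v nb_inv)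
  moreover have "h n = (\<Prod>l<n. (Q l - v') * (1 / (Q l - a')))" by (simp add: h_def del: of_nat_Suc)
  ultimately show ?thesis using nb_mono[OF _ prod_ratio_ge[of n]] by simp
qed

lemma nb_c: "nb (c n) (2 / sqrt (real (Suc n)))"
proof -
  have "c n = h n * (1 / (Q n - a'))" by (simp add: c_def)
  moreover have "sqrt x * (2 / x) = 2 / sqrt x" if "0 \<le> x" for x
  proof -
    have "sqrt x * (2 / x) = 2 * (sqrt x / x)" by simp
    also have "\<dots> = 2 / sqrt x" unfolding sqrt_divide_self_eq[OF that] by (simp add: inverse_eq_divide)
    finally show ?thesis .
  qed
  ultimately show ?thesis using nb_mult[OF nb_h nb_inv(2), of n n] by simp
qed

lemma nb_rho: "nb (rho j n) (1 / sqrt (real (Suc n)))"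
proof -
  \<comment> \<open>The integer here is \<open>l + j + 2\<close>, so even at \<open>j = 0\<close>
    the denominator is at least \<open>(l + 2) - 1 / 8\<close>.\<close>
  have "nb (1 / (Q (l + j + 1) - a')) (1 / (real (Suc l) + 7 / 8))" for l
    by (rule nb_mono[OF nb_inv(6)]) (auto intro!: divide_left_mono mult_pos_pos)
  then have "nb (\<Prod>l<n. (Q l - v') * (1 / (Q (l + j + 1) - a'))) (\<Prod>l<n. (real (Suc l) + 1 / 8) * (1 / (real (Suc l) + 7 / 8)))"
    by (intro nb_prod nb_mult nb_v)
  moreover have "rho j n = (\<Prod>l<n. (Q l - v') * (1 / (Q (l + j + 1) - a')))" by (simp add: rho_def del: of_nat_Suc)
  ultimately show ?thesis using nb_mono[OF _ prod_ratio_le[of n]] by simp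
qed

lemma nb_kappa: "nb (kappa j n) (2 / real (Suc j))"
proof -
  have "nb (rho j n * (1 / (Q j - a'))) (1 * (2 / real (Suc j)))"
    by (intro nb_mult nb_inv nb_mono[OF nb_rho]) simp
  then show ?thesis by (simp add: kappa_def del: of_nat_Suc)
qed

definition K :: real where "K = 4 * (1 + \<bar>t\<bar>)"

lemma K: "0 < K" "(1 + \<bar>t\<bar>) * (2 * H) + \<bar>t\<bar> * (2 * H) \<le> K * H" if "0 \<le> H" for H
  using that by (auto simp: K_def algebra_simps)

lemma sum_2_div: "(\<Sum>l<N. 2 / real (Suc l)) = 2 * Hn N"
  by (simp add: Hn_def sum_distrib_left)

text \<open>Shared by both logarithmic derivatives. \<open>B\<close> bounds the norms of the
  summands and \<open>D\<close> replaces it by a piece of the harmonic sum.\<close>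

lemma nb_log_deriv_sums:
  assumes "finite I" "\<And>i. i \<in> I \<Longrightarrow> B i \<le> D i" "(\<Sum>i\<in>I. D i) \<le> 2 * H" "n \<le> N" "2 * Hn N \<le> 2 * H"
    "\<And>i. i \<in> I \<Longrightarrow> nb (f i) (B i)"
  shows "nb ((1 - fls_const t) * (\<Sum>i\<in>I. f i) + fls_const t * (\<Sum>l<n. 1 / (Q l - v'))) (K * H)"
proof (rule nb_mono[OF nb_add[OF nb_mult[OF nb_1_minus_t nb_sum] nb_mult[OF nb_const nb_sum]]])
  have "(\<Sum>i\<in>I. B i) \<le> (\<Sum>i\<in>I. D i)" using assms(2) by (rule sum_mono)
  then have 1: "(\<Sum>i\<in>I. B i) \<le> 2 * H" using assms(3) by simp
  have "(\<Sum>l<n. 2 / real (Suc l)) \<le> (\<Sum>l<N. 2 / real (Suc l))"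
    using assms(4) by (intro sum_mono2) auto
  then have 2: "(\<Sum>l<n. 2 / real (Suc l)) \<le> 2 * H" using assms(5) by (simp only: sum_2_div)
  have "0 \<le> H" using assms(5) Hn_nonneg[of N] by simp
  from K(2)[OF this] mult_left_mono[OF 1, of "1 + \<bar>t\<bar>"] mult_left_mono[OF 2, of "\<bar>t\<bar>"]
  show "(1 + \<bar>t\<bar>) * (\<Sum>i\<in>I. B i) + \<bar>t\<bar> * (\<Sum>l<n. 2 / real (Suc l)) \<le> K * H" by simp
qed (use assms(6) nb_inv(3) in auto)

lemma nb_log_deriv:
  assumes "n < N" shows "nb (log_deriv N n) (K * Hn N)"
  unfolding log_deriv_def
proof (rule nb_log_deriv_sums[where n = n and N = N and B = "\<lambda>i. 2 / real (Suc (N + i))" and D = "\<lambda>i. 2 / real (Suc i)"])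
  show "(\<Sum>i\<le>n. 2 / real (Suc i)) \<le> 2 * Hn N"
    unfolding sum_2_div[symmetric] using assms by (intro sum_mono2) auto
  show "nb (1 / (Q (N + i) - a')) (2 / real (Suc (N + i)))" for i by (rule nb_inv)
  show "2 / real (Suc (N + i)) \<le> 2 / real (Suc i)" for i by (intro divide_left_mono) auto
qed (use assms in auto)

lemma nb_log_deriv_rho: "nb (log_deriv_rho j N) (K * Hn N)"
proof -
  have "nb ((1 - fls_const t) * (\<Sum>l<N. 1 / (Q (l + j + 1) - a')) + fls_const t * (\<Sum>l<N. 1 / (Q l - v'))) (K * Hn N)"
  proof (rule nb_log_deriv_sums[where N = N and B = "\<lambda>l. 2 / real (Suc (l + j + 1))" and D = "\<lambda>l. 2 / real (Suc l)"])
    show "nb (1 / (Q (l + j + 1) - a')) (2 / real (Suc (l + j + 1)))" for l by (rule nb_inv)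
    show "2 / real (Suc (l + j + 1)) \<le> 2 / real (Suc l)" for l by (intro divide_left_mono) auto
    show "(\<Sum>l<N. 2 / real (Suc l)) \<le> 2 * Hn N" by (simp only: sum_2_div)
  qed auto
  then show ?thesis by (simp only: log_deriv_rho_def add.commute)
qed

lemma nb_PY: "nb (1 / ((Q j - a') * (Q j - y))) (4 / real (Suc j) ^ 2)"
proof -
  have "2 / real (Suc j) * (2 / real (Suc j)) = 4 / real (Suc j) ^ 2"
    by (simp add: power2_eq_square)
  then show ?thesis
    using nb_mult[OF nb_inv(2)[of j] nb_inv(4)[of j]] by (simp only: times_divide_times_eq mult_1_right)
qed

lemma nb_main: "nb (main_deriv j) (8 * (2 + \<bar>t\<bar>) / real (Suc j) ^ 2)"
proof -
  have "main_deriv j = (1 - fls_const t) * (1 / ((Q j - a') * (Q j - y)) * (1 / (Q j - a')))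
      + 1 / ((Q j - a') * (Q j - y)) * (1 / (Q j - y))"
  proof -
    have "e / (P ^ 2 * Y) + 1 / (P * Y ^ 2) = e * (1 / (P * Y) * (1 / P)) + 1 / (P * Y) * (1 / Y)" for e P Y :: "real fls"
      by (simp add: power2_eq_square mult_ac)
    then show ?thesis unfolding main_deriv_def .
  qed
  moreover have "nb \<dots> ((1 + \<bar>t\<bar>) * (4 / real (Suc j) ^ 2 * 2) + 4 / real (Suc j) ^ 2 * 2)"
    by (intro nb_add nb_mult nb_1_minus_t nb_PY nb_mono[OF nb_inv(2)] nb_mono[OF nb_inv(4)]) (simp_all add: divide_le_eq)
  ultimately show ?thesis by (simp add: field_simps del: of_nat_Suc)
qed

text \<open>A common majorant of all decay rates that occur, so that the error terms can simply be
  added.\<close>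

definition rate :: "nat \<Rightarrow> real" where "rate N = Hn N ^ 2 / sqrt (real N)"

text \<open>The edges of the double sum: \<open>kappa N n\<close> from \<open>j = N\<close>,
  \<open>rho j N\<close> from \<open>n = N\<close>. \<open>err_deriv\<close> is its differentiated
  counterpart.\<close>

definition "err_sum N = (\<Sum>n<N. kappa N n / Q n) - (\<Sum>j<N. rho j N / ((Q j - a') * (Q j - y)))"
definition "err_deriv N = (\<Sum>n<N. kappa N n * log_deriv N n / Q n)
  - (\<Sum>j<N. rho j N * main_deriv j + rho j N * log_deriv_rho j N / ((Q j - a') * (Q j - y)))"
definition "err_shuffle N = (\<Sum>n<N. z * c n / Q n * (A N - A (N - Suc n)))"

lemma add_diff_swap: "k + (s - r) = s + (k - r)" for k s r :: "real fls"
  by simp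

lemma sum_c_eq: "(\<Sum>n<N. c n / Q n) = (\<Sum>j<N. 1 / ((Q j - a') * (Q j - y))) + err_sum N"
  unfolding sum_formula err_sum_def diff_divide_distrib sum_subtractf by (rule add_diff_swap)

lemma sum_c_log_deriv_eq: "(\<Sum>n<N. c n / Q n * log_deriv 0 n) = (\<Sum>j<N. main_deriv j) + err_deriv N"
proof -
  have "k + (s - r - u) = s + (k - (r + u))" for k s r u :: "real fls" by simp
  then show ?thesis
    unfolding sum_formula_deriv err_deriv_def left_diff_distrib mult_1_left sum_subtractf sum.distrib .
qed

lemma rate_bounds:
  assumes "1 \<le> N"
  shows "Hn N / real (Suc N) \<le> rate N" "Hn N ^ 2 / real (Suc N) \<le> rate N"
    "1 / sqrt (real (Suc N)) \<le> rate N" "Hn N / sqrt (real (Suc N)) \<le> rate N" "Hn N / sqrt (real N) \<le> rate N"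
proof -
  have H: "1 \<le> Hn N" by (rule Hn_ge_1[OF assms])
  have H2: "Hn N \<le> Hn N ^ 2" using mult_left_mono[OF H, of "Hn N"] H by (simp add: power2_eq_square)
  have s: "sqrt (real N) \<le> real (Suc N)"
    by (rule real_le_lsqrt) (use assms in \<open>auto simp: power2_eq_square algebra_simps\<close>)
  have s': "sqrt (real N) \<le> sqrt (real (Suc N))" by simp
  have s0: "0 < sqrt (real N)" using assms by simp
  have *: "x / y \<le> rate N" if "x \<le> Hn N ^ 2" "sqrt (real N) \<le> y" for x y
    unfolding rate_def using that s0 by (intro frac_le) auto
  show "Hn N / real (Suc N) \<le> rate N" "Hn N ^ 2 / real (Suc N) \<le> rate N"
    "1 / sqrt (real (Suc N)) \<le> rate N" "Hn N / sqrt (real (Suc N)) \<le> rate N" "Hn N / sqrt (real N) \<le> rate N"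
    using H H2 s s' by (auto intro!: *)
qed

lemma nb_sum_const:
  assumes "\<And>i. i < N \<Longrightarrow> nb (f i) (C * D i)" "(\<Sum>i<N. D i) \<le> M" "0 \<le> C" "C * M \<le> B"
  shows "nb (\<Sum>i<N. f i) B"
proof (rule nb_mono[OF nb_sum])
  show "(\<Sum>i<N. C * D i) \<le> B"
    unfolding sum_distrib_left[symmetric] using mult_left_mono[OF assms(2,3)] assms(4) by simp
qed (use assms(1) in auto)

lemma nb_err_sum:
  assumes "1 \<le> N" shows "nb (err_sum N) (12 * rate N)"
proof -
  have "nb (\<Sum>n<N. kappa N n * (1 / Q n)) (4 * rate N)"
  proof (rule nb_sum_const[where D = "\<lambda>n. 1 / real (Suc n)" and C = "4 / real (Suc N)"])
    show "nb (kappa N n * (1 / Q n)) (4 / real (Suc N) * (1 / real (Suc n)))" for n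
      using nb_mult[OF nb_kappa[of N n] nb_inv(5)[of n]] by (simp del: of_nat_Suc)
  qed (use rate_bounds(1)[OF assms] in \<open>auto simp: Hn_def\<close>)
  moreover have "nb (\<Sum>j<N. rho j N * (1 / ((Q j - a') * (Q j - y)))) (8 * rate N)"
  proof (rule nb_sum_const[where D = "\<lambda>j. 1 / real (Suc j) ^ 2" and C = "4 / sqrt (real (Suc N))" and M = 2])
    show "nb (rho j N * (1 / ((Q j - a') * (Q j - y)))) (4 / sqrt (real (Suc N)) * (1 / real (Suc j) ^ 2))" for j
      using nb_mult[OF nb_rho[of j N] nb_PY[of j]] by (simp del: of_nat_Suc)
  qed (use sum_inverse_squares_le rate_bounds(3)[OF assms] in auto)
  ultimately have "nb ((\<Sum>n<N. kappa N n * (1 / Q n)) - (\<Sum>j<N. rho j N * (1 / ((Q j - a') * (Q j - y)))))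
      (4 * rate N + 8 * rate N)" by (rule nb_diff)
  then show ?thesis by (simp add: err_sum_def del: of_nat_Suc)
qed

lemma nb_err_deriv:
  assumes "1 \<le> N" shows "nb (err_deriv N) ((4 * K + 16 * (2 + \<bar>t\<bar>) + 8 * K) * rate N)"
proof -
  have coeff: "0 \<le> K" using K(1)[of 0] by simp
  have "nb (\<Sum>n<N. kappa N n * log_deriv N n * (1 / Q n)) (4 * K * rate N)"
  proof (rule nb_sum_const[where D = "\<lambda>n. 1 / real (Suc n)" and C = "4 * K * Hn N / real (Suc N)"])
    show "nb (kappa N n * log_deriv N n * (1 / Q n)) (4 * K * Hn N / real (Suc N) * (1 / real (Suc n)))" if "n < N" for n
      using nb_mult[OF nb_mult[OF nb_kappa[of N n] nb_log_deriv[OF that]] nb_inv(5)[of n]]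
      by (simp add: mult_ac del: of_nat_Suc)
    show "4 * K * Hn N / real (Suc N) * Hn N \<le> 4 * K * rate N"
      using mult_left_mono[OF rate_bounds(2)[OF assms], of "4 * K"] coeff by (simp add: power2_eq_square mult_ac)
  qed (use coeff Hn_nonneg[of N] in \<open>auto simp: Hn_def\<close>)
  moreover have "nb (\<Sum>j<N. rho j N * main_deriv j) (16 * (2 + \<bar>t\<bar>) * rate N)"
  proof (rule nb_sum_const[where D = "\<lambda>j. 1 / real (Suc j) ^ 2" and C = "8 * (2 + \<bar>t\<bar>) / sqrt (real (Suc N))" and M = 2])
    show "nb (rho j N * main_deriv j) (8 * (2 + \<bar>t\<bar>) / sqrt (real (Suc N)) * (1 / real (Suc j) ^ 2))" for j
      using nb_mult[OF nb_rho[of j N] nb_main[of j]] by (simp del: of_nat_Suc)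
    show "8 * (2 + \<bar>t\<bar>) / sqrt (real (Suc N)) * 2 \<le> 16 * (2 + \<bar>t\<bar>) * rate N"
      using mult_left_mono[OF rate_bounds(3)[OF assms], of "16 * (2 + \<bar>t\<bar>)"] by simp
  qed (use sum_inverse_squares_le in auto)
  moreover have "nb (\<Sum>j<N. rho j N * log_deriv_rho j N * (1 / ((Q j - a') * (Q j - y)))) (8 * K * rate N)"
  proof (rule nb_sum_const[where D = "\<lambda>j. 1 / real (Suc j) ^ 2" and C = "4 * K * Hn N / sqrt (real (Suc N))" and M = 2])
    show "nb (rho j N * log_deriv_rho j N * (1 / ((Q j - a') * (Q j - y))))
        (4 * K * Hn N / sqrt (real (Suc N)) * (1 / real (Suc j) ^ 2))" for j
      using nb_mult[OF nb_mult[OF nb_rho[of j N] nb_log_deriv_rho[of j N]] nb_PY[of j]]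
      by (simp add: mult_ac del: of_nat_Suc)
    show "4 * K * Hn N / sqrt (real (Suc N)) * 2 \<le> 8 * K * rate N"
      using mult_left_mono[OF rate_bounds(4)[OF assms], of "8 * K"] coeff by simp
  qed (use sum_inverse_squares_le coeff Hn_nonneg[of N] in auto)
  ultimately have "nb ((\<Sum>n<N. kappa N n * log_deriv N n * (1 / Q n)) - ((\<Sum>j<N. rho j N * main_deriv j)
      + (\<Sum>j<N. rho j N * log_deriv_rho j N * (1 / ((Q j - a') * (Q j - y))))))
      (4 * K * rate N + (16 * (2 + \<bar>t\<bar>) * rate N + 8 * K * rate N))" by (intro nb_diff nb_add)
  moreover have "4 * K * rate N + (16 * (2 + \<bar>t\<bar>) * rate N + 8 * K * rate N) = (4 * K + 16 * (2 + \<bar>t\<bar>) + 8 * K) * rate N"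
    by (simp add: algebra_simps)
  ultimately show ?thesis by (simp only: err_deriv_def sum.distrib times_divide_eq_right mult_1_right)
qed

text \<open>The tail of \<open>A\<close> is \<open>O(n * Hn N / N)\<close>, and its factor
  \<open>n\<close> cancels \<open>1 / Q n\<close>. What remains is \<open>c n\<close>, of order at
  most \<open>1 / sqrt n\<close>; summing it up to \<open>N\<close> yields
  \<open>Hn N / sqrt N\<close>.\<close>

lemma nb_err_shuffle:
  assumes "1 \<le> N" shows "nb (err_shuffle N) (32 * rate N)"
proof -
  have A: "nb (A N - A (N - k)) (4 * real k * Hn N / real N)" if "k \<le> N" for k
  proof -
    have eq: "A N - A (N - k) = (\<Sum>l\<in>{N - k..<N}. 1 / (Q l - z))"
      unfolding A_def lessThan_atLeast0 using sum.atLeastLessThan_concat[of 0 "N - k" N "\<lambda>l. 1 / (Q l - z)"]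
      by (simp add: algebra_simps del: of_nat_Suc)
    have two: "(\<Sum>l\<in>{N - k..<N}. 2 / real (Suc l)) = 2 * (\<Sum>l\<in>{N - k..<N}. 1 / real (Suc l))"
      by (simp add: sum_distrib_left)
    have "nb (\<Sum>l\<in>{N - k..<N}. 1 / (Q l - z)) (\<Sum>l\<in>{N - k..<N}. 2 / real (Suc l))" by (intro nb_sum nb_inv)
    moreover have "(\<Sum>l\<in>{N - k..<N}. 2 / real (Suc l)) \<le> 4 * real k * Hn N / real N"
      using Hn_tail_le[OF that assms] by (simp only: two)
    ultimately show ?thesis unfolding eq by (rule nb_mono)
  qed
  show ?thesis
    unfolding err_shuffle_def
  proof (rule nb_sum_const[where D = "\<lambda>n. 1 / sqrt (real (Suc n))" and C = "16 * Hn N / real N" and M = "2 * sqrt (real N)"])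
    fix n assume "n < N"
    then have "nb (z * c n * (1 / Q n) * (A N - A (N - Suc n)))
        (1 * (2 / sqrt (real (Suc n))) * (2 / real (Suc n)) * (4 * real (Suc n) * Hn N / real N))"
      by (intro nb_mult nb_z nb_c nb_inv A) simp
    then show "nb (z * c n / Q n * (A N - A (N - Suc n))) (16 * Hn N / real N * (1 / sqrt (real (Suc n))))"
      by (simp add: mult_ac del: of_nat_Suc)
  next
    have "16 * Hn N / real N * (2 * sqrt (real N)) = 32 * (Hn N / sqrt (real N))"
      using assms by (simp add: field_simps)
    then show "16 * Hn N / real N * (2 * sqrt (real N)) \<le> 32 * rate N"
      using rate_bounds(5)[OF assms] by simp
  qed (use sum_inverse_sqrt_le Hn_nonneg[of N] in auto)
qed

definition main :: "nat \<Rightarrow> real fls" where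
  "main j = y * ((z - fls_const t * y) * (1 / ((Q j - a') * (Q j - y))) + y * z * main_deriv j - z / (Q j * (Q j - z)))"

definition err :: "nat \<Rightarrow> real fls" where
  "err N = y * ((z - fls_const t * y) * err_sum N + y * z * err_deriv N - y * err_shuffle N)"

theorem gen_identity':
  "gen (\<lambda>ks. \<mu> ^ length ks * termA t N ks)
    - fls_const (t * \<mu>) * gen (\<lambda>ks. \<mu> ^ length ks * termB t N ks)
    + fls_const ((t - t ^ 2) * \<mu> ^ 2) * gen (\<lambda>ks. \<mu> ^ length ks * termD t N ks)
  = (\<Sum>j<N. main j) + err N"
proof -
  have "(\<Sum>j<N. main j) = y * ((z - fls_const t * y) * (\<Sum>j<N. 1 / ((Q j - a') * (Q j - y)))
      + y * z * (\<Sum>j<N. main_deriv j) - (\<Sum>j<N. z / (Q j * (Q j - z))))"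
    by (simp only: main_def sum_distrib_left[symmetric] sum.distrib sum_subtractf)
  moreover have "Y * (W * (a + e1) + V * (b + e2) - c - Y * e3)
      = Y * (W * a + V * b - c) + Y * (W * e1 + V * e2 - Y * e3)" for Y W V a b c e1 e2 e3 :: "real fls"
    by (simp add: algebra_simps)
  ultimately show ?thesis
    unfolding gen_identity sum_c_eq sum_c_log_deriv_eq err_def err_shuffle_def by simp
qed

lemma err_coeff_tendsto_0:
  assumes "r \<le> R" shows "(\<lambda>N. fls_nth (err N) (int r)) \<longlonglongrightarrow> 0"
proof -
  define C where "C = (1 + \<bar>t\<bar> * 1) * 12 + (4 * K + 16 * (2 + \<bar>t\<bar>) + 8 * K) + 32"
  have bound: "\<bar>fls_nth (err N) (int r)\<bar> \<le> C / rad ^ r * (Hn N ^ 2 / sqrt (real N))" if "1 \<le> N" for N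
  proof -
    have "nb (err N) (1 * ((1 + \<bar>t\<bar> * 1) * (12 * rate N) + 1 * 1 * ((4 * K + 16 * (2 + \<bar>t\<bar>) + 8 * K) * rate N) + 1 * (32 * rate N)))"
      unfolding err_def
      by (intro nb_mult nb_diff nb_add nb_y nb_z nb_const nb_err_sum nb_err_deriv nb_err_shuffle that)
    also have "1 * ((1 + \<bar>t\<bar> * 1) * (12 * rate N) + 1 * 1 * ((4 * K + 16 * (2 + \<bar>t\<bar>) + 8 * K) * rate N) + 1 * (32 * rate N))
        = C * rate N" by (simp add: C_def algebra_simps)
    finally have "nb (err N) (C * rate N)" .
    from nb_coeff[OF this assms] show ?thesis by (simp add: rate_def mult.commute)
  qed
  show ?thesis
  proof (rule Lim_null_comparison)
    show "eventually (\<lambda>N. norm (fls_nth (err N) (int r)) \<le> C / rad ^ r * (Hn N ^ 2 / sqrt (real N))) sequentially"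
      using eventually_ge_at_top[of 1] by eventually_elim (use bound in simp)
    show "(\<lambda>N. C / rad ^ r * (Hn N ^ 2 / sqrt (real N))) \<longlonglongrightarrow> 0"
      by (rule tendsto_mult_right_zero[OF Hn_sq_div_sqrt_tendsto_0])
  qed
qed

end

section \<open>The coefficient of the Riemann zeta value\<close>

text \<open>Substitution of \<open>z / (j + 1)\<close> for \<open>z\<close>, a ring homomorphism.
  \<open>main j\<close> is homogeneous of degree 0 in \<open>z\<close> and \<open>j + 1\<close>,
  hence the image of one fixed series; summing its coefficients at \<open>z^k\<close> over
  \<open>j\<close> gives a multiple of the truncated \<open>zeta(k)\<close>.\<close>

definition hom_at :: "nat \<Rightarrow> real fps \<Rightarrow> real fls" where
  "hom_at j F = fps_to_fls (Abs_fps (\<lambda>k. fps_nth F k / real (Suc j) ^ k))"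

lemma hom_at_nth: "fls_nth (hom_at j F) (int k) = fps_nth F k / real (Suc j) ^ k"
  by (simp add: hom_at_def)

lemma hom_at_add: "hom_at j F + hom_at j G = hom_at j (F + G)"
  unfolding hom_at_def fps_to_fls_plus[symmetric]
  by (intro arg_cong[of _ _ fps_to_fls] fps_ext) (simp add: add_divide_distrib)

lemma hom_at_diff: "hom_at j F - hom_at j G = hom_at j (F - G)"
  unfolding hom_at_def fps_to_fls_minus[symmetric]
  by (intro arg_cong[of _ _ fps_to_fls] fps_ext) (simp add: diff_divide_distrib)

lemma hom_at_mult: "hom_at j F * hom_at j G = hom_at j (F * G)"
  unfolding hom_at_def fls_times_fps_to_fls[symmetric]
proof (intro arg_cong[of _ _ fps_to_fls] fps_ext)
  fix k
  have "real (Suc j) ^ k = real (Suc j) ^ i * real (Suc j) ^ (k - i)" if "i \<in> {0..k}" for i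
    using that by (simp flip: power_add)
  then show "fps_nth (Abs_fps (\<lambda>k. fps_nth F k / real (Suc j) ^ k) * Abs_fps (\<lambda>k. fps_nth G k / real (Suc j) ^ k)) k
      = fps_nth (Abs_fps (\<lambda>k. fps_nth (F * G) k / real (Suc j) ^ k)) k"
    by (simp add: fps_mult_nth sum_divide_distrib del: of_nat_Suc)
qed

lemma hom_at_const: "fls_const c = hom_at j (fps_const c)"
  unfolding hom_at_def fps_const_to_fls[symmetric]
  by (intro arg_cong[of _ _ fps_to_fls] fps_ext) simp

definition geo :: "real \<Rightarrow> real fps" where "geo p = Abs_fps (\<lambda>r. p ^ r)"

lemma hom_at_letter: "fls_X / (of_nat (Suc j) - fls_const p * fls_X) = hom_at j (fps_X * geo p)"
  unfolding gen1_geometric[symmetric] gen1_def hom_at_def geo_def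
  by (intro arg_cong[of _ _ fps_to_fls] fps_ext) simp

lemma geo_mult_nth: "fps_nth (geo p * geo q) r = (\<Sum>i\<le>r. p ^ i * q ^ (r - i))"
  by (simp add: geo_def fps_mult_nth atLeast0AtMost)

lemma geo_sq_nth: "fps_nth (geo p * geo p) r = real (Suc r) * p ^ r"
proof -
  have "(\<Sum>i\<le>r. p ^ i * p ^ (r - i)) = (\<Sum>i\<le>r. p ^ r)"
    by (intro sum.cong refl) (simp flip: power_add)
  then show ?thesis by (simp add: geo_mult_nth)
qed

lemma geo_sq_mult_nth:
  "fps_nth (geo p * geo p * geo q) r = (\<Sum>i\<le>r. real (Suc i) * p ^ i * q ^ (r - i))"
  "fps_nth (geo p * (geo q * geo q)) r = (\<Sum>i\<le>r. p ^ i * (real (Suc (r - i)) * q ^ (r - i)))"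
  unfolding fps_mult_nth[of "geo p * geo p"] fps_mult_nth[of _ "geo q * geo q"] geo_sq_nth
  by (simp_all add: geo_def atLeast0AtMost)

context mzv_err
begin

text \<open>This is \<open>main\<close> at the integer 1; \<open>fps_X * geo p\<close> is
  \<open>z / (1 - p z)\<close>.\<close>

definition main_coeffs :: "real fps" where
  "main_coeffs = fps_const \<mu> * (fps_const (1 - t * \<mu>) * ((fps_X * geo (1 + t * \<mu>)) * (fps_X * geo \<mu>))
    + fps_const (\<mu> * (1 - t)) * ((fps_X * geo (1 + t * \<mu>)) * (fps_X * geo (1 + t * \<mu>)) * (fps_X * geo \<mu>))
    + fps_const \<mu> * ((fps_X * geo (1 + t * \<mu>)) * ((fps_X * geo \<mu>) * (fps_X * geo \<mu>)))
    - (fps_X * geo 0) * (fps_X * geo 1))"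

lemma main_eq: "main j = hom_at j main_coeffs"
proof -
  have l: "z / (Q j - a') = hom_at j (fps_X * geo (1 + t * \<mu>))" "z / (Q j - y) = hom_at j (fps_X * geo \<mu>)"
    "z / Q j = hom_at j (fps_X * geo 0)" "z / (Q j - z) = hom_at j (fps_X * geo 1)"
    using hom_at_letter[of j "1 + t * \<mu>"] hom_at_letter[of j \<mu>] hom_at_letter[of j 0] hom_at_letter[of j 1]
    unfolding a'_eq by simp_all
  have "m * x * ((x - s * (m * x)) * (1 / (P * Y)) + m * x * x * ((1 - s) / (P ^ 2 * Y) + 1 / (P * Y ^ 2)) - x / (q * w))
      = m * ((1 - s * m) * ((x / P) * (x / Y)) + m * (1 - s) * ((x / P) * (x / P) * (x / Y)) + m * ((x / P) * ((x / Y) * (x / Y)))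
        - (x / q) * (x / w))" for m x s P Y q w :: "real fls"
  proof -
    define p u q' w' where "p = 1 / P" and "u = 1 / Y" and "q' = 1 / q" and "w' = 1 / w"
    have "m * x * ((x - s * (m * x)) * (1 / (P * Y)) + m * x * x * ((1 - s) / (P ^ 2 * Y) + 1 / (P * Y ^ 2)) - x / (q * w))
      = m * x * ((x - s * (m * x)) * (p * u) + m * x * x * ((1 - s) * (p * p * u) + p * u * u) - x * (q' * w'))"
      unfolding p_def u_def q'_def w'_def by (simp add: power2_eq_square)
    also have "\<dots> = m * ((1 - s * m) * ((x * p) * (x * u)) + m * (1 - s) * ((x * p) * (x * p) * (x * u))
        + m * ((x * p) * ((x * u) * (x * u))) - (x * q') * (x * w'))"
      by (simp add: algebra_simps)
    finally show ?thesis unfolding p_def u_def q'_def w'_def by simp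
  qed
  then have "main j = fls_const \<mu> * ((1 - fls_const t * fls_const \<mu>) * ((z / (Q j - a')) * (z / (Q j - y)))
      + fls_const \<mu> * (1 - fls_const t) * ((z / (Q j - a')) * (z / (Q j - a')) * (z / (Q j - y)))
      + fls_const \<mu> * ((z / (Q j - a')) * ((z / (Q j - y)) * (z / (Q j - y)))) - (z / Q j) * (z / (Q j - z)))"
    unfolding main_def main_deriv_def .
  also have "1 - fls_const t * fls_const \<mu> = fls_const (1 - t * \<mu>)" by (simp flip: fls_minus_const fls_const_mult_const)
  also have "fls_const \<mu> * (1 - fls_const t) = fls_const (\<mu> * (1 - t))" by (simp flip: fls_minus_const fls_const_mult_const)
  finally show ?thesis
    unfolding l unfolding hom_at_const[of _ j] hom_at_mult hom_at_add hom_at_diff main_coeffs_def .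
qed

lemma main_coeffs_nth:
  "fps_nth main_coeffs (Suc (Suc (Suc s))) = \<mu> * ((1 - t * \<mu>) * (\<Sum>i\<le>Suc s. (1 + t * \<mu>) ^ i * \<mu> ^ (Suc s - i))
    + \<mu> * (1 - t) * (\<Sum>i\<le>s. real (Suc i) * (1 + t * \<mu>) ^ i * \<mu> ^ (s - i))
    + \<mu> * (\<Sum>i\<le>s. (1 + t * \<mu>) ^ i * (real (Suc (s - i)) * \<mu> ^ (s - i))) - 1)"
proof -
  have 2: "(fps_X * f) * (fps_X * g) = fps_X * (fps_X * (f * g))" for f g :: "real fps" by (simp only: mult_ac)
  have 3: "(fps_X * f) * (fps_X * g) * (fps_X * h) = fps_X * (fps_X * (fps_X * (f * g * h)))"
    "(fps_X * f) * ((fps_X * g) * (fps_X * h)) = fps_X * (fps_X * (fps_X * (f * (g * h))))" for f g h :: "real fps"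
    by (simp_all only: mult_ac)
  have 01: "fps_nth (geo 0 * geo 1) r = 1" for r
    unfolding geo_mult_nth by (subst sum.mono_neutral_right[of _ "{0}"]) auto
  show ?thesis
    unfolding main_coeffs_def 3 unfolding 2
    by (simp only: fps_mult_left_const_nth fps_add_nth fps_sub_nth fps_X_mult_nth nat.distinct if_False
        diff_Suc_1 geo_mult_nth[of _ \<mu>] geo_sq_mult_nth 01)
qed

end

text \<open>The part of degree \<open>d\<close> in \<open>\<tau>\<close>, \<open>\<nu>\<close> of
  \<open>(1 + \<tau>)^K / (1 - \<nu>)\<close>. It is applied with \<open>\<tau> = t * \<mu>\<close>
  and \<open>\<nu> = (1 - t) * \<mu>\<close>, so this degree is the power of \<open>\<mu>\<close>,
  while \<open>1 + \<tau>\<close> is \<open>a / z\<close> and \<open>\<tau> + \<nu>\<close> is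
  \<open>y / z\<close>.\<close>

definition hom_part :: "nat \<Rightarrow> nat \<Rightarrow> real \<Rightarrow> real \<Rightarrow> real" where
  "hom_part K d \<tau> \<nu> = (\<Sum>i\<le>d. real (K choose i) * (\<tau> ^ i * \<nu> ^ (d - i)))"

lemma hom_part_0 [simp]: "hom_part K 0 \<tau> \<nu> = 1"
  by (simp add: hom_part_def)

lemma hom_part_Suc: "hom_part (Suc K) (Suc d) \<tau> \<nu> = hom_part K (Suc d) \<tau> \<nu> + \<tau> * hom_part K d \<tau> \<nu>"
proof -
  have "hom_part (Suc K) (Suc d) \<tau> \<nu> = \<nu> ^ Suc d
      + (\<Sum>i\<le>d. (real (K choose Suc i) + real (K choose i)) * (\<tau> ^ Suc i * \<nu> ^ (d - i)))"
    unfolding hom_part_def sum.atMost_Suc_shift by (simp add: add.commute)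
  also have "\<dots> = hom_part K (Suc d) \<tau> \<nu> + \<tau> * hom_part K d \<tau> \<nu>"
    unfolding hom_part_def sum.atMost_Suc_shift by (simp add: sum.distrib sum_distrib_left algebra_simps)
  finally show ?thesis .
qed

lemma hom_part_binomial: "hom_part K K \<tau> \<nu> = (\<tau> + \<nu>) ^ K"
  unfolding hom_part_def binomial_ring by (simp add: mult.assoc)

text \<open>In closed form the left side is
  \<open>((1 + \<tau>)^(r+1) - (\<tau> + \<nu>)^(r+1)) / (1 - \<nu>)\<close>; the subtracted term
  removes exactly the degrees above \<open>r\<close>.\<close>

lemma geometric_hom_parts:
  "(\<Sum>i\<le>r. (1 + \<tau>) ^ i * (\<tau> + \<nu>) ^ (r - i)) = (\<Sum>d\<le>r. hom_part (Suc r) d \<tau> \<nu>)"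
proof (induction r)
  case (Suc r)
  have "(\<Sum>i\<le>Suc r. (1 + \<tau>) ^ i * (\<tau> + \<nu>) ^ (Suc r - i))
      = (\<tau> + \<nu>) ^ Suc r + (1 + \<tau>) * (\<Sum>i\<le>r. (1 + \<tau>) ^ i * (\<tau> + \<nu>) ^ (r - i))"
    unfolding sum.atMost_Suc_shift by (simp add: sum_distrib_left mult.assoc)
  also have "\<dots> = hom_part (Suc r) (Suc r) \<tau> \<nu> + (1 + \<tau>) * (\<Sum>d\<le>r. hom_part (Suc r) d \<tau> \<nu>)"
    by (simp only: Suc.IH hom_part_binomial)
  also have "\<dots> = (\<Sum>d\<le>Suc r. hom_part (Suc r) d \<tau> \<nu>) + \<tau> * (\<Sum>d\<le>r. hom_part (Suc r) d \<tau> \<nu>)"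
    by (simp add: algebra_simps)
  also have "\<dots> = (\<Sum>d\<le>Suc r. hom_part (Suc (Suc r)) d \<tau> \<nu>)"
    unfolding sum.atMost_Suc_shift[of _ r] by (simp add: hom_part_Suc sum.distrib sum_distrib_left)
  finally show ?case .
qed simp

text \<open>Derivative of \<open>hom_part\<close> along \<open>\<tau>' = \<nu>\<close>,
  \<open>\<nu>' = \<tau>\<close>. This is \<open>a' = 1 - t\<close>, \<open>y' = 1\<close> scaled by
  \<open>\<mu>\<close>, and being linear it preserves the degree.\<close>

definition hom_part_deriv :: "nat \<Rightarrow> nat \<Rightarrow> real \<Rightarrow> real \<Rightarrow> real" where
  "hom_part_deriv K d \<tau> \<nu> = (\<Sum>i\<le>d. real (K choose i)
    * (real i * \<tau> ^ (i - 1) * \<nu> * \<nu> ^ (d - i) + \<tau> ^ i * (real (d - i) * \<nu> ^ (d - i - 1) * \<tau>)))"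

text \<open>\<open>geometric_hom_parts\<close> is evaluated on the line
  \<open>(\<tau> + \<nu> * h, \<nu> + \<tau> * h)\<close> and differentiated at
  \<open>h = 0\<close>.\<close>

lemma geometric_hom_parts_deriv:
  "\<nu> * (\<Sum>i\<le>s. real (Suc i) * (1 + \<tau>) ^ i * (\<tau> + \<nu>) ^ (s - i))
    + (\<tau> + \<nu>) * (\<Sum>i\<le>s. (1 + \<tau>) ^ i * (real (Suc (s - i)) * (\<tau> + \<nu>) ^ (s - i)))
  = (\<Sum>d\<le>Suc s. hom_part_deriv (Suc (Suc s)) d \<tau> \<nu>)"
proof -
  let ?a = "\<lambda>h. 1 + (\<tau> + \<nu> * h)" and ?l = "\<lambda>h. (\<tau> + \<nu> * h) + (\<nu> + \<tau> * h)"
  have "((\<lambda>h. \<Sum>i\<le>Suc s. ?a h ^ i * ?l h ^ (Suc s - i)) has_real_derivative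
      (\<Sum>i\<le>Suc s. real i * (1 + \<tau>) ^ (i - 1) * \<nu> * (\<tau> + \<nu>) ^ (Suc s - i)
        + (1 + \<tau>) ^ i * (real (Suc s - i) * (\<tau> + \<nu>) ^ (Suc s - i - 1) * (\<tau> + \<nu>)))) (at 0)"
    by (intro DERIV_sum) (auto intro!: derivative_eq_intros simp: algebra_simps)
  moreover have "((\<lambda>h. \<Sum>d\<le>Suc s. hom_part (Suc (Suc s)) d (\<tau> + \<nu> * h) (\<nu> + \<tau> * h)) has_real_derivative
      (\<Sum>d\<le>Suc s. hom_part_deriv (Suc (Suc s)) d \<tau> \<nu>)) (at 0)"
    unfolding hom_part_def hom_part_deriv_def
    by (intro DERIV_sum DERIV_cmult) (auto intro!: derivative_eq_intros simp: algebra_simps)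
  ultimately have "(\<Sum>i\<le>Suc s. real i * (1 + \<tau>) ^ (i - 1) * \<nu> * (\<tau> + \<nu>) ^ (Suc s - i)
        + (1 + \<tau>) ^ i * (real (Suc s - i) * (\<tau> + \<nu>) ^ (Suc s - i - 1) * (\<tau> + \<nu>)))
      = (\<Sum>d\<le>Suc s. hom_part_deriv (Suc (Suc s)) d \<tau> \<nu>)"
    unfolding geometric_hom_parts by (rule DERIV_unique)
  moreover have "(\<Sum>i\<le>Suc s. real i * (1 + \<tau>) ^ (i - 1) * \<nu> * (\<tau> + \<nu>) ^ (Suc s - i))
      = \<nu> * (\<Sum>i\<le>s. real (Suc i) * (1 + \<tau>) ^ i * (\<tau> + \<nu>) ^ (s - i))"
    unfolding sum.atMost_Suc_shift by (simp add: sum_distrib_left mult_ac del: of_nat_Suc)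
  moreover have "(\<Sum>i\<le>Suc s. (1 + \<tau>) ^ i * (real (Suc s - i) * (\<tau> + \<nu>) ^ (Suc s - i - 1) * (\<tau> + \<nu>)))
      = (\<tau> + \<nu>) * (\<Sum>i\<le>s. (1 + \<tau>) ^ i * (real (Suc (s - i)) * (\<tau> + \<nu>) ^ (s - i)))"
    by (simp add: sum_distrib_left Suc_diff_le mult_ac del: of_nat_Suc of_nat_diff)
  ultimately show ?thesis by (simp only: sum.distrib)
qed

text \<open>The coefficient of \<open>zeta(k)\<close> for \<open>n = d + 1\<close> and \<open>k = K + 1\<close>, homogenised.\<close>

definition rhs_part :: "nat \<Rightarrow> nat \<Rightarrow> real \<Rightarrow> real \<Rightarrow> real" where
  "rhs_part K d \<tau> \<nu> = (\<Sum>i=1..d - 1. (real (Suc K) * real (K choose i)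
      - (real (Suc K) - real d) * real (K choose (i - 1))) * (\<tau> ^ i * \<nu> ^ (d - i)))
    + real (Suc K) * \<nu> ^ d + real (K choose d) * \<tau> ^ d"

lemma rhs_part_eq:
  assumes "Suc d \<le> K"
  shows "rhs_part K (Suc d) \<tau> \<nu> = hom_part K (Suc d) \<tau> \<nu> - \<tau> * hom_part K d \<tau> \<nu> + hom_part_deriv K (Suc d) \<tau> \<nu>"
proof -
  define x where "x i = \<tau> ^ i * \<nu> ^ (Suc d - i)" for i
  have split: "(\<Sum>i\<le>Suc d. f i) = f 0 + (\<Sum>i=1..d. f i) + f (Suc d)" for f :: "nat \<Rightarrow> real"
    by (simp add: atMost_atLeast0 sum.atLeast_Suc_atMost)
  have shift: "(\<Sum>i\<le>d. f (Suc i)) = (\<Sum>i=1..d. f i) + f (Suc d)" for f :: "nat \<Rightarrow> real"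
    using split[of f] unfolding sum.atMost_Suc_shift[of f d] by simp
  have shift': "(\<Sum>i\<le>d. f i) = f 0 + (\<Sum>i=1..d. f i)" for f :: "nat \<Rightarrow> real"
    by (simp add: atMost_atLeast0 sum.atLeast_Suc_atMost)
  have A: "hom_part K (Suc d) \<tau> \<nu> = x 0 + (\<Sum>i=1..d. real (K choose i) * x i) + real (K choose Suc d) * x (Suc d)"
    unfolding hom_part_def x_def[symmetric] split by simp
  have "\<tau> * hom_part K d \<tau> \<nu> = (\<Sum>i\<le>d. real (K choose (Suc i - 1)) * x (Suc i))"
    unfolding hom_part_def sum_distrib_left x_def by (intro sum.cong) auto
  also have "\<dots> = (\<Sum>i=1..d. real (K choose (i - 1)) * x i) + real (K choose d) * x (Suc d)"
    by (subst shift[of "\<lambda>i. real (K choose (i - 1)) * x i"]) simp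
  finally have B: "\<tau> * hom_part K d \<tau> \<nu> = (\<Sum>i=1..d. real (K choose (i - 1)) * x i) + real (K choose d) * x (Suc d)" .
  have "(\<Sum>i\<le>Suc d. real (K choose i) * (real i * \<tau> ^ (i - 1) * \<nu> * \<nu> ^ (Suc d - i)))
      = (\<Sum>i\<le>d. real (Suc i) * real (K choose Suc i) * x i)"
    unfolding sum.atMost_Suc_shift x_def by (simp add: Suc_diff_le mult_ac del: of_nat_Suc)
  also have "\<dots> = real K * x 0 + (\<Sum>i=1..d. real (Suc i) * real (K choose Suc i) * x i)"
    unfolding shift' by simp
  finally have C: "(\<Sum>i\<le>Suc d. real (K choose i) * (real i * \<tau> ^ (i - 1) * \<nu> * \<nu> ^ (Suc d - i)))
      = real K * x 0 + (\<Sum>i=1..d. real (Suc i) * real (K choose Suc i) * x i)" .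
  have "(\<Sum>i\<le>Suc d. real (K choose i) * (\<tau> ^ i * (real (Suc d - i) * \<nu> ^ (Suc d - i - 1) * \<tau>)))
      = (\<Sum>i\<le>d. real (Suc d - (Suc i - 1)) * real (K choose (Suc i - 1)) * x (Suc i))"
    unfolding x_def by (simp add: mult_ac del: of_nat_diff of_nat_Suc)
  also have "\<dots> = (\<Sum>i=1..d. real (Suc d - (i - 1)) * real (K choose (i - 1)) * x i) + real (K choose d) * x (Suc d)"
    by (subst shift[of "\<lambda>i. real (Suc d - (i - 1)) * real (K choose (i - 1)) * x i"]) simp
  finally have D: "(\<Sum>i\<le>Suc d. real (K choose i) * (\<tau> ^ i * (real (Suc d - i) * \<nu> ^ (Suc d - i - 1) * \<tau>)))
      = (\<Sum>i=1..d. real (Suc d - (i - 1)) * real (K choose (i - 1)) * x i) + real (K choose d) * x (Suc d)" .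
  \<comment> \<open>The coefficients agree by absorption,
    \<open>(l + 1) * (K choose (l + 1)) = (K - l) * (K choose l)\<close>, used at
    \<open>l = i - 1\<close> and at \<open>l = i\<close>.\<close>
  have mid: "(real (Suc K) * real (K choose i) - (real (Suc K) - real (Suc d)) * real (K choose (i - 1))) * x i
      = real (K choose i) * x i - real (K choose (i - 1)) * x i
        + (real (Suc i) * real (K choose Suc i) * x i + real (Suc d - (i - 1)) * real (K choose (i - 1)) * x i)"
    if "i \<in> {1..d}" for i
  proof -
    from that obtain l where l: "i = Suc l" "Suc l \<le> d" by (cases i) auto
    have "Suc l * (K choose Suc l) = (K - l) * (K choose l)" "Suc (Suc l) * (K choose Suc (Suc l)) = (K - Suc l) * (K choose Suc l)"
      by (simp_all only: binomial_absorb_comp[symmetric] binomial_absorption diff_Suc_Suc) 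
    from this[THEN arg_cong[of _ _ real]]
    have "real (Suc l) * real (K choose Suc l) = (real K - real l) * real (K choose l)"
      "real (Suc (Suc l)) * real (K choose Suc (Suc l)) = (real K - real (Suc l)) * real (K choose Suc l)"
      using l(2) assms by (simp_all only: of_nat_mult of_nat_diff)
    then have "real (Suc K) * real (K choose Suc l) - (real (Suc K) - real (Suc d)) * real (K choose l)
        = real (K choose Suc l) - real (K choose l) + (real (Suc (Suc l)) * real (K choose Suc (Suc l))
          + (real (Suc d) - real l) * real (K choose l))"
      by (simp add: algebra_simps)
    then show ?thesis using l by (simp add: of_nat_diff flip: distrib_right left_diff_distrib del: of_nat_Suc)
  qed
  have "hom_part_deriv K (Suc d) \<tau> \<nu> = real K * x 0 + (\<Sum>i=1..d. real (Suc i) * real (K choose Suc i) * x i)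
      + ((\<Sum>i=1..d. real (Suc d - (i - 1)) * real (K choose (i - 1)) * x i) + real (K choose d) * x (Suc d))"
    unfolding hom_part_deriv_def distrib_left sum.distrib C D ..
  moreover have "rhs_part K (Suc d) \<tau> \<nu> = (\<Sum>i=1..d. real (K choose i) * x i - real (K choose (i - 1)) * x i
        + (real (Suc i) * real (K choose Suc i) * x i + real (Suc d - (i - 1)) * real (K choose (i - 1)) * x i))
      + real (Suc K) * x 0 + real (K choose Suc d) * x (Suc d)"
  proof -
    have "(\<Sum>i=1..d. (real (Suc K) * real (K choose i) - (real (Suc K) - real (Suc d)) * real (K choose (i - 1))) * x i)
        = (\<Sum>i=1..d. real (K choose i) * x i - real (K choose (i - 1)) * x i
        + (real (Suc i) * real (K choose Suc i) * x i + real (Suc d - (i - 1)) * real (K choose (i - 1)) * x i))"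
      by (rule sum.cong[OF refl mid])
    then show ?thesis unfolding rhs_part_def diff_Suc_1 x_def[symmetric] by (simp add: x_def)
  qed
  ultimately show ?thesis
    unfolding A B sum.distrib sum_subtractf by (simp add: algebra_simps)
qed

text \<open>The last term arises because the factor \<open>1 - \<tau>\<close> lifts the top part by
  one degree. It belongs to \<open>n = k\<close>, outside the range of the theorem.\<close>

lemma main_coeff_eq:
  "(1 - \<tau>) * (\<Sum>i\<le>Suc s. (1 + \<tau>) ^ i * (\<tau> + \<nu>) ^ (Suc s - i))
    + \<nu> * (\<Sum>i\<le>s. real (Suc i) * (1 + \<tau>) ^ i * (\<tau> + \<nu>) ^ (s - i))
    + (\<tau> + \<nu>) * (\<Sum>i\<le>s. (1 + \<tau>) ^ i * (real (Suc (s - i)) * (\<tau> + \<nu>) ^ (s - i))) - 1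
  = (\<Sum>d\<le>s. rhs_part (Suc (Suc s)) (Suc d) \<tau> \<nu>) - \<tau> * hom_part (Suc (Suc s)) (Suc s) \<tau> \<nu>"
proof -
  let ?K = "Suc (Suc s)"
  have "(\<Sum>d\<le>s. rhs_part ?K (Suc d) \<tau> \<nu>)
      = (\<Sum>d\<le>s. hom_part ?K (Suc d) \<tau> \<nu>) - \<tau> * (\<Sum>d\<le>s. hom_part ?K d \<tau> \<nu>) + (\<Sum>d\<le>s. hom_part_deriv ?K (Suc d) \<tau> \<nu>)"
    by (simp add: rhs_part_eq sum.distrib sum_subtractf sum_distrib_left)
  moreover have "(\<Sum>d\<le>Suc s. hom_part ?K d \<tau> \<nu>) = 1 + (\<Sum>d\<le>s. hom_part ?K (Suc d) \<tau> \<nu>)"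
    unfolding sum.atMost_Suc_shift by simp
  moreover have "(\<Sum>d\<le>Suc s. hom_part_deriv ?K d \<tau> \<nu>) = (\<Sum>d\<le>s. hom_part_deriv ?K (Suc d) \<tau> \<nu>)"
    unfolding sum.atMost_Suc_shift by (simp add: hom_part_deriv_def)
  moreover have "(\<Sum>d\<le>Suc s. hom_part ?K d \<tau> \<nu>) = (\<Sum>d\<le>s. hom_part ?K d \<tau> \<nu>) + hom_part ?K (Suc s) \<tau> \<nu>"
    by simp
  moreover have "(1 - \<tau>) * G + M + L - 1 = r - \<tau> * T"
    if "r = Hs - \<tau> * H + D" "G = 1 + Hs" "E = D" "G = H + T" "M + L = E" for G M L r T H Hs D E
  proof -
    have "(1 - \<tau>) * G + M + L - 1 = (G - 1) - \<tau> * G + (M + L)" by (simp add: algebra_simps)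
    also have "G - 1 = Hs" using that(2) by simp
    also have "\<tau> * G = \<tau> * (H + T)" using that(4) by simp
    finally show ?thesis using that(1,3,5) by (simp add: algebra_simps)
  qed
  ultimately show ?thesis
    unfolding geometric_hom_parts
    using geometric_hom_parts_deriv[where \<nu> = \<nu> and s = s and \<tau> = \<tau>] by blast
qed

section \<open>Comparison of the powers of \<mu>\<close>

lemma sum_compositions_by_length:
  assumes "k \<le> M"
  shows "(\<Sum>ks\<in>compositions k. \<mu> ^ length ks * (if ks \<noteq> [] \<and> 2 \<le> hd ks then f ks else 0))
    = (\<Sum>i\<le>M. \<mu> ^ i * (\<Sum>ks\<in>I0_set k i. f ks :: real))"
proof -
  let ?g = "\<lambda>ks. \<mu> ^ length ks * (if ks \<noteq> [] \<and> 2 \<le> hd ks then f ks else 0)"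
  have "length ks \<le> sum_list ks" if "\<forall>x\<in>set ks. 0 < x" for ks :: "nat list"
    using that by (induction ks) auto
  then have "length ` compositions k \<subseteq> {..M}"
    using assms by (force simp: compositions_def)
  then have "(\<Sum>ks\<in>compositions k. ?g ks) = (\<Sum>i\<le>M. \<Sum>ks\<in>{ks \<in> compositions k. length ks = i}. ?g ks)"
    by (intro sum.group[symmetric]) auto
  also have "\<dots> = (\<Sum>i\<le>M. \<mu> ^ i * (\<Sum>ks\<in>I0_set k i. f ks))"
  proof (rule sum.cong[OF refl])
    fix i
    have "(\<Sum>ks\<in>{ks \<in> compositions k. length ks = i}. ?g ks) = (\<Sum>ks\<in>I0_set k i. \<mu> ^ i * f ks)"
    proof (rule sum.mono_neutral_cong_right)
      show "finite {ks \<in> compositions k. length ks = i}"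
        by (rule finite_subset[OF _ finite_compositions[of k]]) auto
    qed (auto simp: I0_set_def I_set_def compositions_def)
    then show "(\<Sum>ks\<in>{ks \<in> compositions k. length ks = i}. ?g ks) = \<mu> ^ i * (\<Sum>ks\<in>I0_set k i. f ks)"
      by (simp add: sum_distrib_left)
  qed
  finally show ?thesis .
qed

text \<open>The ranges end at \<open>s + 5\<close>, \<open>s + 4\<close>, \<open>s + 3\<close> so
  that after multiplication by \<open>1\<close>, \<open>\<mu>\<close>, \<open>\<mu> ^ 2\<close> all
  three polynomials share the degree bound \<open>s + 5\<close>. Each range contains all lengths
  possible at weight \<open>s + 3\<close>.\<close>

lemma weighted_sum_generating:
  fixes t \<mu> :: real and s :: nat
  defines "LA i \<equiv> (\<Sum>ks\<in>I0_set (Suc (Suc (Suc s))) i. if length ks \<noteq> 1 then real_of_int (Ct_tilde ks) * zeta_t t ks else 0)"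
    and "LB i \<equiv> (\<Sum>ks\<in>I0_set (Suc (Suc (Suc s))) i. real_of_int (Ct ks - Ct_tilde ks) * zeta_t t ks)"
    and "LD i \<equiv> (\<Sum>ks\<in>I0_set (Suc (Suc (Suc s))) i. real (b_coef ks) * zeta_t t ks)"
  shows "(\<Sum>i\<le>s + 5. \<mu> ^ i * LA i) - t * \<mu> * (\<Sum>i\<le>s + 4. \<mu> ^ i * LB i)
      + (t - t ^ 2) * \<mu> ^ 2 * (\<Sum>i\<le>s + 3. \<mu> ^ i * LD i)
    = \<mu> * ((\<Sum>d\<le>s. rhs_part (Suc (Suc s)) (Suc d) (t * \<mu>) ((1 - t) * \<mu>))
        - t * \<mu> * hom_part (Suc (Suc s)) (Suc s) (t * \<mu>) ((1 - t) * \<mu>)) * mzv [Suc (Suc (Suc s))]"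
proof -
  let ?k = "Suc (Suc (Suc s))"
  interpret mzv_err \<mu> t ?k .
  let ?adm = "\<lambda>ks :: nat list. ks \<noteq> [] \<and> 2 \<le> hd ks"
  define coeff where "coeff = \<mu> * ((\<Sum>d\<le>s. rhs_part (Suc (Suc s)) (Suc d) (t * \<mu>) ((1 - t) * \<mu>))
        - t * \<mu> * hom_part (Suc (Suc s)) (Suc s) (t * \<mu>) ((1 - t) * \<mu>))"
  have \<mu>: "t * \<mu> + (1 - t) * \<mu> = \<mu>" by (simp add: algebra_simps)
  have coeff: "fps_nth main_coeffs ?k = coeff"
    using main_coeff_eq[where \<tau> = "t * \<mu>" and s = s and \<nu> = "(1 - t) * \<mu>"] unfolding \<mu>
    unfolding main_coeffs_nth coeff_def by (simp only: mult.commute[of \<mu> "1 - t"])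
  have fin: "(\<Sum>ks\<in>compositions ?k. \<mu> ^ length ks * termA t N ks)
      - t * \<mu> * (\<Sum>ks\<in>compositions ?k. \<mu> ^ length ks * termB t N ks)
      + (t - t ^ 2) * \<mu> ^ 2 * (\<Sum>ks\<in>compositions ?k. \<mu> ^ length ks * termD t N ks)
    = coeff * zeta_trunc 0 N [?k] + fls_nth (err N) (int ?k)" for N
  proof -
    have "fls_nth (\<Sum>j<N. main j) (int ?k) = coeff * zeta_trunc 0 N [?k]"
      unfolding fls_nth_sum main_eq hom_at_nth coeff by (simp add: sum_distrib_left del: of_nat_Suc power_Suc)
    with arg_cong[OF gen_identity'[of N], of "\<lambda>f. fls_nth f (int ?k)"]
    show ?thesis by (simp only: fls_plus_nth fls_minus_nth fls_mult_const_nth gen_nth)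
  qed
  have "(\<lambda>N. (\<Sum>ks\<in>compositions ?k. \<mu> ^ length ks * termA t N ks)
      - t * \<mu> * (\<Sum>ks\<in>compositions ?k. \<mu> ^ length ks * termB t N ks)
      + (t - t ^ 2) * \<mu> ^ 2 * (\<Sum>ks\<in>compositions ?k. \<mu> ^ length ks * termD t N ks))
    \<longlonglongrightarrow> (\<Sum>ks\<in>compositions ?k. \<mu> ^ length ks * (if ?adm ks \<and> length ks \<noteq> 1 then real_of_int (Ct_tilde ks) * zeta_t t ks else 0))
      - t * \<mu> * (\<Sum>ks\<in>compositions ?k. \<mu> ^ length ks * (if ?adm ks then real_of_int (Ct ks - Ct_tilde ks) * zeta_t t ks else 0))
      + (t - t ^ 2) * \<mu> ^ 2 * (\<Sum>ks\<in>compositions ?k. \<mu> ^ length ks * (if ?adm ks then real (b_coef ks) * zeta_t t ks else 0))"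
    by (intro tendsto_add tendsto_diff tendsto_mult_left tendsto_sum term_tendsto) (auto simp: compositions_def)
  moreover have "(\<lambda>N. coeff * zeta_trunc 0 N [?k] + fls_nth (err N) (int ?k)) \<longlonglongrightarrow> coeff * mzv [?k] + 0"
    by (intro tendsto_add tendsto_mult_left zeta_trunc_0_tendsto err_coeff_tendsto_0) auto
  ultimately have "(\<Sum>ks\<in>compositions ?k. \<mu> ^ length ks * (if ?adm ks \<and> length ks \<noteq> 1 then real_of_int (Ct_tilde ks) * zeta_t t ks else 0))
      - t * \<mu> * (\<Sum>ks\<in>compositions ?k. \<mu> ^ length ks * (if ?adm ks then real_of_int (Ct ks - Ct_tilde ks) * zeta_t t ks else 0))
      + (t - t ^ 2) * \<mu> ^ 2 * (\<Sum>ks\<in>compositions ?k. \<mu> ^ length ks * (if ?adm ks then real (b_coef ks) * zeta_t t ks else 0))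
      = coeff * mzv [?k]"
    unfolding fin using LIMSEQ_unique by fastforce
  moreover have "(\<Sum>ks\<in>compositions ?k. \<mu> ^ length ks * (if ?adm ks \<and> length ks \<noteq> 1 then real_of_int (Ct_tilde ks) * zeta_t t ks else 0))
      = (\<Sum>i\<le>s + 5. \<mu> ^ i * LA i)"
    unfolding LA_def by (subst sum_compositions_by_length[symmetric]) (auto intro!: sum.cong)
  moreover have "(\<Sum>ks\<in>compositions ?k. \<mu> ^ length ks * (if ?adm ks then real_of_int (Ct ks - Ct_tilde ks) * zeta_t t ks else 0))
      = (\<Sum>i\<le>s + 4. \<mu> ^ i * LB i)"
    unfolding LB_def by (rule sum_compositions_by_length) simp
  moreover have "(\<Sum>ks\<in>compositions ?k. \<mu> ^ length ks * (if ?adm ks then real (b_coef ks) * zeta_t t ks else 0))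
      = (\<Sum>i\<le>s + 3. \<mu> ^ i * LD i)"
    unfolding LD_def by (rule sum_compositions_by_length) simp
  ultimately show ?thesis by (simp only: coeff_def)
qed

lemma rhs_part_homogeneous: "rhs_part K d (t * \<mu>) ((1 - t) * \<mu>) = \<mu> ^ d * rhs_part K d t (1 - t)"
proof -
  have *: "(t * \<mu>) ^ i * ((1 - t) * \<mu>) ^ (d - i) = \<mu> ^ d * (t ^ i * (1 - t) ^ (d - i))" if "i \<in> {1..d - 1}" for i
  proof -
    have "i + (d - i) = d" using that by auto
    then have "\<mu> ^ d = \<mu> ^ i * \<mu> ^ (d - i)" by (metis power_add)
    then show ?thesis by (simp add: power_mult_distrib)
  qed
  have S: "(\<Sum>i=1..d - 1. C i * ((t * \<mu>) ^ i * ((1 - t) * \<mu>) ^ (d - i)))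
      = \<mu> ^ d * (\<Sum>i=1..d - 1. C i * (t ^ i * (1 - t) ^ (d - i)))" for C :: "nat \<Rightarrow> real"
    unfolding sum_distrib_left by (rule sum.cong[OF refl]) (simp only: * mult.left_commute)
  then show ?thesis
    unfolding rhs_part_def S power_mult_distrib[of t \<mu> d] power_mult_distrib[of "1 - t" \<mu> d]
    by (simp only: distrib_left mult_ac)
qed

lemma hom_part_homogeneous: "hom_part K d (t * \<mu>) ((1 - t) * \<mu>) = \<mu> ^ d * hom_part K d t (1 - t)"
proof -
  have "(t * \<mu>) ^ i * ((1 - t) * \<mu>) ^ (d - i) = \<mu> ^ d * (t ^ i * (1 - t) ^ (d - i))" if "i \<in> {..d}" for i
  proof -
    have "i + (d - i) = d" using that by auto
    then have "\<mu> ^ d = \<mu> ^ i * \<mu> ^ (d - i)" by (metis power_add)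
    then show ?thesis by (simp add: power_mult_distrib)
  qed
  then show ?thesis
    unfolding hom_part_def by (simp add: sum_distrib_left mult_ac cong: sum.cong_simp)
qed

theorem theorem3p11:
  fixes k n :: nat and t :: real
  assumes "2 \<le> n" and "n < k"
  shows "(\<Sum>ks\<in>I0_set k n. real_of_int (Ct_tilde ks) * zeta_t t ks)
       - t * (\<Sum>ks\<in>I0_set k (n - 1). real_of_int (Ct ks - Ct_tilde ks) * zeta_t t ks)
       + (t - t ^ 2) * (\<Sum>ks\<in>I0_set k (n - 2). real (b_coef ks) * zeta_t t ks)
     = ((\<Sum>i=1..n-2. (real k * real ((k - 1) choose i)
              - (real k - real n + 1) * real ((k - 1) choose (i - 1))) * t ^ i * (1 - t) ^ (n - 1 - i))
        + real k * (1 - t) ^ (n - 1) + real ((k - 1) choose (n - 1)) * t ^ (n - 1)) * mzv [k]"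
proof -
  define s where "s = k - 3"
  have k: "k = Suc (Suc (Suc s))" using assms by (simp add: s_def)
  define LA where "LA i = (\<Sum>ks\<in>I0_set k i. if length ks \<noteq> 1 then real_of_int (Ct_tilde ks) * zeta_t t ks else 0)" for i
  define LB where "LB i = (\<Sum>ks\<in>I0_set k i. real_of_int (Ct ks - Ct_tilde ks) * zeta_t t ks)" for i
  define LD where "LD i = (\<Sum>ks\<in>I0_set k i. real (b_coef ks) * zeta_t t ks)" for i
  define L where "L i = LA i - t * (if 1 \<le> i then LB (i - 1) else 0) + (t - t ^ 2) * (if 2 \<le> i then LD (i - 2) else 0)" for i
  \<comment> \<open>The exponent \<open>k\<close> carries the leftover term of top degree, which the
    hypothesis \<open>n < k\<close> keeps out of the result.\<close>
  define r where "r i = (if 2 \<le> i \<and> i < k then rhs_part (k - 1) (i - 1) t (1 - t) * mzv [k]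
    else if i = k then - (t * hom_part (k - 1) (k - 2) t (1 - t)) * mzv [k] else 0)" for i
  have "(\<Sum>i\<le>s + 5. L i * \<mu> ^ i) = (\<Sum>i\<le>s + 5. r i * \<mu> ^ i)" for \<mu>
  proof -
    have sB: "(\<Sum>i\<le>s + 5. (if 1 \<le> i then LB (i - 1) else 0) * \<mu> ^ i) = \<mu> * (\<Sum>i\<le>s + 4. \<mu> ^ i * LB i)"
    proof -
      have "s + 5 = Suc (s + 4)" by simp
      then show ?thesis by (simp only: sum.atMost_Suc_shift) (simp add: sum_distrib_left mult_ac)
    qed
    have sD: "(\<Sum>i\<le>s + 5. (if 2 \<le> i then LD (i - 2) else 0) * \<mu> ^ i) = \<mu> ^ 2 * (\<Sum>i\<le>s + 3. \<mu> ^ i * LD i)"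
    proof -
      have "s + 5 = Suc (Suc (s + 3))" by simp
      then show ?thesis
        by (simp only: sum.atMost_Suc_shift) (simp add: sum_distrib_left mult_ac power2_eq_square)
    qed
    have "(\<Sum>i\<le>s + 5. L i * \<mu> ^ i) = (\<Sum>i\<le>s + 5. \<mu> ^ i * LA i)
        - t * (\<Sum>i\<le>s + 5. (if 1 \<le> i then LB (i - 1) else 0) * \<mu> ^ i)
        + (t - t ^ 2) * (\<Sum>i\<le>s + 5. (if 2 \<le> i then LD (i - 2) else 0) * \<mu> ^ i)"
      unfolding L_def sum_distrib_left sum_subtractf[symmetric] sum.distrib[symmetric]
      by (rule sum.cong[OF refl]) (simp only: algebra_simps)
    also have "\<dots> = \<mu> * ((\<Sum>d\<le>s. rhs_part (Suc (Suc s)) (Suc d) (t * \<mu>) ((1 - t) * \<mu>))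
        - t * \<mu> * hom_part (Suc (Suc s)) (Suc s) (t * \<mu>) ((1 - t) * \<mu>)) * mzv [k]"
      unfolding sB sD using weighted_sum_generating[where t = t and \<mu> = \<mu> and s = s]
      unfolding LA_def LB_def LD_def k by (simp only: mult.assoc)
    also have "\<dots> = (\<Sum>d\<le>s. rhs_part (Suc (Suc s)) (Suc d) t (1 - t) * mzv [k] * \<mu> ^ Suc (Suc d))
        + - (t * hom_part (Suc (Suc s)) (Suc s) t (1 - t)) * mzv [k] * \<mu> ^ k"
      unfolding rhs_part_homogeneous hom_part_homogeneous k
      by (simp add: sum_distrib_left sum_distrib_right algebra_simps)
    also have "\<dots> = (\<Sum>i\<le>s + 5. r i * \<mu> ^ i)"
    proof -
      have "(\<Sum>i\<le>s + 5. r i * \<mu> ^ i) = (\<Sum>i\<le>Suc (Suc (Suc s)). r i * \<mu> ^ i)"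
        by (rule sum.mono_neutral_right) (auto simp: r_def k)
      also have "\<dots> = (\<Sum>i\<le>Suc (Suc s). r i * \<mu> ^ i) + r k * \<mu> ^ k" unfolding k by simp
      also have "(\<Sum>i\<le>Suc (Suc s). r i * \<mu> ^ i) = r 0 * \<mu> ^ 0 + (r 1 * \<mu> ^ 1 + (\<Sum>d\<le>s. r (Suc (Suc d)) * \<mu> ^ Suc (Suc d)))"
        by (simp only: sum.atMost_Suc_shift One_nat_def)
      finally show ?thesis by (simp add: r_def k)
    qed
    finally show ?thesis .
  qed
  \<comment> \<open>The identity of polynomials holds for every real \<open>\<mu>\<close>, so the
    coefficients agree; the one at \<open>n\<close> combines the lengths \<open>n\<close>,
    \<open>n - 1\<close> and \<open>n - 2\<close>.\<close>
  then have "L n = r n"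
    using polyfun_eq_coeffs[of L "s + 5" r] assms k by simp
  moreover have "LA n = (\<Sum>ks\<in>I0_set k n. real_of_int (Ct_tilde ks) * zeta_t t ks)"
    unfolding LA_def using assms by (intro sum.cong) (auto simp: I0_set_def I_set_def)
  moreover have "r n = ((\<Sum>i=1..n-2. (real k * real ((k - 1) choose i)
              - (real k - real n + 1) * real ((k - 1) choose (i - 1))) * t ^ i * (1 - t) ^ (n - 1 - i))
        + real k * (1 - t) ^ (n - 1) + real ((k - 1) choose (n - 1)) * t ^ (n - 1)) * mzv [k]"
  proof -
    have "real k - real (n - 1) = real k - real n + 1" "n - 1 - 1 = n - 2" "Suc (k - 1) = k"
      using assms by auto
    then show ?thesis
      using assms unfolding r_def rhs_part_def by (simp only: mult.assoc simp_thms if_True)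
  qed
  ultimately show ?thesis
    using assms by (simp add: L_def LB_def LD_def)
qed

end
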